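(* Let $H=(X,E)$ be a hypergraph with $\bigcup E=X$, let $\mathbf{N}\in\mathbb{N}^E$, and let $\mathcal{C}_H(\le\mathbf{N})$ be the class of join queries on hypergraph $H$ satisfying the cardinality constraints $\mathbf{N}$. For every query $Q$ in $\mathcal{C}_H(\le\mathbf{N})$, with domain $D$, it is possible to uniformly sample $\mathsf{ans}(Q)$ with expected time $$\tilde{\mathcal{O}}\left(\frac{\mathsf{wc}(\mathcal{C}_H(\le\mathbf{N}))}{\max(1,|\mathsf{ans}(Q)|)}\cdot|X|\cdot\log(|D|)\cdot|E|\right).$$
   Context: **Join queries.** For finite sets $X$ (variables) and $D$ (domain), $D^X$ is the set of maps (tuples) $X\to D$; for $\tau\in D^Y$, $\tau_{|Z}$ is the restriction of $\tau$ to $Y\cap Z$. A relation $R$ is a finite subset of $D^{X_R}$, where $X_R$ is its set of variables. A join query $Q$ over $X$ and $D$ is a finite set of relations $R\subseteq D^{X_R}$ with $X_R\subseteq X$; its hypergraph is $(X,\{X_R:R\in Q\})$. $\mathsf{ans}(Q)=\{\tau\in D^X:\tau_{|X_R}\in R\text{ for all }R\in Q\}$. For a class $\mathcal{C}$ of join queries, $\mathsf{wc}(\mathcal{C})=\sup_{Q\in\mathcal{C}}|\mathsf{ans}(Q)|$. **Cardinality constraints.** $\mathcal{C}_H(\le\mathbf{N})$ is the class of join queries $Q$ on hypergraph $H$ (over arbitrary finite domains) such that for every $e\in E$ there is $R_e\in Q$ with $X_{R_e}=e$ and $|R_e|\le\mathbf{N}(e)$. **Conventions.** Uniformly sampling a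 finite set $S$ means outputting each element of $S$ with probability $1/|S|$ if $S\neq\emptyset$, and answering that $S$ is empty otherwise. $D$ is the active domain of $Q$ (the values occurring in its relations) and its values are encoded with $\mathcal{O}(\log|D|)$ bits. The notation $\tilde{\mathcal{O}}(\cdot)$ hides polylogarithmic factors in the relation sizes (in $\sum_{R\in Q}|R|$ and $|D|$) and factors depending on the query size (the hypergraph), which is considered constant; $\tilde{\mathcal{O}}(g)$ is read as $\tilde{\mathcal{O}}(\max(1,g))$. The relations are assumed to be given in a preprocessed form (encoded in binary and sorted lexicographically for the chosen variable order, or stored as tries annotated with cardinalities), so that for a partial assignment $\tau$ of a prefix of the variables (bit by bit), the number of tuples of each relation that agree with $\tau$ can be obtained in (poly)logarithmic time; the preprocessing is not counted in the expected time. *)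

theory Defs
  imports "HOL-Probability.SPMF" "HOL-Library.FuncSet" "HOL-Library.Log_Nat"
begin

section \<open>Join queries\<close>

text \<open>
  A relation carries its set of variables explicitly, as the empty set of tuples does not
  determine it. Domains are arbitrary finite sets of natural numbers: the universe of values only
  has to be infinite for a class of queries to range over finite domains of every size.
\<close>

type_synonym 'x tuple = "'x \<Rightarrow> nat"
type_synonym 'x rel = "'x set \<times> 'x tuple set"

definition hypergraph :: "'x set \<Rightarrow> 'x set set \<Rightarrow> bool" where
  "hypergraph X E \<longleftrightarrow> finite X \<and> E \<subseteq> Pow X"

definition join_query :: "'x set \<Rightarrow> nat set \<Rightarrow> 'x rel set \<Rightarrow> bool" where
  "join_query X D Q \<longleftrightarrow> finite X \<and> finite D \<and> finite Q \<and>
     (\<forall>R\<in>Q. fst R \<subseteq> X \<and> snd R \<subseteq> (fst R \<rightarrow>\<^sub>E D))"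

definition active_domain :: "'x rel set \<Rightarrow> nat set" where
  "active_domain Q = (\<Union>R\<in>Q. \<Union>t\<in>snd R. t ` fst R)"

definition ans :: "'x set \<Rightarrow> nat set \<Rightarrow> 'x rel set \<Rightarrow> 'x tuple set" where
  "ans X D Q = {\<tau> \<in> X \<rightarrow>\<^sub>E D. \<forall>R\<in>Q. restrict \<tau> (fst R) \<in> snd R}"

text \<open>A class of queries over the variables \<open>X\<close> is a set of pairs of a domain and a query.\<close>

definition wc :: "'x set \<Rightarrow> (nat set \<times> 'x rel set) set \<Rightarrow> ennreal" where
  "wc X C = (\<Squnion>(D, Q)\<in>C. of_nat (card (ans X D Q)))"

definition card_class ::
    "'x set \<Rightarrow> 'x set set \<Rightarrow> ('x set \<Rightarrow> nat) \<Rightarrow> (nat set \<times> 'x rel set) set" where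
  "card_class X E N = {(D, Q). join_query X D Q \<and> fst ` Q = E \<and>
     (\<forall>e\<in>E. \<exists>R\<in>Q. fst R = e \<and> card (snd R) \<le> N e)}"


section \<open>Binary encodings and counting access to the relations\<close>

text \<open>
  Values are encoded by bit strings of a common length \<open>b\<close>. For the variable order \<open>vs\<close>, the
  \<open>k\<close>-th bit of the value of \<open>vs ! j\<close> sits at position \<open>j * b + k\<close> of the encoding of a tuple.
\<close>

definition is_encoding :: "nat set \<Rightarrow> nat \<Rightarrow> (nat \<Rightarrow> bool list) \<Rightarrow> bool" where
  "is_encoding D b enc \<longleftrightarrow> inj_on enc D \<and> (\<forall>d\<in>D. length (enc d) = b)"

definition enc_tuple :: "'x list \<Rightarrow> (nat \<Rightarrow> bool list) \<Rightarrow> 'x tuple \<Rightarrow> bool list" where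
  "enc_tuple vs enc \<tau> = concat (map (\<lambda>x. enc (\<tau> x)) vs)"

text \<open>
  The bit string \<open>w\<close> is a partial assignment of a prefix of the variables, the last of which may
  be known only up to a prefix of its bits. A tuple over \<open>Y\<close> agrees with \<open>w\<close> if it has the same
  bits at those positions of \<open>w\<close> that belong to variables in \<open>Y\<close>.
\<close>

definition agrees ::
    "'x list \<Rightarrow> nat \<Rightarrow> (nat \<Rightarrow> bool list) \<Rightarrow> bool list \<Rightarrow> 'x set \<Rightarrow> 'x tuple \<Rightarrow> bool" where
  "agrees vs b enc w Y t \<longleftrightarrow>
     (\<forall>j<length vs. \<forall>k<b. vs ! j \<in> Y \<and> j * b + k < length w \<longrightarrow>
        enc (t (vs ! j)) ! k = w ! (j * b + k))"

definition count_access ::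
    "'x list \<Rightarrow> nat \<Rightarrow> (nat \<Rightarrow> bool list) \<Rightarrow> 'x rel list \<Rightarrow> nat \<Rightarrow> bool list \<Rightarrow> nat" where
  "count_access vs b enc Rs i w =
     (if i < length Rs then card {t \<in> snd (Rs ! i). agrees vs b enc w (fst (Rs ! i)) t} else 0)"


section \<open>Randomised random-access programs with logarithmic cost\<close>

text \<open>
  A memory maps addresses to natural numbers of unbounded size; an instruction is charged the
  binary length of the numbers it handles. The arguments of an instruction are fixed addresses
  (\<open>Const\<close> also has a constant), the first one being the destination.
  Indirect access is by \<open>Load\<close> and \<open>Store\<close>. The only source of randomness is a fair coin.
  \<open>Count a i p l\<close> is the only access to the data: if the cells \<open>i\<close>, \<open>p\<close>, \<open>l\<close> contain \<open>i'\<close>, \<open>p'\<close>, \<open>l'\<close>,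
  it counts the tuples of the \<open>i'\<close>-th relation that agree with the \<open>l'\<close> bits stored from address \<open>p'\<close> on.
\<close>

datatype binop = Add | Sub | Mul | Div

primrec apply_binop :: "binop \<Rightarrow> nat \<Rightarrow> nat \<Rightarrow> nat" where
  "apply_binop Add m n = m + n"
| "apply_binop Sub m n = m - n"
| "apply_binop Mul m n = m * n"
| "apply_binop Div m n = m div n"

datatype prog =
    Skip
  | Const nat nat
  | Op binop nat nat nat
  | Load nat nat
  | Store nat nat
  | Flip nat
  | Count nat nat nat nat
  | Seq prog prog
  | Cond nat prog prog
  | While nat prog

type_synonym memory = "nat \<Rightarrow> nat"

text \<open>A configuration is a memory together with the time spent so far.\<close>

type_synonym config = "memory \<times> nat"

text \<open>\<open>floorlog 2 n\<close> is the number of binary digits of \<open>n\<close>.\<close>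

fun test :: "nat \<Rightarrow> config \<Rightarrow> config" where
  "test a (M, t) = (M, t + 1 + floorlog 2 (M a))"

definition bits_at :: "memory \<Rightarrow> nat \<Rightarrow> nat \<Rightarrow> bool list" where
  "bits_at M p l = map (\<lambda>j. M (p + j) \<noteq> 0) [0..<l]"

partial_function (spmf) loop ::
    "nat \<Rightarrow> (config \<Rightarrow> config spmf) \<Rightarrow> config \<Rightarrow> config spmf" where
  "loop a body s =
     (if fst s a = 0 then return_spmf (test a s)
      else bind_spmf (body (test a s)) (loop a body))"

text \<open>
  The parameter \<open>cnt\<close> is the counting access to the relations, \<open>q\<close> the time taken by one such
  access (in addition to reading its arguments).
\<close>

primrec exec :: "(nat \<Rightarrow> bool list \<Rightarrow> nat) \<Rightarrow> nat \<Rightarrow> prog \<Rightarrow> config \<Rightarrow> config spmf" where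
  "exec cnt q Skip = (\<lambda>(M, t). return_spmf (M, t + 1))"
| "exec cnt q (Const a n) = (\<lambda>(M, t). return_spmf (M(a := n), t + 1 + floorlog 2 n))"
| "exec cnt q (Op f a x y) = (\<lambda>(M, t). return_spmf
     (M(a := apply_binop f (M x) (M y)), t + 1 + floorlog 2 (M x) + floorlog 2 (M y)))"
| "exec cnt q (Load a x) = (\<lambda>(M, t). return_spmf
     (M(a := M (M x)), t + 1 + floorlog 2 (M x) + floorlog 2 (M (M x))))"
| "exec cnt q (Store a x) = (\<lambda>(M, t). return_spmf
     (M(M a := M x), t + 1 + floorlog 2 (M a) + floorlog 2 (M x)))"
| "exec cnt q (Flip a) = (\<lambda>(M, t). map_spmf (\<lambda>c. (M(a := of_bool c), t + 1)) coin_spmf)"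
| "exec cnt q (Count a i p l) = (\<lambda>(M, t). return_spmf
     (M(a := cnt (M i) (bits_at M (M p) (M l))),
      t + 1 + q + M l + floorlog 2 (M i) + floorlog 2 (M p) + floorlog 2 (M l)))"
| "exec cnt q (Seq P P') = (\<lambda>s. bind_spmf (exec cnt q P s) (exec cnt q P'))"
| "exec cnt q (Cond a P P') = (\<lambda>s. if fst s a \<noteq> 0 then exec cnt q P (test a s)
                                    else exec cnt q P' (test a s))"
| "exec cnt q (While a P) = loop a (exec cnt q P)"

text \<open>Cell \<open>0\<close> initially holds the number \<open>b\<close> of bits per value; the rest of the memory is zero.\<close>

definition run :: "'x list \<Rightarrow> nat \<Rightarrow> (nat \<Rightarrow> bool list) \<Rightarrow> 'x rel list \<Rightarrow> nat \<Rightarrow> prog \<Rightarrow> config spmf" where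
  "run vs b enc Rs q P = exec (count_access vs b enc Rs) q P ((\<lambda>_. 0)(0 := b), 0)"

text \<open>
  On termination, a zero in cell \<open>0\<close> is the answer ``empty''; otherwise the sampled element is
  the bit string stored in the first \<open>m\<close> cells after cell \<open>0\<close>.
\<close>

definition answer :: "nat \<Rightarrow> config \<Rightarrow> bool list option" where
  "answer m s = (if fst s 0 = 0 then None else Some (bits_at (fst s) 1 m))"

definition uniform_or_empty :: "'a set \<Rightarrow> 'a option spmf" where
  "uniform_or_empty S = (if S = {} then return_spmf None else map_spmf Some (spmf_of_set S))"

text \<open>
  As the right-hand side has total mass 1 for finite \<open>S\<close>, this includes termination with
  probability 1.
\<close>

definition samples_uniformly ::
    "'x list \<Rightarrow> nat \<Rightarrow> (nat \<Rightarrow> bool list) \<Rightarrow> config spmf \<Rightarrow> 'x tuple set \<Rightarrow> bool" where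
  "samples_uniformly vs b enc p S \<longleftrightarrow>
     map_spmf (answer (length vs * b)) p =
     map_spmf (map_option (enc_tuple vs enc)) (uniform_or_empty S)"

text \<open>A run that fails to terminate with positive probability has infinite expected time.\<close>

definition expected_time :: "config spmf \<Rightarrow> ennreal" where
  "expected_time p =
     (if lossless_spmf p then \<integral>\<^sup>+ s. of_nat (snd s) \<partial>measure_spmf p else \<infinity>)"

text \<open>The logarithm of the size of the data, of which the hidden factors are powers.\<close>

definition log_size :: "nat set \<Rightarrow> 'x rel set \<Rightarrow> real" where
  "log_size D Q = log 2 (2 + real (\<Sum>R\<in>Q. card (snd R)) + real (card D))"

end

(*
  For a fractional edge cover p/m of the hypergraph, the function that maps a partial assignment w
  (a bit string) to the m-th root of the product of the counts n_i(w)^(p_i) is superadditive in the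
  next bit, by the inequality of Hoelder. This survives rounding down and taking the minimum over
  finitely many covers. By Fourier-Motzkin elimination applied to the dual linear program,
  finitely many covers with a common denominator m suffice to make the value U at the root at most
  2^|X| times the size of a product query, hence at most 2^|X| times the worst case.

  Superadditivity maps every answer to one budget r < U: walk down from the root, go to the child 0
  if r is below its estimate, otherwise subtract that estimate and go to the child 1. The sampler
  draws r uniformly below a power of two less than 2 U until r is the budget of an answer. To
  recognise an empty answer set it also tests the budgets 0, 1, 2, ... in turn, one in each round
  in which the draw fails, and stops if all of them fail.
*)

theory Submission
  imports Defs
begin

section \<open>Fractional covers by Fourier-Motzkin elimination\<close>

text \<open>The program is fixed before the relation sizes are known, while the best fractional
  cover depends on them. So the optimum becomes a minimum over a finite stock of covers that
  contains an optimal one for all sizes. Optimality is witnessed by a dual solution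
  \<open>y\<close>, which is also a worst-case instance: give each variable \<open>x\<close> about
  \<open>exp (y x)\<close> values and take full products as relations. The factor 2^|X| is the price
  of rounding \<open>exp (y x)\<close> down, at most 2 per variable as \<open>y x \<ge> 0\<close>.
  Memory holds natural numbers, hence the integer root; superadditivity survives it because it is
  proved between m-th powers of integers. The power of two is due to fair coins being the only
  randomness. Random draws alone never certify emptiness, and a time of about U / |ans| forbids a
  scan of all budgets. So the scan is interleaved, moves past failing budgets only and never outputs
  an answer. If answers exist, it halts at the first budget of an answer, cannot end the loop and
  leaves the output uniform; if none exists, U rounds suffice.\<close>

lemma finite_sandwich:
  fixes f :: "'a \<Rightarrow> real" and g :: "'b \<Rightarrow> real"
  assumes "finite A" "finite B" "\<And>a b. a \<in> A \<Longrightarrow> b \<in> B \<Longrightarrow> f a \<le> g b"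
  shows "\<exists>z. (\<forall>a\<in>A. f a \<le> z) \<and> (\<forall>b\<in>B. z \<le> g b)"
proof (cases "A = {}")
  case True
  show ?thesis
  proof (cases "B = {}")
    case False
    then show ?thesis using True assms(2) by (intro exI[of _ "Min (g ` B)"]) auto
  qed (use True in auto)
next
  case False
  then show ?thesis using assms by (intro exI[of _ "Max (f ` A)"]) auto
qed

text \<open>
  The multipliers of the derived inequalities do not depend on the right-hand sides \<open>b\<close>; this is why
  finitely many covers serve all relation sizes.
\<close>

lemma fourier_motzkin:
  fixes A :: "'i \<Rightarrow> 'v \<Rightarrow> int"
  assumes "finite V" "finite I" "W \<subseteq> V"
  shows "\<exists>\<Lambda>::('i \<Rightarrow> nat) set. finite \<Lambda> \<and>
    (\<forall>l\<in>\<Lambda>. \<forall>v\<in>W. (\<Sum>i\<in>I. int (l i) * A i v) = 0) \<and>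
    (\<forall>(b::'i \<Rightarrow> real) (y::'v \<Rightarrow> real).
       (\<forall>l\<in>\<Lambda>. (\<Sum>i\<in>I. real (l i) * (\<Sum>v\<in>V. A i v * y v)) \<le> (\<Sum>i\<in>I. real (l i) * b i)) \<longrightarrow>
       (\<exists>y'::'v \<Rightarrow> real. (\<forall>v. v \<notin> W \<longrightarrow> y' v = y v) \<and> (\<forall>i\<in>I. (\<Sum>v\<in>V. A i v * y' v) \<le> b i)))"
proof -
  have "finite W" using assms finite_subset by blast
  then show ?thesis using assms(3)
  proof (induction W rule: finite_induct)
    case empty
    \<comment> \<open>With nothing eliminated, the multipliers are the unit vectors, which return
      the given inequalities.\<close>
    let ?e = "\<lambda>i j. of_bool (j = i) :: nat"
    have "finite (?e ` I)" using assms(2) by simp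
    moreover have "(\<Sum>j\<in>I. real (?e i j) * f j) = f i" if "i \<in> I" for i and f :: "'i \<Rightarrow> real"
      using that assms(2) by (simp add: of_bool_def if_distrib[of real] if_distrib[of "\<lambda>z. z * _"] cong: if_cong)
    ultimately show ?case by (intro exI[of _ "?e ` I"]) auto
  next
    case (insert v W)
    then obtain \<Lambda> :: "('i \<Rightarrow> nat) set" where fin: "finite \<Lambda>"
      and zero: "\<And>l u. l \<in> \<Lambda> \<Longrightarrow> u \<in> W \<Longrightarrow> (\<Sum>i\<in>I. int (l i) * A i u) = 0"
      and ext: "\<And>(b::'i \<Rightarrow> real) (y::'v \<Rightarrow> real).
       (\<forall>l\<in>\<Lambda>. (\<Sum>i\<in>I. real (l i) * (\<Sum>v\<in>V. A i v * y v)) \<le> (\<Sum>i\<in>I. real (l i) * b i)) \<Longrightarrow>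
       (\<exists>y'::'v \<Rightarrow> real. (\<forall>v. v \<notin> W \<longrightarrow> y' v = y v) \<and> (\<forall>i\<in>I. (\<Sum>v\<in>V. A i v * y' v) \<le> b i))"
      by auto
    define co where "co l u = (\<Sum>i\<in>I. int (l i) * A i u)" for l :: "'i \<Rightarrow> nat" and u
    \<comment> \<open>Crosswise weighting by the coefficients of \<open>v\<close> cancels
      \<open>v\<close>. With \<open>l\<close> from \<open>PP\<close> and \<open>l'\<close> from
      \<open>NN\<close> both weights are positive, so the multipliers stay natural numbers.\<close>
    define comb where "comb l l' i = nat (co l v) * l' i + nat (- co l' v) * l i"
      for l l' :: "'i \<Rightarrow> nat" and i
    define PP where "PP = {l\<in>\<Lambda>. co l v > 0}"
    define NN where "NN = {l\<in>\<Lambda>. co l v < 0}"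
    define \<Lambda>' where "\<Lambda>' = {l\<in>\<Lambda>. co l v = 0} \<union> (\<lambda>(l, l'). comb l l') ` (PP \<times> NN)"
    have finPN: "finite PP" "finite NN" using fin by (auto simp: PP_def NN_def)
    have co_comb: "co (comb l l') u = co l v * co l' u - co l' v * co l u"
      if "l \<in> PP" "l' \<in> NN" for l l' u
    proof -
      have "co (comb l l') u = (\<Sum>i\<in>I. co l v * (int (l' i) * A i u) + (- co l' v) * (int (l i) * A i u))"
        unfolding co_def[of "comb l l'"] using that
        by (intro sum.cong) (auto simp: comb_def PP_def NN_def algebra_simps)
      then show ?thesis by (simp add: sum.distrib sum_subtractf sum_distrib_left[symmetric] co_def[of l' u] co_def[of l u] sum_negf)
    qed
    have z: "co l u = 0" if l: "l \<in> \<Lambda>'" and u: "u \<in> insert v W" for l u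
    proof (cases "l \<in> \<Lambda>")
      case True
      with l u zero show ?thesis unfolding \<Lambda>'_def
        using co_comb by (auto simp: co_def PP_def NN_def)
    next
      case False
      then obtain p n where pn: "p \<in> PP" "n \<in> NN" "l = comb p n" using l by (auto simp: \<Lambda>'_def)
      have "co p u = 0 \<and> co n u = 0" if "u \<in> W"
        using pn zero that by (auto simp: PP_def NN_def co_def)
      then show ?thesis using u pn co_comb[of p n] by auto
    qed
    show ?case
    proof (intro exI[of _ \<Lambda>'] conjI allI impI ballI)
      show "finite \<Lambda>'" unfolding \<Lambda>'_def using finPN fin by auto
    next
      fix l u assume "l \<in> \<Lambda>'" "u \<in> insert v W"
      then show "(\<Sum>i\<in>I. int (l i) * A i u) = 0" using z by (auto simp: co_def)
    next
      fix b :: "'i \<Rightarrow> real" and y :: "'v \<Rightarrow> real" assume *: "\<forall>l\<in>\<Lambda>'. (\<Sum>i\<in>I. real (l i) * (\<Sum>v\<in>V. A i v * y v)) \<le> (\<Sum>i\<in>I. real (l i) * b i)"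
      \<comment> \<open>\<open>g l\<close> is the slack of the combination \<open>l\<close> at
        \<open>y\<close>. Moving \<open>y v\<close> by \<open>z\<close> turns row \<open>l\<close>
        into \<open>co l v * z \<le> g l\<close>: a lower bound on \<open>z\<close> for
        \<open>NN\<close>, an upper one for \<open>PP\<close>. The slack of \<open>comb\<close> is
        nonnegative exactly when the two are compatible.\<close>
      define g where "g l = (\<Sum>i\<in>I. real (l i) * (b i - (\<Sum>v\<in>V. A i v * y v)))" for l :: "'i \<Rightarrow> nat"
      have g: "0 \<le> g l" if "l \<in> \<Lambda>'" for l
        using * that by (auto simp: g_def right_diff_distrib sum_subtractf)
      have gc: "g (comb l l') = co l v * g l' - co l' v * g l" if "l \<in> PP" "l' \<in> NN" for l l'
      proof -
        have "g (comb l l') = (\<Sum>i\<in>I. co l v * (real (l' i) * (b i - (\<Sum>v\<in>V. A i v * y v)))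
            + (- co l' v) * (real (l i) * (b i - (\<Sum>v\<in>V. A i v * y v))))"
          unfolding g_def[of "comb l l'"] using that
          by (intro sum.cong) (auto simp: comb_def PP_def NN_def algebra_simps)
        then show ?thesis by (simp add: sum.distrib sum_subtractf sum_distrib_left[symmetric] g_def[of l'] g_def[of l] sum_negf)
      qed
      have "\<exists>z. (\<forall>l\<in>NN. g l / co l v \<le> z) \<and> (\<forall>l\<in>PP. z \<le> g l / co l v)"
      proof (intro finite_sandwich finPN)
        fix l' l assume l: "l' \<in> NN" "l \<in> PP"
        then have "comb l l' \<in> \<Lambda>'" by (auto simp: \<Lambda>'_def)
        from g[OF this] gc l have "co l v * g l' \<ge> co l' v * g l" by simp
        moreover have "real_of_int (co l v) > 0" "real_of_int (co l' v) < 0"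
          using l by (auto simp: PP_def NN_def)
        ultimately show "g l' / co l' v \<le> g l / co l v"
          by (simp add: divide_simps mult.commute split: if_splits)
      qed
      then obtain z where z1: "\<And>l. l \<in> NN \<Longrightarrow> g l / co l v \<le> z" and z2: "\<And>l. l \<in> PP \<Longrightarrow> z \<le> g l / co l v"
        by blast
      have cz: "co l v * z \<le> g l" if "l \<in> \<Lambda>" for l
      proof -
        consider "l \<in> PP" | "l \<in> NN" | "co l v = 0"
          using \<open>l \<in> \<Lambda>\<close> linorder_less_linear[of "co l v" 0] by (auto simp: PP_def NN_def)
        then show ?thesis
        proof cases
          case 1 then show ?thesis using z2[OF 1] by (auto simp: PP_def field_simps)
        next
          case 2 then show ?thesis using z1[OF 2] by (auto simp: NN_def field_simps)
        next
          case 3 then have "l \<in> \<Lambda>'" using that by (auto simp: \<Lambda>'_def)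
          then show ?thesis using 3 g by auto
        qed
      qed
      let ?y = "y(v := y v + z)"
      have upd: "(\<Sum>u\<in>V. A i u * ?y u) = (\<Sum>u\<in>V. A i u * y u) + A i v * z" for i
      proof -
        have "(\<Sum>u\<in>V. A i u * ?y u) = (\<Sum>u\<in>V. A i u * y u + (if u = v then A i v * z else 0))"
          by (intro sum.cong) (auto simp: algebra_simps)
        also have "\<dots> = (\<Sum>u\<in>V. A i u * y u) + A i v * z"
          using insert.prems assms(1) by (simp add: sum.distrib)
        finally show ?thesis .
      qed
      have "\<forall>l\<in>\<Lambda>. (\<Sum>i\<in>I. real (l i) * (\<Sum>u\<in>V. A i u * ?y u)) \<le> (\<Sum>i\<in>I. real (l i) * b i)"
      proof
        fix l assume "l \<in> \<Lambda>"
        from cz[OF this] show "(\<Sum>i\<in>I. real (l i) * (\<Sum>u\<in>V. A i u * ?y u)) \<le> (\<Sum>i\<in>I. real (l i) * b i)"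
          unfolding upd
          by (simp add: g_def co_def algebra_simps sum.distrib sum_subtractf sum_distrib_left sum_distrib_right)
      qed
      from ext[OF this] obtain y' :: "'v \<Rightarrow> real" where "\<forall>u. u \<notin> W \<longrightarrow> y' u = ?y u"
        and "\<forall>i\<in>I. (\<Sum>v\<in>V. A i v * y' v) \<le> b i" by blast
      then show "\<exists>y'::'v \<Rightarrow> real. (\<forall>u. u \<notin> insert v W \<longrightarrow> y' u = y u) \<and> (\<forall>i\<in>I. (\<Sum>v\<in>V. A i v * y' v) \<le> b i)"
        by (intro exI[of _ y']) auto
    qed
  qed
qed

text \<open>Linear programming duality with a finite set of primal candidates. Eliminating all
  \<open>y x\<close> from the dual constraints together with a target
  \<open>t \<le> (\<Sum>x\<in>X. y x)\<close> leaves inequalities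
  \<open>n * t \<le> (\<Sum>i<r. p i * s i)\<close>. Each of them with \<open>n > 0\<close> is a
  fractional cover \<open>p / n\<close>, and the smallest of their values on \<open>s\<close> is a
  feasible target. One denominator \<open>m\<close> for all covers lets the estimate use a single
  root.\<close>

lemma fractional_covers:
  fixes e :: "nat \<Rightarrow> 'x set"
  assumes X: "finite X" and cov: "\<And>x. x \<in> X \<Longrightarrow> \<exists>i<r. x \<in> e i"
  obtains m :: nat and C :: "(nat \<Rightarrow> nat) set" where "m > 0" "finite C"
    "\<And>p x. p \<in> C \<Longrightarrow> x \<in> X \<Longrightarrow> m \<le> (\<Sum>i | i < r \<and> x \<in> e i. p i)"
    "\<And>s :: nat \<Rightarrow> real. (\<And>i. i < r \<Longrightarrow> 0 \<le> s i) \<Longrightarrow>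
       \<exists>p\<in>C. \<exists>y. (\<forall>x\<in>X. 0 \<le> y x) \<and> (\<forall>i<r. (\<Sum>x\<in>X \<inter> e i. y x) \<le> s i) \<and>
         (\<Sum>i<r. real (p i) * s i) \<le> real m * (\<Sum>x\<in>X. y x)"
proof -
  define I :: "('x + nat option) set" where "I = X <+> insert None (Some ` {..<r})"
  \<comment> \<open>The rows are \<open>- y x \<le> 0\<close> for \<open>Inl x\<close>, minus the
    sum of all \<open>y x\<close> at most \<open>- t\<close> for \<open>Inr None\<close>, and the
    bound \<open>s i\<close> of edge \<open>i\<close> for \<open>Inr (Some i)\<close>.\<close>
  define A :: "'x + nat option \<Rightarrow> 'x \<Rightarrow> int" where
    "A j u = (case j of Inl x \<Rightarrow> - of_bool (u = x) | Inr None \<Rightarrow> -1 | Inr (Some i) \<Rightarrow> of_bool (u \<in> e i))" for j u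
  have sumI: "sum f I = (\<Sum>x\<in>X. f (Inl x)) + f (Inr None) + (\<Sum>i<r. f (Inr (Some i)))"
    for f :: "_ \<Rightarrow> 'z::comm_monoid_add"
    using X by (simp add: I_def sum.Plus sum.reindex add.assoc)
  have "finite I" using X by (simp add: I_def)
  from fourier_motzkin[OF X this subset_refl, of A] obtain \<Lambda> :: "('x + nat option \<Rightarrow> nat) set"
    where fin: "finite \<Lambda>" and zero: "\<And>l u. l \<in> \<Lambda> \<Longrightarrow> u \<in> X \<Longrightarrow> (\<Sum>i\<in>I. int (l i) * A i u) = 0"
    and ext: "\<And>(b::_ \<Rightarrow> real) (y::'x \<Rightarrow> real).
       (\<forall>l\<in>\<Lambda>. (\<Sum>i\<in>I. real (l i) * (\<Sum>v\<in>X. A i v * y v)) \<le> (\<Sum>i\<in>I. real (l i) * b i)) \<Longrightarrow>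
       (\<exists>y'::'x \<Rightarrow> real. (\<forall>v. v \<notin> X \<longrightarrow> y' v = y v) \<and> (\<forall>i\<in>I. (\<Sum>v\<in>X. A i v * y' v) \<le> b i))"
    by auto
  \<comment> \<open>A pair is a cover with its denominator, the latter being the multiplier of the
    target row. The all-ones cover makes the set nonempty, so that a minimum over it exists.\<close>
  define C0 where "C0 = insert (\<lambda>_. 1, 1)
    ((\<lambda>l. (\<lambda>i. l (Inr (Some i)), l (Inr None))) ` {l\<in>\<Lambda>. l (Inr None) > 0})"
  have finC0: "finite C0" using fin by (simp add: C0_def)
  have C0pos: "n > 0" if "(p, n) \<in> C0" for p n using that by (auto simp: C0_def)
  have C0cov: "n \<le> (\<Sum>i | i < r \<and> x \<in> e i. p i)" if pn: "(p, n) \<in> C0" and x: "x \<in> X" for p n x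
  proof -
    have sub: "(\<Sum>i | i < r \<and> x \<in> e i. q i) = (\<Sum>i<r. q i * of_bool (x \<in> e i))" for q :: "nat \<Rightarrow> nat"
    proof -
      have eq: "{i. i < r \<and> x \<in> e i} = {i\<in>{..<r}. x \<in> e i}" by auto
      show ?thesis unfolding eq by (subst sum.inter_filter) (simp_all add: of_bool_def if_distrib[of "(*) _"] cong: if_cong)
    qed
    consider "p = (\<lambda>_. 1)" "n = 1" | l where "l \<in> \<Lambda>" "p = (\<lambda>i. l (Inr (Some i)))" "n = l (Inr None)"
      using pn by (auto simp: C0_def)
    then show ?thesis
    proof cases
      case 1
      from cov[OF x] have "{i. i < r \<and> x \<in> e i} \<noteq> {}" by auto
      then show ?thesis using 1 by (simp add: Suc_le_eq card_gt_0_iff)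
    next
      case 2
      have "(\<Sum>y\<in>X. int (l (Inl y)) * - of_bool (x = y)) = - int (l (Inl x))"
        using x X by (simp add: of_bool_def sum_negf if_distrib[of "(*) _"] cong: if_cong)
      \<comment> \<open>The coefficient of \<open>y x\<close> vanishes in the combination. The
        multiplier of \<open>- y x \<le> 0\<close> is nonnegative, and dropping it leaves the cover
        inequality at \<open>x\<close>.\<close>
      then have "- int (l (Inl x)) - int (l (Inr None)) + (\<Sum>i<r. int (l (Inr (Some i))) * of_bool (x \<in> e i)) = 0"
        using zero[OF 2(1) x] by (simp add: sumI A_def)
      then have "int (l (Inr None)) \<le> (\<Sum>i<r. int (l (Inr (Some i))) * of_bool (x \<in> e i))" by linarith
      also have "\<dots> = int (\<Sum>i<r. l (Inr (Some i)) * of_bool (x \<in> e i))" by simp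
      finally show ?thesis using 2 unfolding sub by (simp only: of_nat_le_iff)
    qed
  qed
  \<comment> \<open>A common denominator: each \<open>n\<close> divides the product, so
    \<open>m div n\<close> is exact and \<open>p\<close> is rescaled within the natural
    numbers.\<close>
  define m where "m = (\<Prod>(p, n)\<in>C0. n)"
  define C where "C = (\<lambda>(p, n). \<lambda>i. p i * (m div n)) ` C0"
  have dv: "n * (m div n) = m" if "(p, n) \<in> C0" for p n
  proof -
    have "n dvd m" unfolding m_def using dvd_prodI[OF finC0 that, of "\<lambda>(p, n). n"] by simp
    then show ?thesis by simp
  qed
  show ?thesis
  proof (rule that[of m C])
    show "m > 0" unfolding m_def using C0pos by (intro prod_pos) auto
    show "finite C" using finC0 by (simp add: C_def)
    show "m \<le> (\<Sum>i | i < r \<and> x \<in> e i. p i)" if "p \<in> C" "x \<in> X" for p x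
    proof -
      from that obtain p' n where pn: "(p', n) \<in> C0" "p = (\<lambda>i. p' i * (m div n))" by (auto simp: C_def)
      have "m = n * (m div n)" using dv pn by simp
      also have "\<dots> \<le> (\<Sum>i | i < r \<and> x \<in> e i. p' i) * (m div n)"
        by (intro mult_right_mono C0cov[OF pn(1) that(2)]) simp
      finally show ?thesis by (simp add: pn sum_distrib_right)
    qed
    fix s :: "nat \<Rightarrow> real" assume s: "\<And>i. i < r \<Longrightarrow> 0 \<le> s i"
    define ra where "ra = (\<lambda>(p, n). (\<Sum>i<r. real (p i) * s i) / real n)"
    \<comment> \<open>\<open>t\<close> is the least value of a cover on \<open>s\<close>, so all
      rows left by the elimination hold at the target \<open>t\<close>: those with a positive
      multiplier of \<open>t\<close> by minimality, the others because \<open>s\<close> is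
      nonnegative.\<close>
    define t where "t = Min (ra ` C0)"
    have "ra ` C0 \<noteq> {}" by (auto simp: C0_def)
    then have "t \<in> ra ` C0" unfolding t_def using finC0 by (intro Min_in) auto
    then obtain p n where pn: "(p, n) \<in> C0" "t = (\<Sum>i<r. real (p i) * s i) / real n"
      by (auto simp: ra_def)
    have tle: "t \<le> ra z" if "z \<in> C0" for z using that finC0 by (simp add: t_def)
    define b where "b j = (case j of Inl x \<Rightarrow> 0 | Inr None \<Rightarrow> - t | Inr (Some i) \<Rightarrow> s i)" for j :: "'x + nat option"
    have "\<forall>l\<in>\<Lambda>. (\<Sum>i\<in>I. real (l i) * (\<Sum>v\<in>X. real_of_int (A i v) * 0)) \<le> (\<Sum>i\<in>I. real (l i) * b i)"
    proof
      fix l assume l: "l \<in> \<Lambda>"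
      have "real (l (Inr None)) * t \<le> (\<Sum>i<r. real (l (Inr (Some i))) * s i)"
      proof (cases "l (Inr None) = 0")
        case True
        then show ?thesis using s by (auto intro!: sum_nonneg)
      next
        case False
        then have "(\<lambda>i. l (Inr (Some i)), l (Inr None)) \<in> C0" using l by (auto simp: C0_def)
        from tle[OF this] False show ?thesis by (simp add: ra_def field_simps)
      qed
      then show "(\<Sum>i\<in>I. real (l i) * (\<Sum>v\<in>X. real_of_int (A i v) * 0)) \<le> (\<Sum>i\<in>I. real (l i) * b i)"
        by (simp add: sumI b_def)
    qed
    from ext[of "\<lambda>_. 0" b, OF this] obtain y :: "'x \<Rightarrow> real" where
      y: "\<And>i. i \<in> I \<Longrightarrow> (\<Sum>v\<in>X. A i v * y v) \<le> b i" by blast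
    have "0 \<le> y x" if "x \<in> X" for x
    proof -
      have "(\<Sum>v\<in>X. - of_bool (v = x) * y v) = - y x"
        using that X by (simp add: of_bool_def sum_negf if_distrib[of uminus] if_distrib[of "\<lambda>z. z * _"] cong: if_cong)
      then show ?thesis using y[of "Inl x"] that by (simp add: InlI InrI I_def A_def b_def)
    qed
    moreover have "(\<Sum>x\<in>X \<inter> e i. y x) \<le> s i" if "i < r" for i
    proof -
      have "(\<Sum>x\<in>X. of_bool (x \<in> e i) * y x) = (\<Sum>x\<in>X \<inter> e i. y x)"
        using X by (simp add: of_bool_def sum.inter_restrict if_distrib[of "\<lambda>z. z * _"] cong: if_cong)
      then show ?thesis using y[of "Inr (Some i)"] that by (simp add: InlI InrI I_def A_def b_def)
    qed
    moreover have "t \<le> (\<Sum>x\<in>X. y x)"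
      using y[of "Inr None"] by (simp add: InlI InrI I_def A_def b_def sum_negf)
    moreover have "(\<Sum>i<r. real (p i * (m div n)) * s i) = real m * t"
    proof -
      have "real n * real (m div n) = real m" using dv[OF pn(1)] by (metis of_nat_mult)
      then have "real m * t = real (m div n) * (\<Sum>i<r. real (p i) * s i)"
        using C0pos[OF pn(1)] unfolding pn(2) by (simp add: field_simps)
      then show ?thesis by (simp add: sum_distrib_left algebra_simps)
    qed
    moreover have "(\<lambda>i. p i * (m div n)) \<in> C" using pn by (auto simp: C_def)
    ultimately show "\<exists>p\<in>C. \<exists>y. (\<forall>x\<in>X. 0 \<le> y x) \<and> (\<forall>i<r. (\<Sum>x\<in>X \<inter> e i. y x) \<le> s i) \<and>
         (\<Sum>i<r. real (p i) * s i) \<le> real m * (\<Sum>x\<in>X. y x)"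
      using \<open>m > 0\<close> by (intro bexI[of _ "\<lambda>i. p i * (m div n)"] exI[of _ y]) (auto intro!: mult_left_mono)
  qed
qed

section \<open>A weighted inequality of Hoelder type\<close>

text \<open>The arithmetic-geometric mean inequality for the family in which \<open>a i\<close>
  occurs \<open>p i\<close> times. Its exponent is one over the sum of the \<open>p i\<close>; as
  the product is at most 1, the larger exponent \<open>1 / m\<close> only makes it smaller.\<close>

lemma weighted_geom_mean_ratio:
  fixes a n :: "'i \<Rightarrow> real" and p :: "'i \<Rightarrow> nat"
  assumes S: "finite S" and m: "m > 0" "m \<le> (\<Sum>i\<in>S. p i)"
    and a: "\<And>i. i \<in> S \<Longrightarrow> 0 \<le> a i \<and> a i \<le> 1"
  shows "(\<Prod>i\<in>S. a i ^ p i) powr (1 / m) \<le> (\<Sum>i\<in>S. real (p i) * a i) / (\<Sum>i\<in>S. p i)"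
proof -
  define T where "T = Sigma S (\<lambda>i. {..<p i})"
  have fT: "finite T" using S by (auto simp: T_def)
  have cT: "card T = (\<Sum>i\<in>S. p i)" using S by (simp add: T_def)
  with m have T0: "T \<noteq> {}" by auto
  have pr: "(\<Prod>(i, k)\<in>T. a i) = (\<Prod>i\<in>S. a i ^ p i)"
    using S by (simp add: T_def prod.Sigma[symmetric])
  have su: "(\<Sum>(i, k)\<in>T. a i / card T) = (\<Sum>i\<in>S. real (p i) * a i) / card T"
    using S by (simp add: T_def sum.Sigma[symmetric] sum_divide_distrib)
  have ge0: "0 \<le> (\<Prod>i\<in>S. a i ^ p i)" using a by (intro prod_nonneg) auto
  have le1: "(\<Prod>i\<in>S. a i ^ p i) \<le> 1" using a by (intro prod_le_1) (auto intro: power_le_one)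
  have "(\<Prod>i\<in>S. a i ^ p i) powr (1 / m) \<le> (\<Prod>i\<in>S. a i ^ p i) powr (1 / card T)"
  proof (intro powr_mono' ge0 le1)
    show "1 / real (card T) \<le> 1 / real m" unfolding cT using m by (intro divide_left_mono) (auto simp del: of_nat_sum)
  qed
  also have "\<dots> = (\<Prod>z\<in>T. case z of (i, k) \<Rightarrow> a i) powr (1 / card T)" using pr by simp
  also have "\<dots> \<le> (\<Sum>z\<in>T. (case z of (i, k) \<Rightarrow> a i) / card T)"
    using a by (intro arith_geom_mean fT T0) (auto simp: T_def)
  also have "\<dots> = (\<Sum>(i, k)\<in>T. a i / card T)" by (intro sum.cong) auto
  finally show ?thesis using su cT by simp
qed

text \<open>Both \<open>u\<close> and \<open>v\<close> are at most the \<open>m\<close>-th root of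
  the right-hand side times a mean, with weights \<open>p i\<close>, of the ratios
  \<open>a i / (a i + b i)\<close> and \<open>b i / (a i + b i)\<close> respectively; the two means
  add up to 1. The factor \<open>z\<close> is for the relations without the variable at hand, whose
  counts do not split.\<close>

lemma holder_power:
  fixes a b p :: "'i \<Rightarrow> nat"
  assumes S: "finite S" and m: "m > 0" "m \<le> (\<Sum>i\<in>S. p i)"
    and u: "u ^ m \<le> (\<Prod>i\<in>S. a i ^ p i) * z" and v: "v ^ m \<le> (\<Prod>i\<in>S. b i ^ p i) * z"
  shows "(u + v) ^ m \<le> (\<Prod>i\<in>S. (a i + b i) ^ p i) * z"
proof (cases "\<exists>i\<in>S. p i > 0 \<and> a i + b i = 0")
  \<comment> \<open>A zero count with positive exponent would put a zero into the denominators. In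
    that case both products vanish, and with them \<open>u\<close> and \<open>v\<close>.\<close>
  case True
  then have "(\<Prod>i\<in>S. a i ^ p i) = 0" "(\<Prod>i\<in>S. b i ^ p i) = 0" using S by auto
  then have "u = 0" "v = 0" using u v m by auto
  then show ?thesis using m by (simp add: zero_power)
next
  case False
  define S' where "S' = {i\<in>S. p i > 0}"
  have S'S: "(\<Prod>i\<in>S. f i ^ p i) = (\<Prod>i\<in>S'. f i ^ p i)" for f :: "'i \<Rightarrow> nat"
    using S by (intro prod.mono_neutral_right) (auto simp: S'_def)
  have fS': "finite S'" using S by (simp add: S'_def)
  have "(\<Sum>i\<in>S. p i) = (\<Sum>i\<in>S'. p i)"
    using S by (intro sum.mono_neutral_right) (auto simp: S'_def)
  with m have m': "m \<le> (\<Sum>i\<in>S'. p i)" by simp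
  define n where "n i = a i + b i" for i
  have n0: "n i > 0" if "i \<in> S'" for i using that False by (auto simp: S'_def n_def)
  define N where "N = (\<Prod>i\<in>S'. n i ^ p i) * z"
  define \<sigma> where "\<sigma> = real (\<Sum>i\<in>S'. p i)"
  have \<sigma>: "\<sigma> > 0" using m m' by (simp add: \<sigma>_def del: of_nat_sum)
  have key: "real w \<le> (\<Sum>i\<in>S'. real (p i) * (c i / n i)) / \<sigma> * real N powr (1 / m)"
    if w: "w ^ m \<le> (\<Prod>i\<in>S'. c i ^ p i) * z" and c: "\<And>i. c i \<le> n i" for w c
  proof -
    let ?r = "\<lambda>i. real (c i) / real (n i)"
    have "(\<Prod>i\<in>S'. real (c i) ^ p i) = (\<Prod>i\<in>S'. ?r i ^ p i * real (n i) ^ p i)"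
      using n0 by (intro prod.cong) (auto simp: power_mult_distrib[symmetric])
    then have eq: "(\<Prod>i\<in>S'. real (c i) ^ p i) * real z = (\<Prod>i\<in>S'. ?r i ^ p i) * real N"
      by (simp add: prod.distrib N_def)
    have "real w powr real m = real (w ^ m)" using m by (cases "w = 0") (simp_all add: powr_realpow)
    also have "\<dots> \<le> real ((\<Prod>i\<in>S'. c i ^ p i) * z)" using w by (intro of_nat_mono)
    also have "\<dots> = (\<Prod>i\<in>S'. ?r i ^ p i) * real N" using eq by simp
    finally have "(real w powr real m) powr (1 / m) \<le> ((\<Prod>i\<in>S'. ?r i ^ p i) * real N) powr (1 / m)"
      by (intro powr_mono2) auto
    then have "real w \<le> ((\<Prod>i\<in>S'. ?r i ^ p i) * real N) powr (1 / m)"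
      using m by (simp add: powr_powr)
    also have "\<dots> = (\<Prod>i\<in>S'. ?r i ^ p i) powr (1 / m) * real N powr (1 / m)"
      by (rule powr_mult)
    also have "\<dots> \<le> (\<Sum>i\<in>S'. real (p i) * ?r i) / \<sigma> * real N powr (1 / m)"
      unfolding \<sigma>_def using n0 c by (intro mult_right_mono weighted_geom_mean_ratio fS' m m') auto
    finally show ?thesis .
  qed
  have split: "real (p i) * (a i / n i) + real (p i) * (b i / n i) = real (p i)" if "i \<in> S'" for i
    unfolding distrib_left[symmetric] add_divide_distrib[symmetric] of_nat_add[symmetric] n_def[symmetric]
    using n0[OF that] by simp
  have "(\<Sum>i\<in>S'. real (p i) * (a i / n i)) + (\<Sum>i\<in>S'. real (p i) * (b i / n i)) = (\<Sum>i\<in>S'. real (p i))"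
    unfolding sum.distrib[symmetric] using split by (rule sum.cong[OF refl])
  then have one: "(\<Sum>i\<in>S'. real (p i) * (a i / n i)) / \<sigma> + (\<Sum>i\<in>S'. real (p i) * (b i / n i)) / \<sigma> = 1"
    using \<sigma> by (simp add: \<sigma>_def add_divide_distrib[symmetric])
  have "real u + real v \<le> ((\<Sum>i\<in>S'. real (p i) * (a i / n i)) / \<sigma> + (\<Sum>i\<in>S'. real (p i) * (b i / n i)) / \<sigma>) * real N powr (1 / m)"
    unfolding distrib_right
    by (intro add_mono key) (use u v in \<open>auto simp: n_def S'S\<close>)
  then have le: "real (u + v) \<le> real N powr (1 / m)" unfolding one by simp
  have "real ((u + v) ^ m) = real (u + v) ^ m" by simp
  also have "\<dots> \<le> (real N powr (1 / m)) ^ m" by (intro power_mono le) auto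
  also have "\<dots> = real N"
    using m by (cases "N = 0") (simp_all add: powr_realpow[symmetric] powr_powr)
  finally have "(u + v) ^ m \<le> N" by linarith
  then show ?thesis by (simp add: N_def n_def S'S)
qed

section \<open>Loops with uniform random choices\<close>

text \<open>Makes fixpoint induction applicable to expected costs. The integral commutes with the
  supremum of the chain by monotone convergence. The chain itself may be uncountable; the
  countability of its joint support \<open>?C\<close> is what allows this.\<close>

lemma admissible_nn_integral_le:
  "ccpo.admissible lub_spmf (ord_spmf (=)) (\<lambda>p. (\<integral>\<^sup>+ x. f x \<partial>measure_spmf p) \<le> B)"
proof (rule ccpo.admissibleI)
  fix Y :: "'a spmf set"
  assume chain: "Complete_Partial_Order.chain (ord_spmf (=)) Y" and Y: "Y \<noteq> {}"
    and le: "\<forall>p\<in>Y. (\<integral>\<^sup>+ x. f x \<partial>measure_spmf p) \<le> B"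
  let ?C = "\<Union>p\<in>Y. set_spmf p"
  have sub: "(\<integral>\<^sup>+ x. f x \<partial>measure_spmf p) = (\<integral>\<^sup>+ x. ennreal (spmf p x) * f x \<partial>count_space ?C)"
    if "set_spmf p \<subseteq> ?C" for p
  proof -
    have "(\<integral>\<^sup>+ x. ennreal (spmf p x) * f x \<partial>count_space ?C) =
        (\<integral>\<^sup>+ x. ennreal (spmf p x) * f x * indicator ?C x \<partial>count_space UNIV)"
      by (simp add: nn_integral_count_space_indicator)
    also have "\<dots> = (\<integral>\<^sup>+ x. ennreal (spmf p x) * f x \<partial>count_space UNIV)"
      using that by (intro nn_integral_cong) (auto simp: spmf_eq_0_set_spmf split: split_indicator)
    finally show ?thesis by (simp add: nn_integral_measure_spmf)
  qed
  have "(\<integral>\<^sup>+ x. f x \<partial>measure_spmf (lub_spmf Y)) = (\<integral>\<^sup>+ x. ennreal (spmf (lub_spmf Y) x) * f x \<partial>count_space ?C)"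
    by (rule sub) (simp add: set_lub_spmf[OF chain])
  also have "\<dots> = (\<integral>\<^sup>+ x. (SUP p\<in>Y. ennreal (spmf p x) * f x) \<partial>count_space ?C)"
    using Y by (simp add: ennreal_spmf_lub_spmf[OF chain] SUP_mult_right_ennreal)
  also have "\<dots> = (SUP p\<in>Y. \<integral>\<^sup>+ x. ennreal (spmf p x) * f x \<partial>count_space ?C)"
  proof (rule nn_integral_monotone_convergence_SUP_countable[OF Y, where f = "\<lambda>p x. ennreal (spmf p x) * f x"])
    show "Complete_Partial_Order.chain (\<le>) ((\<lambda>p x. ennreal (spmf p x) * f x) ` Y)"
    proof (rule chainI)
      fix u v assume "u \<in> (\<lambda>p x. ennreal (spmf p x) * f x) ` Y" "v \<in> (\<lambda>p x. ennreal (spmf p x) * f x) ` Y"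
      then obtain p q where pq: "p \<in> Y" "q \<in> Y" "u = (\<lambda>x. ennreal (spmf p x) * f x)"
        "v = (\<lambda>x. ennreal (spmf q x) * f x)" by blast
      then have "ord_spmf (=) p q \<or> ord_spmf (=) q p" using chain by (auto dest: chainD)
      then show "u \<le> v \<or> v \<le> u"
        unfolding pq by (auto simp: le_fun_def intro!: mult_right_mono ennreal_leI dest: ord_spmf_eq_leD)
    qed
    show "countable ?C" by (rule spmf_chain_countable[OF chain])
  qed
  also have "\<dots> \<le> B"
    proof (intro SUP_least)
    fix p assume p: "p \<in> Y"
    then have "set_spmf p \<subseteq> ?C" by blast
    from sub[OF this] le p show "(\<integral>\<^sup>+ x. ennreal (spmf p x) * f x \<partial>count_space ?C) \<le> B" by metis
  qed
  finally show "(\<integral>\<^sup>+ x. f x \<partial>measure_spmf (lub_spmf Y)) \<le> B" .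
qed

text \<open>Park induction: a bound \<open>B\<close> that is preserved by one unfolding of the loop
  bounds the expectation over the least fixed point. Diverging runs contribute 0 to the integral, so
  termination has to be established separately.\<close>

lemma loop_nn_integral_le:
  assumes step: "\<And>s f. I s \<Longrightarrow> fst s a \<noteq> 0 \<Longrightarrow>
      (\<And>s'. I s' \<Longrightarrow> (\<integral>\<^sup>+ x. h x \<partial>measure_spmf (f s')) \<le> B s') \<Longrightarrow>
      (\<integral>\<^sup>+ x. h x \<partial>measure_spmf (bind_spmf (body (test a s)) f)) \<le> B s"
    and exit: "\<And>s. I s \<Longrightarrow> fst s a = 0 \<Longrightarrow> h (test a s) \<le> B s"
    and "I s"
  shows "(\<integral>\<^sup>+ x. h x \<partial>measure_spmf (loop a body s)) \<le> B s"
proof -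
  let ?P = "\<lambda>F. \<forall>a' body' s. a' = a \<and> body' = body \<and> I s \<longrightarrow>
    (\<integral>\<^sup>+ x. h x \<partial>measure_spmf (F a' body' s)) \<le> B s"
  have "?P loop"
  proof (rule loop.fixp_induct)
    have "spmf.admissible (\<lambda>F. \<forall>z. (\<lambda>z p. fst (fst z) = a \<and> snd (fst z) = body \<and> I (snd z) \<longrightarrow>
        (\<integral>\<^sup>+ x. h x \<partial>measure_spmf p) \<le> B (snd z)) z (F z))"
      by (rule admissible_fun[OF partial_function_definitions_spmf])
         (intro admissible_imp admissible_nn_integral_le)
    then show "spmf.admissible (\<lambda>F. ?P (curry (curry F)))"
      by (simp add: curry_def split_paired_All)
  next
    show "?P (\<lambda>a body s. return_pmf None)"
      by simp
  next
    fix F assume "?P F"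
    then show "?P (\<lambda>a body s. if fst s a = 0 then return_spmf (test a s)
        else bind_spmf (body (test a s)) (F a body))"
      using step[of _ "F a body"] exit
      by (auto simp: nn_integral_return measure_spmf_return_spmf)
  qed
  then show ?thesis using \<open>I s\<close> by blast
qed

lemma nn_integral_bind_uniform:
  shows "(\<integral>\<^sup>+ x. h x \<partial>measure_spmf (bind_spmf (map_spmf H (spmf_of_set S)) f)) =
    (\<Sum>r\<in>S. (\<integral>\<^sup>+ x. h x \<partial>measure_spmf (f (H r)))) / of_nat (card S)"
proof -
  have "(\<integral>\<^sup>+ x. h x \<partial>measure_spmf (bind_spmf (map_spmf H (spmf_of_set S)) f)) =
      (\<integral>\<^sup>+ r. (\<integral>\<^sup>+ x. h x \<partial>measure_spmf (f (H r))) \<partial>measure_spmf (spmf_of_set S))"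
    by (simp add: bind_map_spmf measure_spmf_bind o_def
        nn_integral_bind[where B="count_space UNIV"] space_subprob_algebra)
  also have "\<dots> = (\<Sum>r\<in>S. (\<integral>\<^sup>+ x. h x \<partial>measure_spmf (f (H r)))) / of_nat (card S)"
    by (rule nn_integral_spmf_of_set)
  finally show ?thesis .
qed

lemma spmf_bind_uniform:
  shows "spmf (bind_spmf (map_spmf H (spmf_of_set S)) f) y =
    (\<Sum>r\<in>S. spmf (f (H r)) y) / card S"
  by (simp add: bind_map_spmf o_def spmf_bind integral_spmf_of_set)

text \<open>The uniform distribution has mass 1, so a subprobability above it pointwise has no mass
  to spare. Lower bounds on the probabilities thus give equality and total mass at once.\<close>

lemma spmf_eq_of_set:
  assumes T: "finite T" "T \<noteq> {}" and le: "\<And>y. y \<in> T \<Longrightarrow> 1 / card T \<le> spmf p y"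
  shows "p = spmf_of_set T"
proof -
  have "ord_spmf (=) (spmf_of_set T) p"
    using le by (intro ord_pmf_increaseI) (auto simp: spmf_of_set split: split_indicator)
  moreover from this have "pmf p None = pmf (spmf_of_set T) None"
    using ord_spmf_eqD_pmf_None[OF chain_empty, of "spmf_of_set T" p] T by (intro antisym) auto
  ultimately show ?thesis using ord_spmf_eq_pmf_None_eq[OF chain_empty, of "spmf_of_set T" p] by simp
qed

text \<open>
  Termination and uniformity follow together: the infimum \<open>z\<close> of the probability of a result over
  all states that satisfy the invariant fulfils \<open>z \<ge> 1 / V + (1 - card G / V) * z\<close>.
\<close>

lemma rejection_loop_uniform:
  fixes V :: nat and out :: "config \<Rightarrow> 'b spmf"
  assumes run: "\<And>s. I s \<Longrightarrow> fst s a \<noteq> 0"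
    and body: "\<And>s. I s \<Longrightarrow> \<exists>H. body (test a s) = map_spmf H (spmf_of_set {..<V}) \<and>
       (\<forall>r<V. if r \<in> G then F (f r) (H r) else I (H r))"
    and exit: "\<And>y s. F y s \<Longrightarrow> bind_spmf (loop a body s) out = return_spmf y"
    and G: "G \<subseteq> {..<V}" "G \<noteq> {}" and f: "bij_betw f G T" and "I s"
  shows "bind_spmf (loop a body s) out = spmf_of_set T"
proof -
  let ?p = "\<lambda>s. bind_spmf (loop a body s) out"
  have finG: "finite G" using G finite_subset by auto
  have cT: "card T = card G" using bij_betw_same_card[OF f] by simp
  have T: "finite T" "T \<noteq> {}" using f G finG by (auto simp: bij_betw_def)
  have GV: "card G \<le> V" "card G > 0" using card_mono[OF _ G(1)] finG G(2) by (auto simp: card_gt_0_iff)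
  have "1 / card T \<le> spmf (?p s) y" if y: "y \<in> T" for y
  proof -
    \<comment> \<open>Rounds start from different states, as the counter and the clock move on, so
      the recurrence is solved for the infimum over all states that satisfy the invariant.\<close>
    define z where "z = (INF s\<in>{s. I s}. spmf (?p s) y)"
    have z: "z \<le> spmf (?p s) y" if "I s" for s
      unfolding z_def using that by (intro cINF_lower bdd_belowI2[of _ 0]) auto
    obtain g where g: "g \<in> G" "f g = y" using y f by (auto simp: bij_betw_def)
    have step: "(1 + (real V - card G) * z) / V \<le> spmf (?p s) y" if s: "I s" for s
    proof -
      from body[OF s] obtain H where H: "body (test a s) = map_spmf H (spmf_of_set {..<V})"
        and H': "\<And>r. r < V \<Longrightarrow> if r \<in> G then F (f r) (H r) else I (H r)" by blast
      have "?p s = bind_spmf (map_spmf H (spmf_of_set {..<V})) ?p"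
        using run[OF s] H by (subst loop.simps) simp
      then have eq: "spmf (?p s) y = (\<Sum>r<V. spmf (?p (H r)) y) / V"
        by (simp only: spmf_bind_uniform card_lessThan)
      have "1 + (real V - card G) * z = (\<Sum>r<V. if r \<in> G then of_bool (r = g) else z)"
      proof -
        have "{..<V} \<inter> {r. r \<in> G} = G" "{..<V} \<inter> - {r. r \<in> G} = {..<V} - G" using G by auto
        moreover have "card ({..<V} - G) = V - card G" using G finG by (simp add: card_Diff_subset)
        moreover have "(\<Sum>r\<in>G. of_bool (r = g)) = (1::real)" using g finG by (simp add: of_bool_def)
        ultimately show ?thesis using GV by (simp add: sum.If_cases of_nat_diff)
      qed
      also have "\<dots> \<le> (\<Sum>r<V. spmf (?p (H r)) y)"
      proof (rule sum_mono)
        fix r assume "r \<in> {..<V}"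
        with H'[of r] have r: "if r \<in> G then F (f r) (H r) else I (H r)" by simp
        then show "(if r \<in> G then of_bool (r = g) else z) \<le> spmf (?p (H r)) y"
          using z[of "H r"] g exit[of "f r" "H r"] by (cases "r \<in> G") auto
      qed
      finally show ?thesis unfolding eq by (rule divide_right_mono) simp
    qed
    have "(1 + (real V - card G) * z) / V \<le> z"
      unfolding z_def[of] by (rule cINF_greatest) (use \<open>I s\<close> step[unfolded z_def] in blast)+
    then have "1 \<le> card G * z" using GV by (simp add: field_simps)
    then have "1 / card T \<le> z" using GV cT by (simp add: field_simps)
    then show ?thesis using z[OF \<open>I s\<close>] by linarith
  qed
  then show ?thesis by (rule spmf_eq_of_set[OF T])
qed

text \<open>The number of rounds is geometric with success probability \<open>card G / V\<close>.
  Instead of summing a series, \<open>B\<close> is checked against one unfolding: a round costs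
  \<open>C\<close> and leaves the expected remainder \<open>C * (V / card G)\<close> with
  probability \<open>1 - card G / V\<close>.\<close>

lemma rejection_loop_time:
  fixes V :: nat and C C' :: nat
  assumes run: "\<And>s. I s \<Longrightarrow> fst s a \<noteq> 0"
    and body: "\<And>s. I s \<Longrightarrow> \<exists>H. body (test a s) = map_spmf H (spmf_of_set {..<V}) \<and>
       (\<forall>r<V. snd (H r) \<le> snd s + C \<and> (if r \<in> G then F (H r) else I (H r)))"
    and exit: "\<And>s. F s \<Longrightarrow> fst s a = 0 \<and> h (test a s) \<le> of_nat (snd s + C')"
    and G: "G \<subseteq> {..<V}" "G \<noteq> {}" and "I s"
  shows "(\<integral>\<^sup>+ x. h x \<partial>measure_spmf (loop a body s)) \<le> ennreal (snd s + C' + C * (V / card G))"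
proof -
  have finG: "finite G" using G finite_subset by auto
  have GV: "card G \<le> V" "card G > 0" using card_mono[OF _ G(1)] finG G(2) by (auto simp: card_gt_0_iff)
  \<comment> \<open>A zero in cell \<open>a\<close> marks the finished states, from which only the
    exit cost \<open>C'\<close> remains.\<close>
  define B where "B s = (if fst s a = 0 then real (snd s + C') else snd s + C' + C * (V / card G))" for s :: config
  have BI: "B s = snd s + C' + C * (V / card G)" if "I s" for s using run[OF that] by (simp add: B_def)
  have BF: "B s = snd s + C'" if "F s" for s using exit[OF that] by (simp add: B_def)
  have "(\<integral>\<^sup>+ x. h x \<partial>measure_spmf (loop a body s)) \<le> ennreal (B s)"
  proof (rule loop_nn_integral_le[where I = "\<lambda>s. I s \<or> F s"])
    show "I s \<or> F s" using \<open>I s\<close> by simp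
  next
    fix s assume "I s \<or> F s" "fst s a = 0"
    then have "F s" using run[of s] by blast
    from exit[OF this] BF[OF this] show "h (test a s) \<le> ennreal (B s)"
      by (simp add: ennreal_of_nat_eq_real_of_nat)
  next
    fix s f
    assume s: "I s \<or> F s" "fst s a \<noteq> 0"
      and IH: "\<And>s'. I s' \<or> F s' \<Longrightarrow> (\<integral>\<^sup>+ x. h x \<partial>measure_spmf (f s')) \<le> ennreal (B s')"
    have I: "I s" using s(1) conjunct1[OF exit[of s]] s(2) by argo
    from body[OF this] obtain H where H: "body (test a s) = map_spmf H (spmf_of_set {..<V})"
      and H': "\<And>r. r < V \<Longrightarrow> snd (H r) \<le> snd s + C \<and> (if r \<in> G then F (H r) else I (H r))" by blast
    let ?t = "real (snd s + C + C')"
    let ?D = "real C * (V / card G)"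
    have "(\<integral>\<^sup>+ x. h x \<partial>measure_spmf (bind_spmf (body (test a s)) f)) =
        (\<Sum>r<V. (\<integral>\<^sup>+ x. h x \<partial>measure_spmf (f (H r)))) / of_nat V"
      unfolding H nn_integral_bind_uniform by simp
    also have "\<dots> \<le> (\<Sum>r<V. ennreal (?t + (if r \<in> G then 0 else ?D))) / of_nat V"
    proof (intro divide_right_mono_ennreal sum_mono)
      fix r assume "r \<in> {..<V}"
      then have r: "r < V" by simp
      have "B (H r) \<le> ?t + (if r \<in> G then 0 else ?D)"
        using H'[OF r] BI BF by (auto split: if_splits)
      moreover have "(\<integral>\<^sup>+ x. h x \<partial>measure_spmf (f (H r))) \<le> ennreal (B (H r))"
        using H'[OF r] by (intro IH) (auto split: if_splits)
      ultimately show "(\<integral>\<^sup>+ x. h x \<partial>measure_spmf (f (H r))) \<le> ennreal (?t + (if r \<in> G then 0 else ?D))"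
        by (meson ennreal_leI order_trans)
    qed
    also have "(\<Sum>r<V. ennreal (?t + (if r \<in> G then 0 else ?D))) = ennreal (\<Sum>r<V. ?t + (if r \<in> G then 0 else ?D))"
      by (rule sum_ennreal) auto
    also have "(\<Sum>r<V. ?t + (if r \<in> G then 0 else ?D)) = V * ?t + (real V - card G) * ?D"
    proof -
      have "{..<V} \<inter> {r. r \<in> G} = G" "{..<V} \<inter> - {r. r \<in> G} = {..<V} - G" using G by auto
      moreover have "card ({..<V} - G) = V - card G" using G finG by (simp add: card_Diff_subset)
      ultimately show ?thesis using GV by (simp add: sum.If_cases sum.distrib of_nat_diff)
    qed
    also have "ennreal \<dots> / of_nat V = ennreal ((V * ?t + (real V - card G) * ?D) / V)"
      using GV by (subst ennreal_of_nat_eq_real_of_nat, subst divide_ennreal) auto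
    also have "(V * ?t + (real V - card G) * ?D) / V = B s"
      using GV by (simp add: BI[OF I] field_simps)
    finally show "(\<integral>\<^sup>+ x. h x \<partial>measure_spmf (bind_spmf (body (test a s)) f)) \<le> ennreal (B s)" .
  qed
  then show ?thesis using BI[OF \<open>I s\<close>] by simp
qed

text \<open>The case without answers: the draws have no influence, every round moves the counter on
  by one whatever was drawn, and the loop runs for exactly \<open>n - j\<close> rounds.\<close>

lemma failing_loop_result:
  fixes V :: nat
  assumes body: "\<And>j s. I j s \<Longrightarrow> j < n \<Longrightarrow> fst s a \<noteq> 0 \<and>
       (\<exists>H. body (test a s) = map_spmf H (spmf_of_set {..<V}) \<and> (\<forall>r<V. I (Suc j) (H r)))"
    and exit: "\<And>s. I n s \<Longrightarrow> bind_spmf (loop a body s) out = return_spmf y"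
    and V: "V > 0" and "I j s" "j \<le> n"
  shows "bind_spmf (loop a body s) out = return_spmf y"
  using \<open>I j s\<close> \<open>j \<le> n\<close>
proof (induction "n - j" arbitrary: j s)
  case 0
  then show ?case using exit by simp
next
  case (Suc k)
  then have j: "j < n" by simp
  from body[OF Suc.prems(1) j] obtain H where H: "fst s a \<noteq> 0" "body (test a s) = map_spmf H (spmf_of_set {..<V})"
    "\<And>r. r < V \<Longrightarrow> I (Suc j) (H r)" by blast
  have "bind_spmf (loop a body s) out = bind_spmf (spmf_of_set {..<V}) (\<lambda>r. bind_spmf (loop a body (H r)) out)"
    using H by (subst loop.simps) (simp add: bind_map_spmf o_def)
  also have "\<dots> = bind_spmf (spmf_of_set {..<V}) (\<lambda>_. return_spmf y)"
    by (intro bind_spmf_cong refl Suc.hyps(1)[of "Suc j"]) (use H Suc.hyps(2) Suc.prems j in auto)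
  also have "\<dots> = return_spmf y" using V by (simp add: bind_spmf_const lessThan_empty_iff)
  finally show ?case .
qed

lemma failing_loop_time:
  fixes V :: nat and C C' :: nat
  assumes body: "\<And>j s. I j s \<Longrightarrow> j < n \<Longrightarrow> fst s a \<noteq> 0 \<and>
       (\<exists>H. body (test a s) = map_spmf H (spmf_of_set {..<V}) \<and>
         (\<forall>r<V. snd (H r) \<le> snd s + C \<and> I (Suc j) (H r)))"
    and exit: "\<And>s. I n s \<Longrightarrow> fst s a = 0 \<and> h (test a s) \<le> of_nat (snd s + C')"
    and V: "V > 0" and "I j s" "j \<le> n"
  shows "(\<integral>\<^sup>+ x. h x \<partial>measure_spmf (loop a body s)) \<le> of_nat (snd s + C' + C * (n - j))"
  using \<open>I j s\<close> \<open>j \<le> n\<close>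
proof (induction "n - j" arbitrary: j s)
  case 0
  then have "I n s" by simp
  from exit[OF this] show ?case
    by (subst loop.simps) (auto simp: measure_spmf_return_spmf nn_integral_return intro: order_trans)
next
  case (Suc k)
  then have j: "j < n" by simp
  from body[OF Suc.prems(1) j] obtain H where H: "fst s a \<noteq> 0" "body (test a s) = map_spmf H (spmf_of_set {..<V})"
    "\<And>r. r < V \<Longrightarrow> snd (H r) \<le> snd s + C \<and> I (Suc j) (H r)" by blast
  have "(\<integral>\<^sup>+ x. h x \<partial>measure_spmf (loop a body s)) =
      (\<Sum>r<V. (\<integral>\<^sup>+ x. h x \<partial>measure_spmf (loop a body (H r)))) / of_nat V"
    using H by (subst loop.simps) (simp only: nn_integral_bind_uniform if_False card_lessThan)
  also have "\<dots> \<le> (\<Sum>r<V. of_nat (snd s + C' + C * (n - j))) / of_nat V"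
  proof (intro divide_right_mono_ennreal sum_mono)
    fix r assume "r \<in> {..<V}"
    then have r: "snd (H r) \<le> snd s + C" "I (Suc j) (H r)" using H(3) by auto
    have "(\<integral>\<^sup>+ x. h x \<partial>measure_spmf (loop a body (H r))) \<le> of_nat (snd (H r) + C' + C * (n - Suc j))"
      by (rule Suc.hyps(1)) (use r Suc.hyps(2) j in auto)
    also have "snd (H r) + C' + C * (n - Suc j) \<le> snd s + C' + C * (n - j)"
    proof -
      have "n - j = Suc (n - Suc j)" using j by simp
      then show ?thesis using r by simp
    qed
    finally show "(\<integral>\<^sup>+ x. h x \<partial>measure_spmf (loop a body (H r))) \<le> of_nat (snd s + C' + C * (n - j))"
      by simp
  qed
  also have "\<dots> = of_nat (snd s + C' + C * (n - j))"
  proof -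
    have "of_nat V * x / of_nat V = x" for x :: ennreal
      using V by (subst mult.commute, intro mult_divide_eq_ennreal) (auto simp: ennreal_of_nat_eq_real_of_nat)
    then show ?thesis by (simp del: of_nat_add of_nat_mult)
  qed
  finally show ?case .
qed

section \<open>Deterministic programs\<close>

text \<open>The fragment without \<open>Flip\<close>, with steps counted instead of time. Exact
  times depend on the numbers handled; a uniform charge per step suffices once all cells stay below
  \<open>2 ^ W\<close>, so the instructions that create a new number carry a side condition.
  \<open>Count\<close> also needs a bounded prefix length, as it pays for each bit.\<close>

inductive big_step :: "(nat \<Rightarrow> bool list \<Rightarrow> nat) \<Rightarrow> nat \<Rightarrow> prog \<Rightarrow> memory \<Rightarrow> memory \<Rightarrow> nat \<Rightarrow> bool"
  for cnt W where
  "big_step cnt W Skip M M 1"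
| "n < 2 ^ W \<Longrightarrow> big_step cnt W (Const a n) M (M(a := n)) 1"
| "apply_binop f (M x) (M y) < 2 ^ W \<Longrightarrow> big_step cnt W (Op f a x y) M (M(a := apply_binop f (M x) (M y))) 1"
| "big_step cnt W (Load a x) M (M(a := M (M x))) 1"
| "big_step cnt W (Store a x) M (M(M a := M x)) 1"
| "M l \<le> W \<Longrightarrow> cnt (M i) (bits_at M (M p) (M l)) < 2 ^ W \<Longrightarrow>
     big_step cnt W (Count a i p l) M (M(a := cnt (M i) (bits_at M (M p) (M l)))) 1"
| "big_step cnt W P M M1 n1 \<Longrightarrow> big_step cnt W P' M1 M2 n2 \<Longrightarrow> big_step cnt W (Seq P P') M M2 (n1 + n2)"
| "M a \<noteq> 0 \<Longrightarrow> big_step cnt W P M M' n \<Longrightarrow> big_step cnt W (Cond a P P') M M' (Suc n)"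
| "M a = 0 \<Longrightarrow> big_step cnt W P' M M' n \<Longrightarrow> big_step cnt W (Cond a P P') M M' (Suc n)"
| "M a = 0 \<Longrightarrow> big_step cnt W (While a P) M M 1"
| "M a \<noteq> 0 \<Longrightarrow> big_step cnt W P M M1 n1 \<Longrightarrow> big_step cnt W (While a P) M1 M2 n2 \<Longrightarrow>
     big_step cnt W (While a P) M M2 (Suc (n1 + n2))"

definition bounded_mem :: "nat \<Rightarrow> memory \<Rightarrow> bool" where
  "bounded_mem W M \<longleftrightarrow> (\<forall>a. M a < 2 ^ W)"

text \<open>\<open>Count\<close> is the most expensive instruction: the access time
  \<open>q\<close>, three operands and the prefix length, each of these four at most
  \<open>W\<close>.\<close>

definition step_cost :: "nat \<Rightarrow> nat \<Rightarrow> nat" where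
  "step_cost q W = 1 + q + 4 * W"

lemma floorlog_le: "n < 2 ^ W \<Longrightarrow> floorlog 2 n \<le> W"
  by (simp add: floorlog_le_iff)

lemma bounded_floorlog: "bounded_mem W M \<Longrightarrow> floorlog 2 (M a) \<le> W"
  by (simp add: bounded_mem_def floorlog_le)

lemma big_step_exec:
  assumes "big_step cnt W P M M' n" "bounded_mem W M"
  shows "bounded_mem W M' \<and> (\<forall>t. \<exists>t'. exec cnt q P (M, t) = return_spmf (M', t') \<and>
    t \<le> t' \<and> t' \<le> t + n * step_cost q W)"
  using assms
proof (induction rule: big_step.induct)
  case (7 P M M1 n1 P' M2 n2)
  then have b1: "bounded_mem W M1" and b2: "bounded_mem W M2" by auto
  show ?case
  proof (intro conjI allI b2)
    fix t
    from 7 obtain t1 where t1: "exec cnt q P (M, t) = return_spmf (M1, t1)" "t \<le> t1" "t1 \<le> t + n1 * step_cost q W"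
      by blast
    from 7 b1 obtain t2 where "exec cnt q P' (M1, t1) = return_spmf (M2, t2)" "t1 \<le> t2" "t2 \<le> t1 + n2 * step_cost q W"
      by blast
    with t1 show "\<exists>t'. exec cnt q (Seq P P') (M, t) = return_spmf (M2, t') \<and> t \<le> t' \<and> t' \<le> t + (n1 + n2) * step_cost q W"
      by (auto simp: algebra_simps)
  qed
next
  case (8 M a P M' n P')
  show ?case
  proof (intro conjI allI)
    show "bounded_mem W M'" using 8 by blast
    fix t
    from 8 obtain t1 where "exec cnt q P (M, t + 1 + floorlog 2 (M a)) = return_spmf (M', t1)"
      "t + 1 + floorlog 2 (M a) \<le> t1" "t1 \<le> t + 1 + floorlog 2 (M a) + n * step_cost q W"
      by blast
    with 8 bounded_floorlog[OF 8(4), of a]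
    show "\<exists>t'. exec cnt q (Cond a P P') (M, t) = return_spmf (M', t') \<and> t \<le> t' \<and> t' \<le> t + Suc n * step_cost q W"
      by (auto simp: step_cost_def)
  qed
next
  case (9 M a P' M' n P)
  show ?case
  proof (intro conjI allI)
    show "bounded_mem W M'" using 9 by blast
    fix t
    from 9 obtain t1 where "exec cnt q P' (M, t + 1 + floorlog 2 (M a)) = return_spmf (M', t1)"
      "t + 1 + floorlog 2 (M a) \<le> t1" "t1 \<le> t + 1 + floorlog 2 (M a) + n * step_cost q W"
      by blast
    with 9 bounded_floorlog[OF 9(4), of a]
    show "\<exists>t'. exec cnt q (Cond a P P') (M, t) = return_spmf (M', t') \<and> t \<le> t' \<and> t' \<le> t + Suc n * step_cost q W"
      by (auto simp: step_cost_def)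
  qed
next
  case (10 M a P)
  then show ?case using bounded_floorlog[of W M a] by (auto simp: loop.simps step_cost_def)
next
  case (11 M a P M1 n1 M2 n2)
  then have b1: "bounded_mem W M1" and b2: "bounded_mem W M2" by auto
  show ?case
  proof (intro conjI allI b2)
    fix t
    let ?t = "t + 1 + floorlog 2 (M a)"
    from 11 obtain t1 where t1: "exec cnt q P (M, ?t) = return_spmf (M1, t1)" "?t \<le> t1" "t1 \<le> ?t + n1 * step_cost q W"
      by blast
    from 11 b1 obtain t2 where "exec cnt q (While a P) (M1, t1) = return_spmf (M2, t2)" "t1 \<le> t2" "t2 \<le> t1 + n2 * step_cost q W"
      by blast
    with t1 11(1) bounded_floorlog[OF 11(6), of a] show "\<exists>t'. exec cnt q (While a P) (M, t) = return_spmf (M2, t') \<and> t \<le> t' \<and> t' \<le> t + Suc (n1 + n2) * step_cost q W"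
      by (subst exec.simps, subst loop.simps) (auto simp: algebra_simps step_cost_def)
  qed
next
  case (3 f M x y a)
  then show ?case
    using bounded_floorlog[of W M x] bounded_floorlog[of W M y] by (auto simp: step_cost_def bounded_mem_def)
next
  case (4 a x M)
  then show ?case
    using bounded_floorlog[of W M x] bounded_floorlog[of W M "M x"]
    by (auto simp: step_cost_def bounded_mem_def)
next
  case (5 a x M)
  then show ?case
    using bounded_floorlog[of W M x] bounded_floorlog[of W M a]
    by (auto simp: step_cost_def bounded_mem_def)
next
  case (6 M l i p a)
  then show ?case
    using bounded_floorlog[of W M i] bounded_floorlog[of W M p] bounded_floorlog[of W M l]
    by (auto simp: step_cost_def bounded_mem_def)
next
  case (2 n a M)
  then show ?case using floorlog_le[of n W] by (auto simp: step_cost_def bounded_mem_def)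
qed (auto simp: step_cost_def)

text \<open>A weakest precondition for total correctness whose postcondition also sees the step
  count. The equations below serve as rewrite rules, so straight-line code is verified by symbolic
  execution.\<close>

definition wp :: "(nat \<Rightarrow> bool list \<Rightarrow> nat) \<Rightarrow> nat \<Rightarrow> prog \<Rightarrow> (memory \<Rightarrow> nat \<Rightarrow> bool) \<Rightarrow> memory \<Rightarrow> bool" where
  "wp cnt W P Q M \<longleftrightarrow> (\<exists>M' n. big_step cnt W P M M' n \<and> Q M' n)"

lemma wp_mono: "wp cnt W P Q M \<Longrightarrow> (\<And>M' n. Q M' n \<Longrightarrow> Q' M' n) \<Longrightarrow> wp cnt W P Q' M"
  unfolding wp_def by blast

lemma wp_simps [simp]:
  "wp cnt W Skip Q M \<longleftrightarrow> Q M 1"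
  "wp cnt W (Const a k) Q M \<longleftrightarrow> k < 2 ^ W \<and> Q (M(a := k)) 1"
  "wp cnt W (Op f a x y) Q M \<longleftrightarrow> apply_binop f (M x) (M y) < 2 ^ W \<and> Q (M(a := apply_binop f (M x) (M y))) 1"
  "wp cnt W (Load a x) Q M \<longleftrightarrow> Q (M(a := M (M x))) 1"
  "wp cnt W (Store a x) Q M \<longleftrightarrow> Q (M(M a := M x)) 1"
  "wp cnt W (Count a i p l) Q M \<longleftrightarrow> M l \<le> W \<and> cnt (M i) (bits_at M (M p) (M l)) < 2 ^ W \<and>
     Q (M(a := cnt (M i) (bits_at M (M p) (M l)))) 1"
  unfolding wp_def by ((subst big_step.simps, (auto simp del: One_nat_def)[1])+)

lemma wp_Seq [simp]:
  "wp cnt W (Seq P P') Q M \<longleftrightarrow> wp cnt W P (\<lambda>M1 n1. wp cnt W P' (\<lambda>M2 n2. Q M2 (n1 + n2)) M1) M"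
  unfolding wp_def by (subst big_step.simps) (simp, blast)

lemma wp_Cond [simp]:
  "wp cnt W (Cond a P P') Q M \<longleftrightarrow> (if M a \<noteq> 0 then wp cnt W P (\<lambda>M n. Q M (Suc n)) M
     else wp cnt W P' (\<lambda>M n. Q M (Suc n)) M)"
  unfolding wp_def by (subst big_step.simps) auto

lemma wp_While:
  "wp cnt W (While a P) Q M \<longleftrightarrow> (if M a = 0 then Q M 1
     else wp cnt W P (\<lambda>M1 n1. wp cnt W (While a P) (\<lambda>M2 n2. Q M2 (Suc (n1 + n2))) M1) M)"
  unfolding wp_def by (subst big_step.simps) (auto simp del: One_nat_def, blast)

text \<open>The index of the invariant is the variant, an upper bound on the rounds left. On exit it
  is forgotten, since the loop may stop early.\<close>

lemma wp_While_rule: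
  assumes step: "\<And>i M. I i M \<Longrightarrow> M a \<noteq> 0 \<Longrightarrow> i > 0 \<and> wp cnt W P (\<lambda>M' n. I (i - 1) M' \<and> n \<le> c) M"
    and "I i M"
  shows "wp cnt W (While a P) (\<lambda>M' n. (\<exists>i'. I i' M') \<and> M' a = 0 \<and> n \<le> i * Suc c + 1) M"
  using \<open>I i M\<close>
proof (induction i arbitrary: M)
  case 0
  then show ?case using step[of 0 M] by (subst wp_While) auto
next
  case (Suc i)
  show ?case
  proof (cases "M a = 0")
    case True
    then show ?thesis using Suc by (subst wp_While) auto
  next
    case False
    from step[OF Suc.prems False] have "wp cnt W P (\<lambda>M' n. I i M' \<and> n \<le> c) M" by simp
    then show ?thesis using False
      by (subst wp_While, simp) (erule wp_mono, elim conjE, drule Suc.IH, erule wp_mono, auto)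
  qed
qed

definition seqs :: "prog list \<Rightarrow> prog" where
  "seqs ps = foldr Seq ps Skip"

lemma wp_seqs [simp]:
  "wp cnt W (seqs []) Q M \<longleftrightarrow> Q M 1"
  "wp cnt W (seqs (p # ps)) Q M \<longleftrightarrow> wp cnt W p (\<lambda>M1 n1. wp cnt W (seqs ps) (\<lambda>M2 n2. Q M2 (n1 + n2)) M1) M"
  by (simp_all add: seqs_def)

section \<open>Computing the estimate\<close>

definition frame :: "nat set \<Rightarrow> memory \<Rightarrow> memory \<Rightarrow> bool" where
  "frame S M M' \<longleftrightarrow> (\<forall>a. a \<notin> S \<longrightarrow> M' a = M a)"

lemma frameD: "frame S M M' \<Longrightarrow> a \<notin> S \<Longrightarrow> M' a = M a"
  by (simp add: frame_def)

lemma frame_trans: "frame S M M' \<Longrightarrow> frame S M' M'' \<Longrightarrow> frame S M M''"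
  by (auto simp: frame_def)

lemma frame_mono: "frame S M M' \<Longrightarrow> S \<subseteq> T \<Longrightarrow> frame T M M'"
  by (auto simp: frame_def)

lemma frame_upd [simp]: "a \<in> S \<Longrightarrow> frame S M (M'(a := x)) \<longleftrightarrow> frame S M M'"
  by (auto simp: frame_def)

lemma frame_refl [simp]: "frame S M M"
  by (auto simp: frame_def)

lemma bits_at_cong: "(\<And>a. p \<le> a \<Longrightarrow> a < p + l \<Longrightarrow> M' a = M a) \<Longrightarrow> bits_at M' p l = bits_at M p l"
  by (auto simp: bits_at_def)

lemma bits_at_upd_below [simp]: "a < p \<Longrightarrow> bits_at (M(a := x)) p l = bits_at M p l"
  by (auto intro: bits_at_cong)

lemma bits_at_frame: "frame S M M' \<Longrightarrow> (\<And>a. a \<in> S \<Longrightarrow> a < p) \<Longrightarrow> bits_at M' p l = bits_at M p l"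
  by (rule bits_at_cong) (metis frameD leD)

section \<open>Integer roots and the code of the estimate\<close>

definition froot :: "nat \<Rightarrow> nat \<Rightarrow> nat" where
  "froot m v = Max {u. u ^ m \<le> v}"

lemma froot_finite:
  assumes "m > 0"
  shows "finite {u :: nat. u ^ m \<le> v}"
proof (rule finite_subset)
  show "{u. u ^ m \<le> v} \<subseteq> {..v}"
  proof
    fix u :: nat assume "u \<in> {u. u ^ m \<le> v}"
    then show "u \<in> {..v}" using self_le_power[of u m] assms by (cases "u = 0") auto
  qed
qed simp

lemma froot_eqI:
  assumes "u ^ m \<le> v" "v < (u + 1) ^ m" "m > 0"
  shows "froot m v = u"
  unfolding froot_def
proof (rule Max_eqI[OF froot_finite])
  fix y assume "y \<in> {u. u ^ m \<le> v}"
  then have "y ^ m < (u + 1) ^ m" using assms by simp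
  then have "y < u + 1" by (rule power_less_imp_less_base) simp
  then show "y \<le> u" by simp
qed (use assms in auto)

lemma froot_power_le: "m > 0 \<Longrightarrow> froot m v ^ m \<le> v"
  using Max_in[OF froot_finite[of m v]] unfolding froot_def
  by (metis (mono_tags, lifting) empty_iff le0 mem_Collect_eq zero_power)

lemma le_froot: "m > 0 \<Longrightarrow> u ^ m \<le> v \<Longrightarrow> u \<le> froot m v"
  unfolding froot_def by (rule Max_ge[OF froot_finite]) auto

lemma froot_le: "m > 0 \<Longrightarrow> froot m v \<le> v"
  using froot_power_le[of m v] self_le_power[of "froot m v" m] by (cases "froot m v = 0") auto

text \<open>
  Registers: \<open>1\<close> buffer address, \<open>2\<close> buffer length, \<open>3\<close> estimate at the root, \<open>4\<close> number of
  budgets known to fail, \<open>5\<close> success flag, \<open>7\<close> current budget, \<open>8\<close> number of bits fixed so far,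
  \<open>10\<close> result of the estimate, \<open>16\<close> the constant 1; the others are temporaries.
\<close>

definition prod_code :: "nat list \<Rightarrow> prog" where
  "prod_code js = seqs (Const 14 1 # concat (map (\<lambda>i. [Const 17 i, Count 17 17 1 8, Op Mul 14 14 17]) js))"

text \<open>Minimum by truncated subtraction, \<open>x - (x - y)\<close>. As there is no move
  instruction, a register is copied by adding a zero.\<close>

definition min_code :: "nat list \<Rightarrow> nat list list \<Rightarrow> prog" where
  "min_code js0 jss = seqs (prod_code js0 # Const 15 0 # Op Add 11 14 15 #
     concat (map (\<lambda>js. [prod_code js, Op Sub 15 11 14, Op Sub 11 11 15]) jss))"

text \<open>Bisection between cell \<open>10\<close>, whose \<open>m\<close>-th power does not
  exceed the radicand in cell \<open>11\<close>, and cell \<open>12\<close>, whose power does. Cell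
  \<open>15\<close> ends as the gap minus 1, which is 0 exactly when cell \<open>10\<close> is the
  rounded-down root. The power is unrolled, \<open>m\<close> being a constant of the
  program.\<close>

definition bisect_code :: "nat \<Rightarrow> prog" where
  "bisect_code m = seqs ([Op Add 13 10 12, Const 14 2, Op Div 13 13 14, Const 14 1] @
     replicate m (Op Mul 14 14 13) @
     [Op Sub 15 14 11, Cond 15 (seqs [Const 15 0, Op Add 12 13 15]) (Op Add 10 13 15),
      Op Sub 15 12 10, Op Sub 15 15 16])"

definition root_code :: "nat \<Rightarrow> prog" where
  "root_code m = seqs [Const 10 0, Op Add 12 11 16, Op Sub 15 12 10, Op Sub 15 15 16,
     While 15 (bisect_code m)]"

definition est_code :: "nat \<Rightarrow> nat list \<Rightarrow> nat list list \<Rightarrow> prog" where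
  "est_code m js0 jss = seqs [min_code js0 jss, root_code m]"

text \<open>A cover is a list of relation indices with repetitions, so a product of powers is an
  iterated product. \<open>A\<close> bounds the counts and \<open>J\<close> the lengths of the
  lists. The largest power computed is that of a bisection midpoint, hence \<open>AJ_W\<close>; its
  factor 4 leaves room for sums of two bounds and for the power of two used in drawing. The 40 in
  \<open>len_W\<close> makes room for the registers and the addresses of the buffer.\<close>

locale estimator =
  fixes cnt :: "nat \<Rightarrow> bool list \<Rightarrow> nat" and W len m A J :: nat
    and js0 :: "nat list" and jss :: "nat list list"
  assumes m_pos: "m > 0"
    and A_pos: "A > 0" and J_pos: "J > 0"
    and len_W: "len + 40 \<le> W"
    and cnt_le: "\<And>i w. length w \<le> len \<Longrightarrow> cnt i w \<le> A"
    and js_W: "\<And>js i. js \<in> set (js0 # jss) \<Longrightarrow> i \<in> set js \<Longrightarrow> i \<le> W"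
    and js_J: "\<And>js. js \<in> set (js0 # jss) \<Longrightarrow> length js \<le> J"
    and AJ_W: "4 * (A ^ J + 1) ^ m \<le> 2 ^ W"
begin

definition vprod :: "nat list \<Rightarrow> bool list \<Rightarrow> nat" where
  "vprod js w = prod_list (map (\<lambda>i. cnt i w) js)"

definition vmin :: "bool list \<Rightarrow> nat" where
  "vmin w = foldl (\<lambda>v js. min v (vprod js w)) (vprod js0 w) jss"

definition est :: "bool list \<Rightarrow> nat" where
  "est w = froot m (vmin w)"

lemma AJ_W': "4 * (A ^ J + 1) \<le> 2 ^ W"
  using AJ_W self_le_power[of "A ^ J + 1" m] m_pos by simp

lemma A_W: "A < 2 ^ W"
  using AJ_W' self_le_power[of A J] A_pos J_pos by simp

lemma len2_W: "2 * len + 40 < 2 ^ W"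
proof -
  obtain W' where W': "W = Suc W'" using len_W by (cases W) auto
  have "W' + 1 \<le> 2 ^ W'" using less_exp[of W'] by linarith
  moreover have "2 ^ W = 2 * (2 ^ W' :: nat)" using W' by simp
  ultimately show ?thesis using len_W W' by linarith
qed

lemma W_less: "n \<le> W \<Longrightarrow> n < 2 ^ W"
  using less_exp[of W] by linarith

lemma vprod_le: "length w \<le> len \<Longrightarrow> vprod js w \<le> A ^ length js"
  unfolding vprod_def by (induction js) (auto intro: mult_mono cnt_le)

lemma vprod_AJ: "length w \<le> len \<Longrightarrow> js \<in> set (js0 # jss) \<Longrightarrow> vprod js w \<le> A ^ J"
  using vprod_le[of w js] js_J[of js] power_increasing[of "length js" J A] A_pos by linarith

lemma vmin_eq: "vmin w = Min ((\<lambda>js. vprod js w) ` set (js0 # jss))"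
proof -
  have "foldl (\<lambda>v js. min v (vprod js w)) a ks = Min (insert a ((\<lambda>js. vprod js w) ` set ks))" for a ks
  proof (induction ks arbitrary: a)
    case (Cons k ks)
    then show ?case by (cases "ks = []") (simp_all add: min.assoc)
  qed simp
  then show ?thesis by (simp add: vmin_def)
qed

text \<open>The induction carries the largest value still possible,
  \<open>M 14 * A ^ length js\<close>. As \<open>A > 0\<close>, no partial product exceeds it, so no
  cell overflows.\<close>

lemma wp_prod_aux:
  assumes "M 1 = B" "18 \<le> B" "M 8 = length w" "bits_at M B (length w) = w" "length w \<le> len"
    "\<And>i. i \<in> set js \<Longrightarrow> i \<le> W" "M 14 * A ^ length js < 2 ^ W"
  shows "wp cnt W (seqs (concat (map (\<lambda>i. [Const 17 i, Count 17 17 1 8, Op Mul 14 14 17]) js)))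
    (\<lambda>M' n. M' 14 = M 14 * vprod js w \<and> frame {14, 17} M M' \<and> n \<le> 3 * length js + 1) M"
  using assms
proof (induction js arbitrary: M)
  case Nil
  then show ?case by (simp add: vprod_def)
next
  case (Cons i js)
  let ?c = "cnt i w"
  let ?M = "M(17 := ?c, 14 := M 14 * ?c)"
  have c: "?c \<le> A" using cnt_le Cons.prems by simp
  have le: "M 14 * ?c * A ^ length js \<le> M 14 * A ^ length (i # js)"
    using c by (simp add: mult.assoc mult_left_mono)
  then have lt: "M 14 * ?c * A ^ length js < 2 ^ W" using Cons.prems(7) by linarith
  moreover have "M 14 * ?c * 1 \<le> M 14 * ?c * A ^ length js"
    by (rule mult_left_mono) (use A_pos in auto)
  ultimately have lt2: "M 14 * ?c < 2 ^ W" by linarith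
  have cW: "?c < 2 ^ W" using c A_W by simp
  have "wp cnt W (seqs (concat (map (\<lambda>i. [Const 17 i, Count 17 17 1 8, Op Mul 14 14 17]) js)))
    (\<lambda>M' n. M' 14 = ?M 14 * vprod js w \<and> frame {14, 17} ?M M' \<and> n \<le> 3 * length js + 1) ?M"
  proof (rule Cons.IH)
    show "bits_at ?M B (length w) = w" using Cons.prems by (simp del: fun_upd_apply)
  qed (use Cons.prems lt in auto)
  then show ?case
    using Cons.prems lt2 cW len_W
    by (simp add: W_less fun_upd_twist[of 17 14]) (erule wp_mono, auto simp: vprod_def mult.assoc frame_def)
qed

lemma wp_prod_code:
  assumes "M 1 = B" "18 \<le> B" "M 8 = length w" "bits_at M B (length w) = w" "length w \<le> len"
    and js: "js \<in> set (js0 # jss)"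
  shows "wp cnt W (prod_code js)
    (\<lambda>M' n. M' 14 = vprod js w \<and> frame {14, 17} M M' \<and> n \<le> 3 * length js + 2) M"
proof -
  have "A ^ length js \<le> A ^ J" using js_J[OF js] A_pos by (intro power_increasing) auto
  then have lt: "A ^ length js < 2 ^ W" using AJ_W' by simp
  have "wp cnt W (seqs (concat (map (\<lambda>i. [Const 17 i, Count 17 17 1 8, Op Mul 14 14 17]) js)))
    (\<lambda>M' n. M' 14 = (M(14 := 1)) 14 * vprod js w \<and> frame {14, 17} (M(14 := 1)) M' \<and> n \<le> 3 * length js + 1) (M(14 := 1))"
    by (rule wp_prod_aux) (use assms lt js_W[OF js] in \<open>auto simp del: fun_upd_apply\<close>, auto)
  then show ?thesis using W_less[of 1] len_W
    by (simp add: prod_code_def) (erule wp_mono, auto simp: frame_def)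
qed

lemma wp_min_aux:
  assumes "M 1 = B" "18 \<le> B" "M 8 = length w" "bits_at M B (length w) = w" "length w \<le> len"
    "set ks \<subseteq> set (js0 # jss)" "M 11 < 2 ^ W"
  shows "wp cnt W (seqs (concat (map (\<lambda>js. [prod_code js, Op Sub 15 11 14, Op Sub 11 11 15]) ks)))
    (\<lambda>M' n. M' 11 = foldl (\<lambda>v js. min v (vprod js w)) (M 11) ks \<and> frame {11, 14, 15, 17} M M' \<and>
       n \<le> length ks * (3 * J + 4) + 1) M"
  using assms
proof (induction ks arbitrary: M)
  case Nil
  then show ?case by simp
next
  case (Cons js ks)
  have len: "length js \<le> J" using Cons.prems(6) js_J[of js] by auto
  have step: "wp cnt W (prod_code js)
    (\<lambda>M' n. M' 14 = vprod js w \<and> frame {14, 17} M M' \<and> n \<le> 3 * length js + 2) M"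
    by (rule wp_prod_code[of M B w]) (use Cons.prems in auto)
  show ?case
    apply simp
    apply (rule wp_mono[OF step])
    subgoal for M1 n1
    proof (elim conjE)
      assume 1: "M1 14 = vprod js w" "frame {14, 17} M M1" "n1 \<le> 3 * length js + 2"
      let ?v = "min (M 11) (vprod js w)"
      let ?M = "M1(15 := M 11 - vprod js w, 11 := ?v)"
      have M11: "M1 11 = M 11" using 1(2) by (simp add: frame_def)
      have fr: "frame {11, 14, 15, 17} M ?M" using 1(2) by (auto simp: frame_def)
      have "bits_at ?M B (length w) = bits_at M B (length w)"
        by (rule bits_at_frame[OF fr]) (use Cons.prems in auto)
      then have "wp cnt W (seqs (concat (map (\<lambda>js. [prod_code js, Op Sub 15 11 14, Op Sub 11 11 15]) ks)))
        (\<lambda>M' n. M' 11 = foldl (\<lambda>v js. min v (vprod js w)) (?M 11) ks \<and> frame {11, 14, 15, 17} ?M M' \<and>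
           n \<le> length ks * (3 * J + 4) + 1) ?M"
        by (intro Cons.IH) (use Cons.prems 1(2) in \<open>auto simp: frame_def simp del: fun_upd_apply\<close>, (auto simp: frame_def))
      moreover have "M 11 - (M 11 - vprod js w) = ?v" by auto
      ultimately show ?thesis using 1 M11 Cons.prems(7) len
        by (simp add: less_imp_diff_less min.strict_coboundedI1) (erule wp_mono, auto dest: frame_trans[OF fr])
    qed
    done
qed

lemma wp_min_code:
  assumes "M 1 = B" "18 \<le> B" "M 8 = length w" "bits_at M B (length w) = w" "length w \<le> len"
  shows "wp cnt W (min_code js0 jss)
    (\<lambda>M' n. M' 11 = vmin w \<and> frame {11, 14, 15, 17} M M' \<and> n \<le> length jss * (3 * J + 4) + 3 * J + 5) M"
proof -
  have len: "length js0 \<le> J" using js_J[of js0] by auto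
  have lt: "vprod js0 w < 2 ^ W" using vprod_AJ[of w js0] assms AJ_W' by auto
  have step: "wp cnt W (prod_code js0)
    (\<lambda>M' n. M' 14 = vprod js0 w \<and> frame {14, 17} M M' \<and> n \<le> 3 * length js0 + 2) M"
    by (rule wp_prod_code[of M B w]) (use assms in auto)
  show ?thesis
    unfolding min_code_def
    apply simp
    apply (rule wp_mono[OF step])
    subgoal for M1 n1
    proof (elim conjE)
      assume 1: "M1 14 = vprod js0 w" "frame {14, 17} M M1" "n1 \<le> 3 * length js0 + 2"
      let ?M = "M1(15 := 0, 11 := vprod js0 w)"
      have fr: "frame {11, 14, 15, 17} M ?M" using 1(2) by (auto simp: frame_def)
      have "bits_at ?M B (length w) = bits_at M B (length w)"
        by (rule bits_at_frame[OF fr]) (use assms in auto)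
      then have "wp cnt W (seqs (concat (map (\<lambda>js. [prod_code js, Op Sub 15 11 14, Op Sub 11 11 15]) jss)))
        (\<lambda>M' n. M' 11 = foldl (\<lambda>v js. min v (vprod js w)) (?M 11) jss \<and> frame {11, 14, 15, 17} ?M M' \<and>
           n \<le> length jss * (3 * J + 4) + 1) ?M"
        using fr assms lt by (intro wp_min_aux) (auto simp: frame_def simp del: fun_upd_apply, (auto simp: frame_def))
      then show ?thesis using 1 lt len
        by simp (erule wp_mono, auto simp: vmin_def dest: frame_trans[OF fr])
    qed
    done
qed

lemma vmin_AJ: "length w \<le> len \<Longrightarrow> vmin w \<le> A ^ J"
  using vprod_AJ[of w js0] unfolding vmin_eq by (intro Min.coboundedI[THEN order_trans]) auto

lemma est_AJ: "length w \<le> len \<Longrightarrow> est w \<le> A ^ J"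
  unfolding est_def using vmin_AJ[of w] froot_le[OF m_pos, of "vmin w"] by linarith

lemma wp_power_aux:
  assumes "M 14 * M 13 ^ k < 2 ^ W" "M 13 > 0"
  shows "wp cnt W (seqs (replicate k (Op Mul 14 14 13) @ ps)) Q M \<longleftrightarrow>
    wp cnt W (seqs ps) (\<lambda>M' n. Q M' (k + n)) (M(14 := M 14 * M 13 ^ k))"
  using assms
proof (induction k arbitrary: M Q)
  case (Suc k)
  have "M 14 * M 13 * 1 \<le> M 14 * M 13 * M 13 ^ k"
    by (rule mult_left_mono) (use Suc.prems in auto)
  also have "\<dots> = M 14 * M 13 ^ Suc k" by simp
  also have "\<dots> < 2 ^ W" by (rule Suc.prems)
  finally have "M 14 * M 13 < 2 ^ W" by simp
  then have "wp cnt W (seqs (replicate (Suc k) (Op Mul 14 14 13) @ ps)) Q M \<longleftrightarrow>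
      wp cnt W (seqs (replicate k (Op Mul 14 14 13) @ ps)) (\<lambda>M' n. Q M' (Suc n)) (M(14 := M 14 * M 13))"
    by simp
  also have "\<dots> \<longleftrightarrow> wp cnt W (seqs ps) (\<lambda>M' n. Q M' (Suc (k + n)))
      ((M(14 := M 14 * M 13))(14 := (M(14 := M 14 * M 13)) 14 * (M(14 := M 14 * M 13)) 13 ^ k))"
    by (rule Suc.IH) (use Suc.prems in \<open>simp_all add: mult.assoc\<close>)
  also have "(M(14 := M 14 * M 13))(14 := (M(14 := M 14 * M 13)) 14 * (M(14 := M 14 * M 13)) 13 ^ k)
      = M(14 := M 14 * M 13 ^ Suc k)" by (simp add: mult.assoc)
  finally show ?case by simp
qed simp

text \<open>The gap is at most \<open>2 ^ i\<close> and this bound halves in each round, so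
  \<open>i\<close> bounds the rounds left; it starts at the word length \<open>W\<close>.\<close>

definition bisect_inv :: "nat \<Rightarrow> memory \<Rightarrow> nat \<Rightarrow> memory \<Rightarrow> bool" where
  "bisect_inv v M i M' \<longleftrightarrow> frame {10, 12, 13, 14, 15} M M' \<and> M' 11 = v \<and> M' 16 = 1 \<and>
     M' 10 ^ m \<le> v \<and> v < M' 12 ^ m \<and> M' 10 < M' 12 \<and> M' 12 \<le> v + 1 \<and> M' 12 - M' 10 \<le> 2 ^ i \<and>
     M' 15 = M' 12 - M' 10 - 1"

lemma wp_bisect_step:
  assumes v: "v \<le> A ^ J" and inv: "bisect_inv v M i N" and N: "N 15 \<noteq> 0"
  shows "i > 0 \<and> wp cnt W (bisect_code m) (\<lambda>N' n. bisect_inv v M (i - 1) N' \<and> n \<le> m + 13) N"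
proof -
  define lo where "lo = N 10"
  define hi where "hi = N 12"
  define mid where "mid = (lo + hi) div 2"
  have lh: "lo + 2 \<le> hi" "hi \<le> v + 1" "hi - lo \<le> 2 ^ i" "N 10 = lo" "N 12 = hi" "N 11 = v" "N 16 = 1"
    "lo ^ m \<le> v" "v < hi ^ m" and fr: "frame {10, 12, 13, 14, 15} M N"
    using inv N by (auto simp: bisect_inv_def lo_def hi_def)
  have i: "i > 0" using lh by (cases i) auto
  have mid: "lo < mid" "mid < hi" using lh by (auto simp: mid_def)
  have half: "mid - lo \<le> 2 ^ (i - 1)" "hi - mid \<le> 2 ^ (i - 1)"
    using lh i by (cases i; auto simp: mid_def)+
  have W1: "lo + hi < 2 ^ W" using lh v AJ_W' by simp
  have "mid ^ m \<le> (A ^ J + 1) ^ m" using mid lh v by (intro power_mono) auto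
  moreover have "x < b" if "x \<le> a" "4 * a \<le> b" "0 < a" for x a b :: nat using that by linarith
  ultimately have W2: "mid ^ m < 2 ^ W" using AJ_W by (metis add_gr_0 zero_less_one zero_less_power)
  have lt: "hi < 2 ^ W" "mid < 2 ^ W" "lo < 2 ^ W" using W1 mid by auto
  have W3: "(2::nat) < 2 ^ W" "(1::nat) < 2 ^ W" using len2_W by auto
  let ?N = "N(13 := lo + hi, 14 := 2, 13 := mid, 14 := 1)"
  have "wp cnt W (bisect_code m) (\<lambda>N' n. bisect_inv v M (i - 1) N' \<and> n \<le> m + 13) N \<longleftrightarrow>
      wp cnt W (seqs (replicate m (Op Mul 14 14 13) @
     [Op Sub 15 14 11, Cond 15 (seqs [Const 15 0, Op Add 12 13 15]) (Op Add 10 13 15),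
      Op Sub 15 12 10, Op Sub 15 15 16])) (\<lambda>N' n. bisect_inv v M (i - 1) N' \<and> n + 4 \<le> m + 13) ?N"
    unfolding bisect_code_def using lh W1 W3 lt by (simp add: mid_def)
  moreover have "wp cnt W (seqs (replicate m (Op Mul 14 14 13) @
     [Op Sub 15 14 11, Cond 15 (seqs [Const 15 0, Op Add 12 13 15]) (Op Add 10 13 15),
      Op Sub 15 12 10, Op Sub 15 15 16])) (\<lambda>N' n. bisect_inv v M (i - 1) N' \<and> n + 4 \<le> m + 13) ?N"
  proof (subst wp_power_aux)
    show "wp cnt W (seqs [Op Sub 15 14 11, Cond 15 (seqs [Const 15 0, Op Add 12 13 15]) (Op Add 10 13 15),
      Op Sub 15 12 10, Op Sub 15 15 16]) (\<lambda>N' n. bisect_inv v M (i - 1) N' \<and> m + n + 4 \<le> m + 13)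
      (?N(14 := ?N 14 * ?N 13 ^ m))"
      using lh mid half W2 W3 lt fr
      by (auto simp: bisect_inv_def less_imp_diff_less)
  qed (use W2 mid in auto)
  ultimately show ?thesis using i by simp
qed

lemma wp_root_code:
  assumes "M 11 = v" "v \<le> A ^ J" "M 16 = 1"
  shows "wp cnt W (root_code m)
    (\<lambda>M' n. M' 10 = froot m v \<and> frame {10, 12, 13, 14, 15} M M' \<and> n \<le> W * (m + 14) + 6) M"
proof -
  have v: "v + 1 < 2 ^ W" using assms AJ_W' by simp
  let ?M = "M(10 := 0, 12 := v + 1, 15 := v + 1, 15 := v)"
  have inv: "bisect_inv v M W ?M"
    using v assms m_pos self_le_power[of "v + 1" m] by (auto simp: bisect_inv_def zero_power frame_def)
  have "wp cnt W (While 15 (bisect_code m))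
     (\<lambda>M' n. (\<exists>i'. bisect_inv v M i' M') \<and> M' 15 = 0 \<and> n \<le> W * Suc (m + 13) + 1) ?M"
    by (rule wp_While_rule[where I = "bisect_inv v M", OF wp_bisect_step inv]) (use assms in auto)
  moreover have "froot m v = M' 10" if "bisect_inv v M i M'" "M' 15 = 0" for M' i
  proof -
    have "M' 12 = M' 10 + 1" "M' 10 ^ m \<le> v" "v < M' 12 ^ m" using that by (auto simp: bisect_inv_def)
    then show ?thesis using froot_eqI[of "M' 10" m v] m_pos by simp
  qed
  ultimately show ?thesis using v assms unfolding root_code_def
    by simp (erule wp_mono, auto simp: bisect_inv_def add.commute)
qed

definition est_time :: nat where
  "est_time = length jss * (3 * J + 4) + 3 * J + 13 + m"

lemma wp_est_code:
  assumes "M 1 = B" "18 \<le> B" "M 8 = length w" "bits_at M B (length w) = w" "length w \<le> len" "M 16 = 1"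
  shows "wp cnt W (est_code m js0 jss)
    (\<lambda>M' n. M' 10 = est w \<and> frame {10, 11, 12, 13, 14, 15, 17} M M' \<and> n \<le> (W + 1) * (est_time + 1)) M"
  unfolding est_code_def
  apply simp
  apply (rule wp_mono[OF wp_min_code[of M B w]])
  using assms apply simp_all
  apply (elim conjE)
  subgoal for M1 n1
    apply (rule wp_mono[OF wp_root_code[of M1 "vmin w"]])
    using assms vmin_AJ apply (auto simp: est_def est_time_def algebra_simps)
     apply (simp_all add: frame_def)
    done
  done

end

section \<open>Walking down the tree of partial assignments\<close>

fun walk :: "(bool list \<Rightarrow> nat) \<Rightarrow> nat \<Rightarrow> bool list \<Rightarrow> nat \<Rightarrow> bool list \<times> nat" where
  "walk U 0 w r = (w, r)"
| "walk U (Suc n) w r = (if r < U (w @ [False]) then walk U n (w @ [False]) r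
     else walk U n (w @ [True]) (r - U (w @ [False])))"

lemma length_walk: "length (fst (walk U n w r)) = length w + n"
  by (induction n arbitrary: w r) auto

lemma bits_at_Suc: "bits_at M p (Suc l) = bits_at M p l @ [M (p + l) \<noteq> 0]"
  by (simp add: bits_at_def)

lemma length_bits_at [simp]: "length (bits_at M p l) = l"
  by (simp add: bits_at_def)

text \<open>The bit 0 is appended tentatively so that \<open>est_prog\<close> sees child 0.
  Truncated subtraction of its estimate \<open>u\<close> from \<open>r + 1\<close> gives a nonzero
  value exactly for \<open>r \<ge> u\<close>; then the budget is reduced and the bit overwritten by
  1. Cell \<open>9\<close> holds the number of bits still missing.\<close>

definition walk_step :: "prog \<Rightarrow> prog" where
  "walk_step est_prog = seqs [Op Add 15 1 8, Const 14 0, Store 15 14, Op Add 8 8 16, est_prog,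
     Op Add 15 7 16, Op Sub 15 15 10,
     Cond 15 (seqs [Op Sub 7 7 10, Op Add 15 1 8, Op Sub 15 15 16, Store 15 16]) Skip,
     Op Sub 9 2 8]"

text \<open>One more evaluation at the leaf decides whether the budget is that of an answer, since
  nothing on the way down rejects a budget.\<close>

definition walk_code :: "prog \<Rightarrow> prog" where
  "walk_code est_prog = seqs [Const 8 0, Op Sub 9 2 8, While 9 (walk_step est_prog), est_prog, Op Sub 15 10 7]"

context estimator
begin

abbreviation est_prog where "est_prog \<equiv> est_code m js0 jss"

definition base :: nat where "base = 18 + len"

definition est_cost :: nat where "est_cost = (W + 1) * (est_time + 1)"

text \<open>The walk that remains to be made ends where the whole walk ends. The budget never grows,
  so it keeps fitting into a word.\<close>

definition walk_inv :: "memory \<Rightarrow> nat \<Rightarrow> nat \<Rightarrow> memory \<Rightarrow> bool" where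
  "walk_inv M r i N \<longleftrightarrow> i \<le> len \<and> N 8 = len - i \<and> N 9 = i \<and>
     walk est i (bits_at N base (len - i)) (N 7) = walk est len [] r \<and> N 7 \<le> r \<and>
     frame ({7..15} \<union> {17} \<union> {base..}) M N"

lemma wp_walk_step:
  assumes M: "M 1 = base" "M 2 = len" "M 16 = 1" and r: "r + 1 < 2 ^ W"
    and inv: "walk_inv M r i N" and N: "N 9 \<noteq> 0"
  shows "i > 0 \<and> wp cnt W (walk_step est_prog) (\<lambda>N' n. walk_inv M r (i - 1) N' \<and> n \<le> est_cost + 14) N"
proof -
  define w where "w = bits_at N base (len - i)"
  have i: "i \<le> len" "length w = len - i" "N 8 = len - i" "N 9 = i"
     "bits_at N base (len - i) = w" "walk est i w (N 7) = walk est len [] r" "N 7 \<le> r"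
     and fr: "frame ({7..15} \<union> {17} \<union> {base..}) M N"
    using inv by (auto simp: walk_inv_def w_def)
  have i0: "i > 0" using i N by auto
  then obtain i' where i': "i = Suc i'" by (cases i) auto
  have N1: "N 1 = base" "N 2 = len" "N 16 = 1" using fr M by (auto simp: frame_def base_def)
  let ?l = "len - i"
  let ?N = "N(15 := base + ?l, 14 := 0, base + ?l := 0, 8 := ?l + 1)"
  have bl: "base + ?l < 2 ^ W" "base + ?l + 1 < 2 ^ W" "?l + 1 < 2 ^ W" "len < 2 ^ W"
    using len2_W i i0 by (auto simp: base_def)
  have W0: "(0::nat) < 2 ^ W" by simp
  have bits: "bits_at ?N base (length (w @ [False])) = w @ [False]"
  proof -
    have "bits_at ?N base ?l = w" unfolding i(5)[symmetric]
      by (rule bits_at_cong) (auto simp: base_def)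
    then show ?thesis using i by (simp add: bits_at_Suc base_def del: fun_upd_apply) (simp add: base_def)
  qed
  have step: "wp cnt W est_prog (\<lambda>M' n. M' 10 = est (w @ [False]) \<and> frame {10, 11, 12, 13, 14, 15, 17} ?N M' \<and>
      n \<le> est_cost) ?N"
    unfolding est_cost_def
    by (rule wp_est_code[OF _ _ _ bits]) (use i i0 N1 in \<open>auto simp: base_def\<close>)
  have fin: "wp cnt W (seqs [Op Add 15 7 16, Op Sub 15 15 10,
     Cond 15 (seqs [Op Sub 7 7 10, Op Add 15 1 8, Op Sub 15 15 16, Store 15 16]) Skip,
     Op Sub 9 2 8]) (\<lambda>N' n. walk_inv M r i' N' \<and> n \<le> 10) M1"
    if u: "M1 10 = est (w @ [False])" and fr1: "frame {10, 11, 12, 13, 14, 15, 17} ?N M1" for M1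
  proof -
    let ?u = "est (w @ [False])"
    have M1: "M1 7 = N 7" "M1 16 = 1" "M1 1 = base" "M1 8 = len - i'" "M1 2 = len" "M1 16 = 1"
      using fr1 N1 i i' by (auto simp: frame_def base_def)
    have w1: "bits_at M1 base (len - i') = w @ [False]"
    proof -
      have "bits_at M1 base (length (w @ [False])) = bits_at ?N base (length (w @ [False]))"
        by (rule bits_at_frame[OF fr1]) (auto simp: base_def)
      also note bits
      finally have "bits_at M1 base (length (w @ [False])) = w @ [False]" .
      then show ?thesis using i i' by (simp add: Suc_diff_Suc)
    qed
    have frM: "frame ({7..15} \<union> {17} \<union> {base..}) M M1"
      using fr fr1 by (auto simp: frame_def base_def)
    have n7: "N 7 + 1 < 2 ^ W" using i r by linarith
    have li: "len - i' = Suc ?l" using i i' by auto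
    show ?thesis
    proof (cases "N 7 < ?u")
      case True
      have "walk_inv M r i' (M1(15 := N 7 + 1 - ?u, 9 := len - (len - i')))"
      proof -
        have "bits_at (M1(15 := N 7 + 1 - ?u, 9 := len - (len - i'))) base (len - i') = w @ [False]"
          using w1 by (simp add: base_def del: fun_upd_apply)
        moreover have "frame ({7..15} \<union> {17} \<union> {base..}) M (M1(15 := N 7 + 1 - ?u, 9 := len - (len - i')))"
          using frM by (auto simp: frame_def base_def)
        ultimately show ?thesis
          unfolding walk_inv_def using True i i' M1 by auto
      qed
      moreover have "N 7 + 1 - ?u = 0" using True by simp
      moreover have "i' < 2 ^ W" using i i' bl by linarith
      ultimately show ?thesis using True M1 n7 u i i' by (simp add: fun_upd_same less_imp_diff_less)
    next
      case False
      define p where "p = base + ?l"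
      let ?M = "M1(15 := p, 7 := N 7 - ?u, p := 1, 9 := i')"
      have p: "\<And>k. k < 18 \<Longrightarrow> p \<noteq> k" "\<And>k. k < 18 \<Longrightarrow> k \<noteq> p" "base + (len - i') = Suc p" "Suc p < 2 ^ W"
        using li bl by (auto simp: p_def base_def)
      have bM: "bits_at ?M base (len - i') = w @ [True]"
      proof -
        have "bits_at ?M base ?l = bits_at M1 base ?l"
          by (rule bits_at_cong) (auto simp: base_def p_def)
        also have "\<dots> = w" using w1 unfolding li bits_at_Suc by simp
        finally show ?thesis unfolding li bits_at_Suc using p(1)[of 9] by (simp add: p_def)
      qed
      have inv': "walk_inv M r i' ?M"
      proof -
        have "frame ({7..15} \<union> {17} \<union> {base..}) M ?M"
          using frM by (auto simp: frame_def p_def)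
        moreover have "?M 7 = N 7 - ?u" "?M 8 = len - i'" "?M 9 = i'"
          using M1 p by auto
        moreover have "walk_inv M r i' K" if "frame ({7..15} \<union> {17} \<union> {base..}) M K"
            "K 7 = N 7 - ?u" "K 8 = len - i'" "K 9 = i'" "bits_at K base (len - i') = w @ [True]" for K
          unfolding walk_inv_def using that False i(1,6,7) i' by auto
        ultimately show ?thesis using bM by blast
      qed
      have "N 7 + 1 - ?u \<noteq> 0" "len - (len - i') = i'" "i' < 2 ^ W" using False i i' bl by auto
      then show ?thesis using False M1(1-5) n7 u p inv'
        by (simp add: less_imp_diff_less fun_upd_twist[of 7 15])
    qed
  qed
  let ?rest = "[Op Add 15 7 16, Op Sub 15 15 10,
     Cond 15 (seqs [Op Sub 7 7 10, Op Add 15 1 8, Op Sub 15 15 16, Store 15 16]) Skip,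
     Op Sub 9 2 8]"
  have eq: "wp cnt W (walk_step est_prog) Q N \<longleftrightarrow>
      wp cnt W est_prog (\<lambda>M1 n1. wp cnt W (seqs ?rest) (\<lambda>M2 n2. Q M2 (Suc (Suc (Suc (Suc (n1 + n2)))))) M1) ?N" for Q
    unfolding walk_step_def
      wp_seqs(2)[of cnt W "Op Add 15 1 8"] wp_seqs(2)[of cnt W "Const 14 0"] wp_seqs(2)[of cnt W "Store 15 14"]
      wp_seqs(2)[of cnt W "Op Add 8 8 16"] wp_seqs(2)[of cnt W est_prog] wp_simps apply_binop.simps
    using bl W0 by (simp add: N1[unfolded One_nat_def] i(3) base_def del: wp_seqs(2))
  have "wp cnt W (walk_step est_prog) (\<lambda>N' n. walk_inv M r i' N' \<and> n \<le> est_cost + 14) N"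
    unfolding eq
    by (rule wp_mono[OF step], elim conjE, drule (1) fin, erule wp_mono) simp
  then show ?thesis using i' by simp
qed

end

section \<open>Uniform draws from fair coins\<close>

definition draw_step :: prog where
  "draw_step = Seq (Flip 14) (seqs [Op Add 7 7 7, Op Add 7 7 14, Op Add 13 13 13, Op Sub 15 3 13])"

definition draw_code :: prog where
  "draw_code = Seq (seqs [Const 7 0, Const 13 1, Op Sub 15 3 13]) (While 15 draw_step)"

text \<open>The coin becomes the leading bit: it selects the lower or the upper half of the doubled
  range.\<close>

lemma bind_coin_uniform:
  fixes n :: nat
  shows "bind_spmf coin_spmf (\<lambda>c. map_spmf (G c) (spmf_of_set {..<n})) =
    map_spmf (\<lambda>y. if y < n then G False y else G True (y - n)) (spmf_of_set {..<2 * n})"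
proof -
  have "spmf_of_set {..<2 * n} = bind_spmf coin_spmf (\<lambda>c. map_spmf (\<lambda>y. if c then y + n else y) (spmf_of_set {..<n}))"
  proof (rule spmf_eqI)
    fix y
    have 1: "map_spmf (\<lambda>y. y + n) (spmf_of_set {..<n}) = spmf_of_set {n..<2 * n}"
    proof -
      have "(\<lambda>y. y + n) ` {..<n} = {n..<2 * n}"
        using image_add_atLeastLessThan'[of n 0 n] by (simp add: lessThan_atLeast0 mult_2)
      then show ?thesis by (simp add: inj_on_def)
    qed
    show "spmf (spmf_of_set {..<2 * n}) y = spmf (bind_spmf coin_spmf (\<lambda>c. map_spmf (\<lambda>y. if c then y + n else y) (spmf_of_set {..<n}))) y"
      by (simp add: spmf_bind integral_spmf_of_set UNIV_bool 1 spmf_of_set split: split_indicator)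
  qed
  then show ?thesis
    by (auto simp: map_spmf_bind_spmf spmf.map_comp o_def intro!: bind_spmf_cong map_spmf_cong)
qed

context estimator
begin

lemma wp_walk_code:
  assumes M: "M 1 = base" "M 2 = len" "M 16 = 1" and r: "M 7 = r" "r + 1 < 2 ^ W"
  shows "wp cnt W (walk_code est_prog) (\<lambda>M' n. bits_at M' base len = fst (walk est len [] r) \<and>
     (M' 15 \<noteq> 0 \<longleftrightarrow> snd (walk est len [] r) < est (fst (walk est len [] r))) \<and>
     frame ({7..15} \<union> {17} \<union> {base..}) M M' \<and> n \<le> (len + 1) * (est_cost + 15) + 6) M"
proof -
  let ?M = "M(8 := 0, 9 := len)"
  have inv: "walk_inv M r len ?M"
    using r by (auto simp: walk_inv_def bits_at_def frame_def)
  have loop: "wp cnt W (While 9 (walk_step est_prog)) (\<lambda>M' n. (\<exists>i'. walk_inv M r i' M') \<and> M' 9 = 0 \<and>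
      n \<le> len * Suc (est_cost + 14) + 1) ?M"
    by (rule wp_While_rule[where I = "walk_inv M r", OF wp_walk_step inv]) (use M r in auto)
  have fin: "wp cnt W (seqs [est_prog, Op Sub 15 10 7]) (\<lambda>M' n. bits_at M' base len = fst (walk est len [] r) \<and>
     (M' 15 \<noteq> 0 \<longleftrightarrow> snd (walk est len [] r) < est (fst (walk est len [] r))) \<and>
     frame ({7..15} \<union> {17} \<union> {base..}) M M' \<and> n \<le> est_cost + 2) M1"
    if inv: "walk_inv M r i M1" and "M1 9 = 0" for M1 i
  proof -
    from that have i: "i = 0" by (simp add: walk_inv_def)
    let ?w = "bits_at M1 base len"
    have w: "walk est len [] r = (?w, M1 7)" and M1: "M1 8 = len"
      and fr: "frame ({7..15} \<union> {17} \<union> {base..}) M M1" using inv i by (auto simp: walk_inv_def)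
    have M1': "M1 1 = base" "M1 16 = 1" using fr M by (auto simp: frame_def base_def)
    have est: "wp cnt W est_prog (\<lambda>M' n. M' 10 = est ?w \<and> frame {10, 11, 12, 13, 14, 15, 17} M1 M' \<and>
      n \<le> est_cost) M1"
      unfolding est_cost_def
      by (rule wp_est_code[of M1 base]) (use M1 M1' in \<open>auto simp: base_def\<close>)
    have "est ?w < 2 ^ W" using est_AJ[of ?w] AJ_W' by simp
    moreover have "bits_at (N(15 := x)) base len = ?w \<and> N 7 = M1 7 \<and> frame ({7..15} \<union> {17} \<union> {base..}) M N"
      if "frame {10, 11, 12, 13, 14, 15, 17} M1 N" for N x
    proof -
      have "bits_at N base len = ?w" by (rule bits_at_frame[OF that]) (auto simp: base_def)
      moreover have "frame ({7..15} \<union> {17} \<union> {base..}) M1 N"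
        using frame_mono[OF that] by auto
      moreover have "N 7 = M1 7" using that by (auto simp: frame_def)
      ultimately show ?thesis using frame_trans[OF fr] by (simp add: base_def del: fun_upd_apply)
    qed
    ultimately show ?thesis
      using w by (simp add: less_imp_diff_less) (rule wp_mono[OF est], auto)
  qed
  have "wp cnt W (seqs [While 9 (walk_step est_prog), est_prog, Op Sub 15 10 7]) (\<lambda>M' n. bits_at M' base len = fst (walk est len [] r) \<and>
     (M' 15 \<noteq> 0 \<longleftrightarrow> snd (walk est len [] r) < est (fst (walk est len [] r))) \<and>
     frame ({7..15} \<union> {17} \<union> {base..}) M M' \<and> n \<le> len * (est_cost + 15) + 1 + est_cost + 2) ?M"
    unfolding wp_seqs(2)[of _ _ "While 9 (walk_step est_prog)"]
    by (rule wp_mono[OF loop], elim conjE exE, drule (1) fin, erule wp_mono) (auto simp: add.commute)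
  then show ?thesis
    unfolding walk_code_def using M len2_W
    by (simp del: wp_seqs(2) add: wp_seqs(2)[of _ _ "Const 8 0"] wp_seqs(2)[of _ _ "Op Sub 9 2 8"] del: fun_upd_apply)
      (simp del: wp_seqs(2), erule wp_mono, auto)
qed

text \<open>After \<open>i\<close> flips, cell \<open>13\<close> is \<open>2 ^ i\<close> and cell
  \<open>7\<close> the number formed by the flips. \<open>k\<close> flips remain until
  \<open>2 ^ (i + k)\<close> reaches cell \<open>3\<close>; the strict inequality for
  \<open>k > 0\<close> prevents an earlier end. The result is a function \<open>G\<close> of a
  uniform number, since the time may depend on the number drawn.\<close>

lemma draw_loop:
  assumes "bounded_mem W M" "M 13 = 2 ^ i" "M 15 = M 3 - M 13" "M 3 \<le> 2 ^ (i + k)"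
    "k > 0 \<Longrightarrow> 2 ^ (i + k) < 2 * M 3" "M 7 < 2 ^ i" "i + k < W"
  shows "\<exists>G. exec cnt q (While 15 draw_step) (M, t) = map_spmf G (spmf_of_set {..<2 ^ k}) \<and>
    (\<forall>y<2 ^ k. \<exists>M' t'. G y = (M', t') \<and> bounded_mem W M' \<and> M' 7 = M 7 * 2 ^ k + y \<and>
       frame {7, 13, 14, 15} M M' \<and> t' \<le> t + (7 * k + 1) * step_cost q W)"
  using assms
proof (induction k arbitrary: M i t)
  case 0
  then have "M 15 = 0" by simp
  then have "exec cnt q (While 15 draw_step) (M, t) = return_spmf (test 15 (M, t))"
    by (simp add: loop.simps)
  moreover have "{..<2 ^ 0 :: nat} = {0}" by auto
  ultimately show ?case using 0 bounded_floorlog[of W M 15]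
    by (intro exI[of _ "\<lambda>_. test 15 (M, t)"]) (simp add: spmf_of_set_singleton step_cost_def)
next
  case (Suc k)
  let ?R = "seqs [Op Add 7 7 7, Op Add 7 7 14, Op Add 13 13 13, Op Sub 15 3 13]"
  define t1 where "t1 = t + 1 + floorlog 2 (M 15)"
  have t1: "t1 + 1 \<le> t + 2 * step_cost q W" using bounded_floorlog[of W M 15] Suc.prems
    by (simp add: t1_def step_cost_def)
  have "(2::nat) ^ i \<le> 2 ^ (i + k)" by (rule power_increasing) auto
  also have "\<dots> < M 3" using Suc.prems(5) by simp
  finally have n0: "M 15 \<noteq> 0" using Suc.prems by simp
  have pW: "(2::nat) ^ (i + Suc k) < 2 ^ W"
    using Suc.prems(7) by (intro power_strict_increasing) auto
  moreover have "(2::nat) ^ (i + 1) \<le> 2 ^ (i + Suc k)" by (intro power_increasing) auto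
  ultimately have pW': "2 ^ Suc i < (2::nat) ^ W" by (simp only: Suc_eq_plus1)
  have lt0: "(1::nat) < 2 ^ W" using len2_W by linarith
  define N where "N c = M(14 := of_bool c, 7 := 2 * M 7 + of_bool c, 13 := 2 ^ Suc i, 15 := M 3 - 2 ^ Suc i)" for c
  have lt: "2 * M 7 + 1 < 2 ^ Suc i" using Suc.prems(6) by simp
  have "\<exists>G. bind_spmf (return_spmf (M(14 := of_bool c), t1 + 1)) (\<lambda>s. bind_spmf (exec cnt q
        ?R s)
        (exec cnt q (While 15 draw_step))) = map_spmf G (spmf_of_set {..<2 ^ k}) \<and>
      (\<forall>y<2 ^ k. \<exists>M' t'. G y = (M', t') \<and> bounded_mem W M' \<and> M' 7 = N c 7 * 2 ^ k + y \<and>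
       frame {7, 13, 14, 15} M M' \<and> t' \<le> t + (7 * Suc k + 1) * step_cost q W)" for c
  proof -
    have one: "of_bool c \<le> (1::nat)" by simp
    have b1: "bounded_mem W (M(14 := of_bool c))"
      using Suc.prems(1) lt0 by (auto simp: bounded_mem_def)
    have "wp cnt W ?R
      (\<lambda>M' n. M' = N c \<and> n = 5) (M(14 := of_bool c))"
      using Suc.prems lt pW' one
      by (auto simp: N_def fun_eq_iff bounded_mem_def less_imp_diff_less)
    then have "big_step cnt W ?R
      (M(14 := of_bool c)) (N c) 5" by (auto simp: wp_def)
    from big_step_exec[OF this b1, of q] obtain t2 where bN: "bounded_mem W (N c)" and
      ex: "exec cnt q ?R (M(14 := of_bool c), t1 + 1)
        = return_spmf (N c, t2)" and t2: "t2 \<le> t1 + 1 + 5 * step_cost q W" by blast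
    have "\<exists>G. exec cnt q (While 15 draw_step) (N c, t2) = map_spmf G (spmf_of_set {..<2 ^ k}) \<and>
     (\<forall>y<2 ^ k. \<exists>M' t'. G y = (M', t') \<and> bounded_mem W M' \<and> M' 7 = N c 7 * 2 ^ k + y \<and>
       frame {7, 13, 14, 15} (N c) M' \<and> t' \<le> t2 + (7 * k + 1) * step_cost q W)"
      by (rule Suc.IH[where i = "Suc i", OF bN]) (use Suc.prems in \<open>auto simp: N_def\<close>)
    moreover have "frame {7, 13, 14, 15} M M'" if "frame {7, 13, 14, 15} (N c) M'" for M'
      using that by (auto simp: frame_def N_def)
    moreover have "t' \<le> t + (7 * Suc k + 1) * step_cost q W" if "t' \<le> t2 + (7 * k + 1) * step_cost q W" for t'
    proof -
      have "t' \<le> t + 2 * step_cost q W + 5 * step_cost q W + (7 * k + 1) * step_cost q W"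
        using that t2 t1 by linarith
      then show ?thesis by (simp add: algebra_simps)
    qed
    ultimately show ?thesis using ex by simp blast
  qed
  then obtain G where G1: "\<And>c. bind_spmf (return_spmf (M(14 := of_bool c), t1 + 1)) (\<lambda>s. bind_spmf (exec cnt q
        ?R s)
        (exec cnt q (While 15 draw_step))) = map_spmf (G c) (spmf_of_set {..<2 ^ k})"
    and G2: "\<And>c y. y < 2 ^ k \<Longrightarrow> \<exists>M' t'. G c y = (M', t') \<and> bounded_mem W M' \<and> M' 7 = N c 7 * 2 ^ k + y \<and>
       frame {7, 13, 14, 15} M M' \<and> t' \<le> t + (7 * Suc k + 1) * step_cost q W"
    by metis
  have "exec cnt q (While 15 draw_step) (M, t) =
      bind_spmf coin_spmf (\<lambda>c. bind_spmf (return_spmf (M(14 := of_bool c), t1 + 1)) (\<lambda>s. bind_spmf (exec cnt q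
        ?R s)
        (exec cnt q (While 15 draw_step))))"
    using n0 unfolding exec.simps(10) by (subst loop.simps) (simp add: draw_step_def t1_def bind_map_spmf o_def)
  also have "\<dots> = bind_spmf coin_spmf (\<lambda>c. map_spmf (G c) (spmf_of_set {..<2 ^ k}))"
    by (simp only: G1)
  also have "\<dots> = map_spmf (\<lambda>y. if y < 2 ^ k then G False y else G True (y - 2 ^ k)) (spmf_of_set {..<2 ^ Suc k})"
    by (simp add: bind_coin_uniform)
  finally have eq: "exec cnt q (While 15 draw_step) (M, t) =
      map_spmf (\<lambda>y. if y < 2 ^ k then G False y else G True (y - 2 ^ k)) (spmf_of_set {..<2 ^ Suc k})" .
  show ?case
  proof (intro exI[of _ "\<lambda>y. if y < 2 ^ k then G False y else G True (y - 2 ^ k)"] conjI allI impI eq)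
    fix y :: nat assume y: "y < 2 ^ Suc k"
    show "\<exists>M' t'. (if y < 2 ^ k then G False y else G True (y - 2 ^ k)) = (M', t') \<and> bounded_mem W M' \<and>
      M' 7 = M 7 * 2 ^ Suc k + y \<and> frame {7, 13, 14, 15} M M' \<and> t' \<le> t + (7 * Suc k + 1) * step_cost q W"
    proof (cases "y < 2 ^ k")
      case True
      then show ?thesis using G2[of y False] by (auto simp: N_def mult.assoc mult.left_commute)
    next
      case False
      then show ?thesis using G2[of "y - 2 ^ k" True] y by (auto simp: N_def algebra_simps)
    qed
  qed
qed

end

section \<open>The sampler\<close>

text \<open>The test of the budget in cell \<open>4\<close> only moves the counter and never
  produces an output, which would favour one answer; the counter stops at the first budget that
  hits. A successful draw raises it to the estimate at the root, so that cell \<open>6\<close>,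
  which controls the loop, becomes 0.\<close>

definition rest_code :: "prog \<Rightarrow> prog" where
  "rest_code est_prog = seqs [walk_code est_prog,
     Cond 15 (seqs [Const 5 1, Const 15 0, Op Add 4 3 15])
       (seqs [Op Add 7 4 15, walk_code est_prog, Cond 15 Skip (Op Add 4 4 16)]),
     Op Sub 6 3 4]"

definition init_code :: "nat \<Rightarrow> prog \<Rightarrow> prog" where
  "init_code k est_prog = seqs [Const 15 k, Op Mul 2 15 0, Const 1 18, Op Add 1 1 2, Const 16 1, Const 8 0, est_prog,
     Const 15 0, Op Add 3 10 15, Op Sub 6 3 4]"

text \<open>Bit \<open>x\<close> goes to cell \<open>x + 1\<close>, for \<open>x\<close> from 17 on.
  The targets lie above the registers and, being at most \<open>len\<close>, below the buffer, so no
  bit is lost before it is read.\<close>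

definition copy_step :: prog where
  "copy_step = seqs [Op Add 15 1 8, Load 14 15, Op Add 8 8 16, Store 8 14, Op Sub 9 2 8]"

text \<open>
  The registers occupy cells that must finally hold the first 17 bits of the answer. So each of these
  cells is loaded with the address of its bit (for cell \<open>1\<close>, the buffer address is already right), and
  \<open>Load a a\<close> then replaces the address by the bit.
\<close>

definition out_code :: prog where
  "out_code = seqs ([Const 0 1, Const 8 17, Op Sub 9 2 8, While 9 copy_step] @
     concat (map (\<lambda>a. [Const a (a - 1), Op Add a a 1]) [2..<18]) @ map (\<lambda>a. Load a a) [1..<18])"

definition sampler_code :: "nat \<Rightarrow> prog \<Rightarrow> prog" where
  "sampler_code k est_prog = Seq (init_code k est_prog)
     (Seq (While 6 (Seq draw_code (rest_code est_prog))) (Cond 5 out_code (Const 0 0)))"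

text \<open>No load reads a cell that a load of the sequence overwrites, so the loads act as a
  simultaneous one.\<close>

lemma wp_load_self:
  assumes "distinct as" "\<And>a. a \<in> set as \<Longrightarrow> M a \<notin> set as"
  shows "wp cnt W (seqs (map (\<lambda>a. Load a a) as)) Q M \<longleftrightarrow>
    Q (\<lambda>x. if x \<in> set as then M (M x) else M x) (length as + 1)"
  using assms
proof (induction as arbitrary: M Q)
  case (Cons a as)
  let ?M = "M(a := M (M a))"
  have "wp cnt W (seqs (map (\<lambda>a. Load a a) (a # as))) Q M \<longleftrightarrow>
      wp cnt W (seqs (map (\<lambda>a. Load a a) as)) (\<lambda>M' n. Q M' (1 + n)) ?M"
    by simp
  also have "\<dots> \<longleftrightarrow> Q (\<lambda>x. if x \<in> set as then ?M (?M x) else ?M x) (1 + (length as + 1))"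
    by (rule Cons.IH) (use Cons.prems in auto)
  also have "(\<lambda>x. if x \<in> set as then ?M (?M x) else ?M x) = (\<lambda>x. if x \<in> set (a # as) then M (M x) else M x)"
    using Cons.prems by (auto simp: fun_eq_iff)
  finally show ?case by simp
qed simp

lemma wp_addresses:
  assumes "distinct as" "\<And>a. a \<in> set as \<Longrightarrow> 2 \<le> a \<and> a - 1 + M 1 < 2 ^ W"
  shows "wp cnt W (seqs (concat (map (\<lambda>a. [Const a (a - 1), Op Add a a 1]) as) @ ps)) Q M \<longleftrightarrow>
    wp cnt W (seqs ps) (\<lambda>M' n. Q M' (2 * length as + n)) (\<lambda>x. if x \<in> set as then x - 1 + M 1 else M x)"
  using assms
proof (induction as arbitrary: M Q)
  case (Cons a as)
  let ?M = "M(a := a - 1 + M 1)"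
  have a: "2 \<le> a" "a - 1 + M 1 < 2 ^ W" using Cons.prems by auto
  then have a1: "a - 1 < 2 ^ W" "a \<noteq> 1" by auto
  have upd: "M(a := a - 1, a := (M(a := a - 1)) a + (M(a := a - 1)) 1) = ?M" using a1 by simp
  have "wp cnt W (seqs (concat (map (\<lambda>a. [Const a (a - 1), Op Add a a 1]) (a # as)) @ ps)) Q M \<longleftrightarrow>
      wp cnt W (seqs (concat (map (\<lambda>a. [Const a (a - 1), Op Add a a 1]) as) @ ps)) (\<lambda>M' n. Q M' (1 + (1 + n))) ?M"
    using a a1 by simp
  also have "\<dots> \<longleftrightarrow> wp cnt W (seqs ps) (\<lambda>M' n. Q M' (1 + (1 + (2 * length as + n))))
      (\<lambda>x. if x \<in> set as then x - 1 + ?M 1 else ?M x)"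
    by (rule Cons.IH) (use Cons.prems a1 in auto)
  also have "(\<lambda>x. if x \<in> set as then x - 1 + ?M 1 else ?M x) = (\<lambda>x. if x \<in> set (a # as) then x - 1 + M 1 else M x)"
    using Cons.prems a1 by (auto simp: fun_eq_iff)
  finally show ?case by simp
qed simp

context estimator
begin

definition hit :: "nat \<Rightarrow> bool" where
  "hit r \<longleftrightarrow> snd (walk est len [] r) < est (fst (walk est len [] r))"

definition walk_cost :: nat where "walk_cost = (len + 1) * (est_cost + 15) + 6"

definition main_inv :: "nat \<Rightarrow> memory \<Rightarrow> bool" where
  "main_inv j M \<longleftrightarrow> M 1 = base \<and> M 2 = len \<and> M 3 = est [] \<and> M 4 = j \<and> M 5 = 0 \<and>
     M 6 = est [] - j \<and> M 16 = 1 \<and> j \<le> est []"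

definition fin_inv :: "bool list \<Rightarrow> memory \<Rightarrow> bool" where
  "fin_inv w M \<longleftrightarrow> M 1 = base \<and> M 2 = len \<and> M 5 = 1 \<and> M 6 = 0 \<and> M 16 = 1 \<and> bits_at M base len = w"

lemma est_root_W: "4 * (est [] + 1) \<le> 2 ^ W"
  using est_AJ[of "[]"] AJ_W' by simp

lemma wp_rest_code:
  assumes inv: "main_inv j M" and j: "j < est []" and y: "M 7 = y" "y + 1 < 2 ^ W"
  shows "wp cnt W (rest_code est_prog) (\<lambda>M' n. (if hit y then fin_inv (fst (walk est len [] y)) M'
     else main_inv (if hit j then j else j + 1) M') \<and> n \<le> 2 * walk_cost + 12) M"
proof -
  note inv = inv[unfolded main_inv_def]
  have lt: "est [] + 1 < 2 ^ W" "(1::nat) < 2 ^ W" using est_root_W by simp_all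
  have w1: "wp cnt W (walk_code est_prog) (\<lambda>M' n. bits_at M' base len = fst (walk est len [] y) \<and>
     (M' 15 \<noteq> 0 \<longleftrightarrow> hit y) \<and> frame ({7..15} \<union> {17} \<union> {base..}) M M' \<and> n \<le> walk_cost) M"
    unfolding hit_def walk_cost_def by (rule wp_walk_code) (use inv y in auto)
  have w2: "wp cnt W (walk_code est_prog) (\<lambda>M' n.
     (M' 15 \<noteq> 0 \<longleftrightarrow> hit j) \<and> frame ({7..15} \<union> {17} \<union> {base..}) M M' \<and> n \<le> walk_cost) (M1(7 := j))"
    if fr: "frame ({7..15} \<union> {17} \<union> {base..}) M M1" for M1
  proof -
    have "wp cnt W (walk_code est_prog) (\<lambda>M' n. bits_at M' base len = fst (walk est len [] j) \<and>
      (M' 15 \<noteq> 0 \<longleftrightarrow> hit j) \<and> frame ({7..15} \<union> {17} \<union> {base..}) (M1(7 := j)) M' \<and> n \<le> walk_cost) (M1(7 := j))"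
      unfolding hit_def walk_cost_def
      by (rule wp_walk_code) (use inv j fr lt in \<open>auto simp: frame_def base_def\<close>)
    moreover have "frame ({7..15} \<union> {17} \<union> {base..}) M M'"
      if "frame ({7..15} \<union> {17} \<union> {base..}) (M1(7 := j)) M'" for M'
      using fr that by (auto simp: frame_def)
    ultimately show ?thesis by (auto elim: wp_mono)
  qed
  have fin: "wp cnt W (seqs [Cond 15 (seqs [Const 5 1, Const 15 0, Op Add 4 3 15])
       (seqs [Op Add 7 4 15, walk_code est_prog, Cond 15 Skip (Op Add 4 4 16)]), Op Sub 6 3 4])
     (\<lambda>M' n. (if hit y then fin_inv (fst (walk est len [] y)) M'
     else main_inv (if hit j then j else j + 1) M') \<and> n \<le> walk_cost + 10) M1"
    if "bits_at M1 base len = fst (walk est len [] y)" "M1 15 \<noteq> 0 \<longleftrightarrow> hit y"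
      and fr: "frame ({7..15} \<union> {17} \<union> {base..}) M M1" for M1
  proof -
    have M1: "M1 1 = base" "M1 2 = len" "M1 3 = est []" "M1 4 = j" "M1 5 = 0" "M1 16 = 1"
      using fr inv by (auto simp: frame_def base_def)
    show ?thesis
    proof (cases "hit y")
      case True
      have "bits_at (M1(5 := 1, 15 := 0, 4 := est [], 6 := 0)) base len = bits_at M1 base len"
        by (rule bits_at_cong) (auto simp: base_def)
      then show ?thesis using True that M1 lt
        by (simp add: fin_inv_def del: fun_upd_apply) simp
    next
      case False
      then have z: "M1 15 = 0" using that by simp
      have "j < 2 ^ W" using j lt by simp
      show ?thesis
      proof (cases "hit j")
        case True
        from this False z M1 lt \<open>j < 2 ^ W\<close> show ?thesis
          by simp (rule wp_mono[OF w2[OF fr]],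
            use True j inv in \<open>auto simp: main_inv_def frame_def base_def less_imp_diff_less\<close>)
      next
        case nh: False
        from this False z M1 lt \<open>j < 2 ^ W\<close> show ?thesis
          by simp (rule wp_mono[OF w2[OF fr]],
            use nh j inv in \<open>auto simp: main_inv_def frame_def base_def less_imp_diff_less\<close>)
      qed
    qed
  qed
  have "wp cnt W (rest_code est_prog) Q M \<longleftrightarrow> wp cnt W (walk_code est_prog) (\<lambda>M1 n1.
      wp cnt W (seqs [Cond 15 (seqs [Const 5 1, Const 15 0, Op Add 4 3 15])
       (seqs [Op Add 7 4 15, walk_code est_prog, Cond 15 Skip (Op Add 4 4 16)]), Op Sub 6 3 4])
       (\<lambda>M2 n2. Q M2 (n1 + n2)) M1) M" for Q
    unfolding rest_code_def wp_seqs(2)[of _ _ "walk_code est_prog"] ..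
  then show ?thesis
    by (simp only:) (rule wp_mono[OF w1], elim conjE, drule (2) fin, erule wp_mono, auto)
qed

lemma wp_init_code:
  assumes len: "len = k * b" and M: "M = (\<lambda>_. 0)(0 := b)" and W: "b \<le> W" "k \<le> W"
  shows "wp cnt W (init_code k est_prog) (\<lambda>M' n. main_inv 0 M' \<and> n \<le> est_cost + 12) M"
proof -
  let ?M = "M(15 := k, 2 := len, 1 := base, 16 := 1, 8 := 0)"
  have lt: "b < 2 ^ W" "k < 2 ^ W" "len < 2 ^ W" "base < 2 ^ W" "(1::nat) < 2 ^ W" "(18::nat) < 2 ^ W"
    using W_less W len2_W by (auto simp: base_def)
  have M0: "M 0 = b" using M by simp
  have est: "wp cnt W est_prog (\<lambda>M' n. M' 10 = est [] \<and> frame {10, 11, 12, 13, 14, 15, 17} ?M M' \<and>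
      n \<le> est_cost) ?M"
    unfolding est_cost_def
    by (rule wp_est_code[of ?M base]) (auto simp: base_def bits_at_def)
  have upd: "M(15 := k, 2 := len, 1 := 18, 1 := 18 + len, 16 := 1, 8 := 0) = ?M"
    by (simp add: base_def)
  have "wp cnt W (init_code k est_prog) Q M \<longleftrightarrow> wp cnt W est_prog (\<lambda>M1 n1. wp cnt W (seqs [Const 15 0, Op Add 3 10 15, Op Sub 6 3 4])
      (\<lambda>M2 n2. Q M2 (Suc (Suc (Suc (Suc (Suc (Suc (n1 + n2)))))))) M1) ?M" for Q
    unfolding init_code_def
      wp_seqs(2)[of cnt W "Const 15 k"] wp_seqs(2)[of cnt W "Op Mul 2 15 0"] wp_seqs(2)[of cnt W "Const 1 18"]
      wp_seqs(2)[of cnt W "Op Add 1 1 2"] wp_seqs(2)[of cnt W "Const 16 1"] wp_seqs(2)[of cnt W "Const 8 0"]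
      wp_seqs(2)[of cnt W est_prog] wp_simps apply_binop.simps
    using lt M0 by (simp add: base_def len[symmetric] del: wp_seqs(2))
  then show ?thesis
    apply (simp only:)
    apply (rule wp_mono[OF est])
    using M est_root_W lt apply (auto simp: main_inv_def frame_def)
    done
qed

lemma wp_out_code:
  assumes M: "fin_inv w M"
  shows "wp cnt W out_code (\<lambda>M' n. M' 0 = 1 \<and> bits_at M' 1 len = w \<and> n \<le> 7 * W + 60) M"
proof -
  note M = M[unfolded fin_inv_def]
  let ?R = "seqs (concat (map (\<lambda>a. [Const a (a - 1), Op Add a a 1]) [2..<18]) @ map (\<lambda>a. Load a a) [1..<18])"
  define I where "I i N \<longleftrightarrow> (\<exists>k. N 8 = k \<and> 17 \<le> k \<and> N 9 = len - k \<and> i = len - k \<and> N 1 = base \<and> N 2 = len \<and> N 16 = 1 \<and>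
    N 0 = 1 \<and> (\<forall>a\<ge>base. N a = M a) \<and> (\<forall>x. 17 \<le> x \<and> x < k \<longrightarrow> N (x + 1) = M (base + x)) \<and> (k \<le> len \<or> k = 17))"
    for i and N :: memory
  have step: "i > 0 \<and> wp cnt W copy_step (\<lambda>N' n. I (i - 1) N' \<and> n \<le> 6) N" if "I i N" "N 9 \<noteq> 0" for i N
  proof -
    from that(1) obtain k where k: "N 8 = k" "17 \<le> k" "N 9 = len - k" "i = len - k" "N 1 = base" "N 2 = len" "N 16 = 1"
      "N 0 = 1" "\<forall>a\<ge>base. N a = M a" "\<forall>x. 17 \<le> x \<and> x < k \<longrightarrow> N (x + 1) = M (base + x)"
      unfolding I_def by blast
    have kl: "k < len" using k that by simp
    then have lt: "base + k < 2 ^ W" "k + 1 < 2 ^ W" "len < 2 ^ W" using len2_W by (auto simp: base_def)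
    let ?N = "N(15 := base + k, 14 := M (base + k), 8 := k + 1, k + 1 := M (base + k), 9 := len - (k + 1))"
    have "I (i - 1) ?N" unfolding I_def
      by (rule exI[of _ "k + 1"]) (use k kl in \<open>auto simp: base_def less_Suc_eq\<close>)
    moreover have "N (base + k) = M (base + k)" using k by simp
    ultimately show ?thesis unfolding copy_step_def
      using k(1-8) kl lt by (simp add: base_def less_imp_diff_less)
  qed
  let ?M = "M(0 := 1, 8 := 17, 9 := len - 17)"
  have I0: "I (len - 17) ?M" unfolding I_def
    by (rule exI[of _ 17]) (use M in \<open>auto simp: base_def\<close>)
  have loop: "wp cnt W (While 9 copy_step) (\<lambda>N' n. (\<exists>i. I i N') \<and> N' 9 = 0 \<and> n \<le> (len - 17) * Suc 6 + 1) ?M"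
    by (rule wp_While_rule[where I = I, OF step I0])
  have fin: "wp cnt W ?R
    (\<lambda>M' n. M' 0 = 1 \<and> bits_at M' 1 len = w \<and> n \<le> 50) N" if "I i N" "N 9 = 0" for i N
  proof -
    from that obtain k where k: "len - k = 0" "N 1 = base" "N 0 = 1" "\<forall>a\<ge>base. N a = M a" "17 \<le> k"
      "\<forall>x. 17 \<le> x \<and> x < k \<longrightarrow> N (x + 1) = M (base + x)"
      unfolding I_def by auto
    let ?N1 = "\<lambda>x. if x \<in> {2..<18} then x - 1 + N 1 else N x"
    let ?N2 = "\<lambda>x. if x \<in> {1..<18} then ?N1 (?N1 x) else ?N1 x"
    have "bits_at ?N2 1 len = bits_at M base len"
      unfolding bits_at_def
    proof (intro map_cong refl)
      fix x assume "x \<in> set [0..<len]"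
      then have x: "x < len" by simp
      have "?N2 (1 + x) = M (base + x)"
      proof (cases "x < 17")
        case True
        then show ?thesis using k by (cases "x = 0") (auto simp: base_def add.commute)
      next
        case False
        then show ?thesis using k x by (auto simp: base_def)
      qed
      then show "(?N2 (1 + x) \<noteq> 0) = (M (base + x) \<noteq> 0)" by simp
    qed
    then have 1: "bits_at ?N2 1 len = w" using M by simp
    have 2: "?N2 0 = 1" using k by simp
    have eq: "wp cnt W ?R Q N
        \<longleftrightarrow> Q ?N2 (2 * length [2..<18] + (length [1..<18] + 1))" for Q
    proof (subst wp_addresses[where as = "[2..<18]", unfolded set_upt])
      fix a :: nat assume "a \<in> {2..<18}"
      then show "2 \<le> a \<and> a - 1 + N 1 < 2 ^ W" using k len2_W by (auto simp: base_def)
    next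
      show "wp cnt W (seqs (map (\<lambda>a. Load a a) [1..<18])) (\<lambda>M' n. Q M' (2 * length [2..<18] + n)) ?N1 \<longleftrightarrow>
        Q ?N2 (2 * length [2..<18] + (length [1..<18] + 1))"
        proof (rule wp_load_self[where as = "[1..<18]", unfolded set_upt])
        fix a :: nat assume "a \<in> {1..<18}"
        then show "?N1 a \<notin> {1..<18}" using k by (cases "a = 1") (auto simp: base_def)
      qed simp
    qed simp
    show ?thesis unfolding eq using 1 2 by (intro conjI) simp_all
  qed
  have lt: "(1::nat) < 2 ^ W" "(17::nat) < 2 ^ W" "len < 2 ^ W" using len2_W by auto
  have "len \<le> W" using len_W by simp
  have "wp cnt W out_code Q M \<longleftrightarrow> wp cnt W (While 9 copy_step) (\<lambda>M1 n1. wp cnt W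
     ?R
      (\<lambda>M2 n2. Q M2 (Suc (Suc (Suc (n1 + n2))))) M1) ?M" for Q
    unfolding out_code_def append.simps
      wp_seqs(2)[of cnt W "Const 0 1"] wp_seqs(2)[of cnt W "Const 8 17"] wp_seqs(2)[of cnt W "Op Sub 9 2 8"]
      wp_seqs(2)[of cnt W "While 9 copy_step"] wp_simps apply_binop.simps
    using lt M by (simp add: less_imp_diff_less del: wp_seqs(2) upt.simps upt_rec_numeral upt_Suc)
  moreover have "wp cnt W (While 9 copy_step) (\<lambda>M1 n1. wp cnt W
     ?R
      (\<lambda>M2 n2. M2 0 = 1 \<and> bits_at M2 1 len = w \<and> Suc (Suc (Suc (n1 + n2))) \<le> 7 * W + 60) M1) ?M"
    by (rule wp_mono[OF loop], elim conjE exE, drule (1) fin, erule wp_mono) (use \<open>len \<le> W\<close> in auto)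
  ultimately show ?thesis by blast
qed

definition ell :: nat where "ell = (LEAST k. est [] \<le> 2 ^ k)"

definition body_cost :: "nat \<Rightarrow> nat" where
  "body_cost q = (2 * walk_cost + 7 * W + 20) * step_cost q W"

definition total_cost :: "nat \<Rightarrow> nat" where
  "total_cost q = body_cost q + (est_cost + 7 * W + 80) * step_cost q W"

lemma ell_le: "est [] \<le> 2 ^ ell"
  unfolding ell_def by (rule LeastI[of _ "est []"]) (simp add: less_imp_le)

lemma ell_gt: "ell > 0 \<Longrightarrow> 2 ^ ell < 2 * est []"
proof -
  assume "ell > 0"
  then obtain k where k: "ell = Suc k" by (cases ell) auto
  then have "\<not> est [] \<le> 2 ^ k" using not_less_Least[of k "\<lambda>k. est [] \<le> 2 ^ k"] by (simp add: ell_def)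
  then show ?thesis using k by simp
qed

lemma ell_W: "ell + 2 \<le> W"
proof -
  have "2 \<le> W" using len_W by simp
  then obtain W' where W': "W = W' + 2" by (metis le_add_diff_inverse2)
  have "est [] \<le> 2 ^ W'" using est_root_W by (simp add: W' power_add)
  then have "ell \<le> W'" unfolding ell_def by (rule Least_le)
  then show ?thesis using W' by simp
qed

lemma ell_double: "est [] > 0 \<Longrightarrow> 2 ^ ell \<le> 2 * est []"
  using ell_gt by (cases "ell = 0") auto

text \<open>After the draw a round is deterministic, so it is the image of a uniform budget under
  one function \<open>H\<close>: the form that the rules for random loops expect. The counter moves
  only if the drawn budget and \<open>j\<close> both fail.\<close>

lemma exec_body:
  assumes bM: "bounded_mem W M" and inv: "main_inv j M" and j: "j < est []"
  shows "\<exists>H. exec cnt q (Seq draw_code (rest_code est_prog)) (M, t) = map_spmf H (spmf_of_set {..<2 ^ ell}) \<and>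
    (\<forall>y<2 ^ ell. \<exists>M' t'. H y = (M', t') \<and> bounded_mem W M' \<and> t' \<le> t + body_cost q \<and>
       (if hit y then fin_inv (fst (walk est len [] y)) M' else main_inv (if hit j then j else j + 1) M'))"
proof -
  let ?C = "step_cost q W"
  let ?M = "M(7 := 0, 13 := 1, 15 := est [] - 1)"
  have ltU: "est [] < 2 ^ W" "(1::nat) < 2 ^ W" using est_root_W by simp_all
  have "wp cnt W (seqs [Const 7 0, Const 13 1, Op Sub 15 3 13]) (\<lambda>M' n. M' = ?M \<and> n = 4) M"
    using inv ltU by (simp add: main_inv_def less_imp_diff_less)
  then have "big_step cnt W (seqs [Const 7 0, Const 13 1, Op Sub 15 3 13]) M ?M 4" by (auto simp: wp_def)
  from big_step_exec[OF this bM, of q] obtain t1 where b1: "bounded_mem W ?M"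
    and e1: "exec cnt q (seqs [Const 7 0, Const 13 1, Op Sub 15 3 13]) (M, t) = return_spmf (?M, t1)"
    and t1: "t1 \<le> t + 4 * ?C" by blast
  have "\<exists>G. exec cnt q (While 15 draw_step) (?M, t1) = map_spmf G (spmf_of_set {..<2 ^ ell}) \<and>
    (\<forall>y<2 ^ ell. \<exists>M' t'. G y = (M', t') \<and> bounded_mem W M' \<and> M' 7 = ?M 7 * 2 ^ ell + y \<and>
       frame {7, 13, 14, 15} ?M M' \<and> t' \<le> t1 + (7 * ell + 1) * ?C)"
    by (rule draw_loop[where i = 0, OF b1]) (use inv ell_le ell_gt ell_W in \<open>auto simp: main_inv_def\<close>)
  then obtain G where G: "exec cnt q (While 15 draw_step) (?M, t1) = map_spmf G (spmf_of_set {..<2 ^ ell})"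
    and G': "\<And>y. y < 2 ^ ell \<Longrightarrow> \<exists>M' t'. G y = (M', t') \<and> bounded_mem W M' \<and> M' 7 = ?M 7 * 2 ^ ell + y \<and>
       frame {7, 13, 14, 15} ?M M' \<and> t' \<le> t1 + (7 * ell + 1) * ?C" by blast
  have "\<exists>s'. exec cnt q (rest_code est_prog) (G y) = return_spmf s' \<and> (\<exists>M' t'. s' = (M', t') \<and>
      bounded_mem W M' \<and> t' \<le> t + body_cost q \<and>
       (if hit y then fin_inv (fst (walk est len [] y)) M' else main_inv (if hit j then j else j + 1) M'))"
    if y: "y < 2 ^ ell" for y
  proof -
    from G'[OF y] obtain M1 t2 where M1: "G y = (M1, t2)" "bounded_mem W M1" "M1 7 = y"
       "frame {7, 13, 14, 15} ?M M1" "t2 \<le> t1 + (7 * ell + 1) * ?C" by auto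
    have inv1: "main_inv j M1" using inv M1(4) by (auto simp: main_inv_def frame_def)
    have "(2::nat) ^ ell < 2 ^ W" using ell_W by (intro power_strict_increasing) auto
    then have yW: "y + 1 < 2 ^ W" using y by linarith
    from wp_rest_code[OF inv1 j M1(3) yW] obtain M2 n where
      M2: "big_step cnt W (rest_code est_prog) M1 M2 n" "if hit y then fin_inv (fst (walk est len [] y)) M2
     else main_inv (if hit j then j else j + 1) M2" "n \<le> 2 * walk_cost + 12" unfolding wp_def by blast
    from big_step_exec[OF M2(1) M1(2), of q] obtain t3 where t3: "bounded_mem W M2"
      "exec cnt q (rest_code est_prog) (M1, t2) = return_spmf (M2, t3)" "t3 \<le> t2 + n * ?C" by blast
    have "t3 \<le> t + 4 * ?C + (7 * ell + 1) * ?C + (2 * walk_cost + 12) * ?C"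
      using t3(3) M1(5) t1 mult_right_mono[OF M2(3), of ?C] by linarith
    also have "\<dots> = t + (2 * walk_cost + 7 * ell + 17) * ?C" by (simp add: algebra_simps)
    also have "\<dots> \<le> t + body_cost q" unfolding body_cost_def
      using ell_W by (intro add_left_mono mult_right_mono) auto
    finally show ?thesis using t3 M1 M2 by auto
  qed
  then obtain H where H: "\<And>y. y < 2 ^ ell \<Longrightarrow> exec cnt q (rest_code est_prog) (G y) = return_spmf (H y)"
    and H': "\<And>y. y < 2 ^ ell \<Longrightarrow> \<exists>M' t'. H y = (M', t') \<and> bounded_mem W M' \<and> t' \<le> t + body_cost q \<and>
       (if hit y then fin_inv (fst (walk est len [] y)) M' else main_inv (if hit j then j else j + 1) M')"
    by metis
  have "exec cnt q (Seq draw_code (rest_code est_prog)) (M, t) =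
      bind_spmf (spmf_of_set {..<2 ^ ell}) (\<lambda>y. exec cnt q (rest_code est_prog) (G y))"
    unfolding draw_code_def exec.simps(8)[of cnt q "Seq _ _"] exec.simps(8)[of cnt q "seqs _" "While _ _"]
    by (simp only: e1 return_bind_spmf G bind_map_spmf o_def)
  also have "\<dots> = bind_spmf (spmf_of_set {..<2 ^ ell}) (\<lambda>y. return_spmf (H y))"
    by (intro bind_spmf_cong refl H) auto
  also have "\<dots> = map_spmf H (spmf_of_set {..<2 ^ ell})" by (simp add: map_spmf_conv_bind_spmf)
  finally show ?thesis using H' by blast
qed

text \<open>The run starts after \<open>test 6\<close>, because leaving the loop charges a last
  test.\<close>

lemma exec_final:
  assumes "bounded_mem W M"
  shows "fin_inv w M \<Longrightarrow> \<exists>M' t'. exec cnt q (Cond 5 out_code (Const 0 0)) (test 6 (M, t)) = return_spmf (M', t') \<and>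
      answer len (M', t') = Some w \<and> t' \<le> t + (7 * W + 62) * step_cost q W"
    and "main_inv (est []) M \<Longrightarrow> \<exists>M' t'. exec cnt q (Cond 5 out_code (Const 0 0)) (test 6 (M, t)) = return_spmf (M', t') \<and>
      answer len (M', t') = None \<and> t' \<le> t + (7 * W + 62) * step_cost q W"
proof -
  let ?t = "t + 1 + floorlog 2 (M 6)"
  have t: "?t \<le> t + step_cost q W" using bounded_floorlog[OF assms, of 6] by (simp add: step_cost_def)
  have *: "\<exists>M' t'. exec cnt q (Cond 5 out_code (Const 0 0)) (test 6 (M, t)) = return_spmf (M', t') \<and>
      P M' \<and> t' \<le> t + (7 * W + 62) * step_cost q W"
    if "wp cnt W (Cond 5 out_code (Const 0 0)) (\<lambda>M' n. P M' \<and> n \<le> 7 * W + 61) M" for P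
  proof -
    from that obtain M' n where M': "big_step cnt W (Cond 5 out_code (Const 0 0)) M M' n" "P M'" "n \<le> 7 * W + 61"
      unfolding wp_def by blast
    from big_step_exec[OF M'(1) assms, of q] obtain t' where
      t': "exec cnt q (Cond 5 out_code (Const 0 0)) (M, ?t) = return_spmf (M', t')" "t' \<le> ?t + n * step_cost q W" by blast
    have "t' \<le> t + step_cost q W + (7 * W + 61) * step_cost q W"
      using t'(2) t mult_right_mono[OF M'(3), of "step_cost q W"] by linarith
    then show ?thesis using t' M' by (auto simp: algebra_simps)
  qed
  show "fin_inv w M \<Longrightarrow> \<exists>M' t'. exec cnt q (Cond 5 out_code (Const 0 0)) (test 6 (M, t)) = return_spmf (M', t') \<and>
      answer len (M', t') = Some w \<and> t' \<le> t + (7 * W + 62) * step_cost q W"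
  proof -
    assume f: "fin_inv w M"
    then have "M 5 \<noteq> 0" by (simp add: fin_inv_def)
    then have "wp cnt W (Cond 5 out_code (Const 0 0)) (\<lambda>M' n. (M' 0 = 1 \<and> bits_at M' 1 len = w) \<and> n \<le> 7 * W + 61) M"
      by simp (rule wp_mono[OF wp_out_code[OF f]], auto)
    from *[OF this] show ?thesis unfolding answer_def fst_conv by (metis zero_neq_one)
  qed
  show "main_inv (est []) M \<Longrightarrow> \<exists>M' t'. exec cnt q (Cond 5 out_code (Const 0 0)) (test 6 (M, t)) = return_spmf (M', t') \<and>
      answer len (M', t') = None \<and> t' \<le> t + (7 * W + 62) * step_cost q W"
  proof -
    assume "main_inv (est []) M"
    then have "M 5 = 0" by (simp add: main_inv_def)
    then have "wp cnt W (Cond 5 out_code (Const 0 0)) (\<lambda>M' n. M' 0 = 0 \<and> n \<le> 7 * W + 61) M"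
      by simp
    from *[OF this] show ?thesis unfolding answer_def fst_conv by metis
  qed
qed

lemma ennreal_le_trans: "x \<le> ennreal a \<Longrightarrow> a \<le> y \<Longrightarrow> y \<le> z \<Longrightarrow> x \<le> ennreal z"
  by (meson ennreal_leI order_trans)

text \<open>With a good budget the loop is a rejection loop that accepts the hits; without one it is
  a failing loop of \<open>est []\<close> rounds. Termination is read off from the output
  distribution, which has mass 1.\<close>

lemma sampler_correct:
  assumes len: "len = k * b" and W: "b \<le> W" "k \<le> W"
    and hits: "\<And>r. hit r \<Longrightarrow> r < est []"
    and inj: "inj_on (\<lambda>r. fst (walk est len [] r)) {r. hit r}"
    and T: "T = (\<lambda>r. fst (walk est len [] r)) ` {r. hit r}"
    and p: "p = exec cnt q (sampler_code k est_prog) ((\<lambda>_. 0)(0 := b), 0)"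
  shows "map_spmf (answer len) p = uniform_or_empty T"
    and "expected_time p \<le> ennreal (total_cost q * (1 + 2 * real (est []) / max 1 (card T)))"
proof -
  let ?C = "step_cost q W" and ?D = "(7 * W + 62) * step_cost q W"
  let ?body = "exec cnt q (Seq draw_code (rest_code est_prog))"
  let ?fin = "exec cnt q (Cond 5 out_code (Const 0 0))"
  define V :: nat where "V = 2 ^ ell"
  define f where "f r = Some (fst (walk est len [] r))" for r
  define G where "G = {r. hit r}"
  let ?M0 = "(\<lambda>_. 0)(0 := b) :: memory"
  have b0: "bounded_mem W ?M0" using W_less[OF W(1)] by (auto simp: bounded_mem_def)
  from wp_init_code[OF len refl W] obtain M1 n where M1: "big_step cnt W (init_code k est_prog) ?M0 M1 n"
    "main_inv 0 M1" "n \<le> est_cost + 12" unfolding wp_def by blast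
  from big_step_exec[OF M1(1) b0, of q] obtain t1 where b1: "bounded_mem W M1"
    and e1: "exec cnt q (init_code k est_prog) (?M0, 0) = return_spmf (M1, t1)" and t1: "t1 \<le> 0 + n * ?C" by blast
  have t1': "t1 \<le> (est_cost + 12) * ?C" using t1 mult_right_mono[OF M1(3), of ?C] by linarith
  have p': "p = bind_spmf (loop 6 ?body (M1, t1)) ?fin"
    unfolding p sampler_code_def by (simp only: exec.simps(8,10) e1 return_bind_spmf)
  have map_p: "map_spmf (answer len) p = bind_spmf (loop 6 ?body (M1, t1)) (\<lambda>s. map_spmf (answer len) (?fin s))"
    unfolding p' by (simp add: map_spmf_bind_spmf o_def)
  define h where "h s = (\<integral>\<^sup>+ x. of_nat (snd x) \<partial>measure_spmf (?fin s))" for s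
  have time_p: "(\<integral>\<^sup>+ x. of_nat (snd x) \<partial>measure_spmf p) = (\<integral>\<^sup>+ s. h s \<partial>measure_spmf (loop 6 ?body (M1, t1)))"
    unfolding p' h_def by (simp add: measure_spmf_bind o_def
        nn_integral_bind[where B="count_space UNIV"] space_subprob_algebra)
  have h_le: "h s \<le> of_nat u" if "?fin s = return_spmf (M', t')" "t' \<le> u" for s M' t' u
    using that by (simp add: h_def measure_spmf_return_spmf nn_integral_return)
  have inv_W: "\<And>M j. main_inv j M \<Longrightarrow> j \<le> est []" by (simp add: main_inv_def)
  have test6: "test 6 (M, t) = (M, t + 1 + floorlog 2 (M 6))" for M t by simp
  have test6_le: "t + 1 + floorlog 2 (M 6) + body_cost q \<le> t + (body_cost q + ?C)" if "bounded_mem W M" for M t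
    using bounded_floorlog[OF that, of 6] by (simp add: step_cost_def)
  have tot: "real t1 + ?D + (body_cost q + ?C) * z \<le> total_cost q * (1 + z)" if "z \<ge> 0" for z :: real
  proof -
    have "t1 + ?D \<le> total_cost q" using t1' by (simp add: total_cost_def algebra_simps)
    moreover have "body_cost q + ?C \<le> total_cost q" by (simp add: total_cost_def algebra_simps)
    ultimately have "real (t1 + ?D) + real (body_cost q + ?C) * z \<le> real (total_cost q) + real (total_cost q) * z"
      using that by (intro add_mono mult_right_mono of_nat_mono)
    then show ?thesis by (simp add: algebra_simps)
  qed
  have "map_spmf (answer len) p = uniform_or_empty T \<and>
     (\<integral>\<^sup>+ x. of_nat (snd x) \<partial>measure_spmf p) \<le> ennreal (total_cost q * (1 + 2 * real (est []) / max 1 (card T)))"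
  proof (cases "G = {}")
    case True
    then have nohit: "\<not> hit r" for r by (auto simp: G_def)
    have T0: "T = {}" using T True by (auto simp: G_def)
    define I where "I j s \<longleftrightarrow> bounded_mem W (fst s) \<and> main_inv j (fst s)" for j and s :: config
    have body: "fst s 6 \<noteq> 0 \<and> (\<exists>H. ?body (test 6 s) = map_spmf H (spmf_of_set {..<V}) \<and>
        (\<forall>r<V. snd (H r) \<le> snd s + (body_cost q + ?C) \<and> I (Suc j) (H r)))"
      if s: "I j s" "j < est []" for j s
    proof -
      obtain M t where [simp]: "s = (M, t)" by (cases s)
      from s have M: "bounded_mem W M" "main_inv j M" by (auto simp: I_def)
      from exec_body[OF M s(2), of q "t + 1 + floorlog 2 (M 6)"] obtain H where
        "?body (test 6 s) = map_spmf H (spmf_of_set {..<V})" and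
        H: "\<And>y. y < V \<Longrightarrow> \<exists>M' t'. H y = (M', t') \<and> bounded_mem W M' \<and> t' \<le> t + 1 + floorlog 2 (M 6) + body_cost q \<and>
           main_inv (j + 1) M'"
        unfolding V_def using nohit by auto
      moreover have "snd (H r) \<le> snd s + (body_cost q + ?C) \<and> I (Suc j) (H r)" if "r < V" for r
        using H[OF that] test6_le[OF M(1), of t] by (auto simp: I_def)
      moreover have "fst s 6 \<noteq> 0" using M s by (auto simp: main_inv_def)
      ultimately show ?thesis by blast
    qed
    have exit: "bind_spmf (loop 6 ?body s) (\<lambda>s. map_spmf (answer len) (?fin s)) = return_spmf None \<and>
        fst s 6 = 0 \<and> h (test 6 s) \<le> of_nat (snd s + ?D)"
      if s: "I (est []) s" for s
    proof -
      obtain M t where [simp]: "s = (M, t)" by (cases s)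
      from s have M: "bounded_mem W M" "main_inv (est []) M" by (auto simp: I_def)
      then have 0: "M 6 = 0" by (simp add: main_inv_def)
      from exec_final(2)[OF M, of q t] obtain M' t' where e: "?fin (test 6 s) = return_spmf (M', t')"
        "answer len (M', t') = None" "t' \<le> t + ?D" by auto
      from e 0 h_le[OF e(1), of "t + ?D"] show ?thesis
        by (subst loop.simps) (simp del: test.simps exec.simps of_nat_add of_nat_mult)
    qed
    have V0: "V > 0" by (simp add: V_def)
    have I0: "I 0 (M1, t1)" using M1 b1 by (simp add: I_def)
    have res: "map_spmf (answer len) p = return_spmf None"
      unfolding map_p
      by (rule failing_loop_result[of I "est []" 6 ?body V _ None 0, OF _ _ V0 I0]) (use body exit in blast)+
    have "(\<integral>\<^sup>+ s. h s \<partial>measure_spmf (loop 6 ?body (M1, t1))) \<le>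
        of_nat (snd (M1, t1) + ?D + (body_cost q + ?C) * (est [] - 0))"
      by (rule failing_loop_time[of I "est []" 6 ?body V, OF body _ V0 I0]) (use exit in auto)
    then have le1: "(\<integral>\<^sup>+ s. h s \<partial>measure_spmf (loop 6 ?body (M1, t1))) \<le>
        ennreal (real (snd (M1, t1) + ?D + (body_cost q + ?C) * (est [] - 0)))"
      by (simp only: ennreal_of_nat_eq_real_of_nat)
    have le2: "real (snd (M1, t1) + ?D + (body_cost q + ?C) * (est [] - 0)) \<le>
        total_cost q * (1 + real (est []))" using tot[of "est []"] by simp
    \<comment> \<open>Here \<open>max 1 (card T)\<close> is 1 and the scan takes
      \<open>est []\<close> rounds. The factor 2 comes from the other case, where the draws range
      below a power of two.\<close>
    have le3: "total_cost q * (1 + real (est [])) \<le> total_cost q * (1 + 2 * real (est []) / max 1 (card T))"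
      using T0 by (intro mult_left_mono) auto
    show ?thesis
      unfolding time_p using res T0 ennreal_le_trans[OF le1 le2 le3] by (simp only: uniform_or_empty_def if_True simp_thms)
  next
    case False
    then obtain g where g: "hit g" by (auto simp: G_def)
    have T0: "T \<noteq> {}" using T False by (auto simp: G_def)
    have U0: "est [] > 0" using hits[OF g] by simp
    have GV: "G \<subseteq> {..<V}" using hits ell_le by (force simp: G_def V_def)
    have cGT: "card T = card G" unfolding T G_def by (rule card_image[OF inj])
    have cG: "card G > 0" using GV False finite_subset by (auto simp: card_gt_0_iff)
    \<comment> \<open>Budgets below the counter fail, so the counter cannot pass the good budget
      \<open>g\<close> and stays below \<open>est []\<close>: the loop never ends by
      exhaustion.\<close>
    define I where "I s \<longleftrightarrow> (\<exists>j. bounded_mem W (fst s) \<and> main_inv j (fst s) \<and> (\<forall>i<j. \<not> hit i))" for s :: config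
    define F where "F y s \<longleftrightarrow> (\<exists>w. y = Some w \<and> bounded_mem W (fst s) \<and> fin_inv w (fst s))" for y and s :: config
    have run: "fst s 6 \<noteq> 0 \<and> (\<exists>H. ?body (test 6 s) = map_spmf H (spmf_of_set {..<V}) \<and>
        (\<forall>r<V. snd (H r) \<le> snd s + (body_cost q + ?C) \<and> (if r \<in> G then F (f r) (H r) else I (H r))))"
      if s: "I s" for s
    proof -
      obtain M t where [simp]: "s = (M, t)" by (cases s)
      from s obtain j where M: "bounded_mem W M" "main_inv j M" and j: "\<And>i. i < j \<Longrightarrow> \<not> hit i" by (auto simp: I_def)
      have "j \<le> g" using j g by (meson linorder_not_less)
      then have jU: "j < est []" using hits[OF g] by simp
      from exec_body[OF M jU, of q "t + 1 + floorlog 2 (M 6)"] obtain H where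
        "?body (test 6 s) = map_spmf H (spmf_of_set {..<V})" and
        H: "\<And>y. y < V \<Longrightarrow> \<exists>M' t'. H y = (M', t') \<and> bounded_mem W M' \<and> t' \<le> t + 1 + floorlog 2 (M 6) + body_cost q \<and>
           (if hit y then fin_inv (fst (walk est len [] y)) M' else main_inv (if hit j then j else j + 1) M')"
        unfolding V_def by auto
      moreover have "snd (H r) \<le> snd s + (body_cost q + ?C) \<and> (if r \<in> G then F (f r) (H r) else I (H r))" if "r < V" for r
      proof -
        from H[OF that] obtain M' t' where Hr: "H r = (M', t')" "bounded_mem W M'" "t' \<le> t + 1 + floorlog 2 (M 6) + body_cost q"
          "if hit r then fin_inv (fst (walk est len [] r)) M' else main_inv (if hit j then j else j + 1) M'" by blast
        have "I (H r)" if "\<not> hit r"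
        proof -
          have "\<forall>i<(if hit j then j else j + 1). \<not> hit i" using j by (auto simp: less_Suc_eq)
          moreover have "main_inv (if hit j then j else j + 1) M'" using Hr(4) that by (simp only: if_False)
          ultimately show ?thesis using Hr(1,2) unfolding I_def
            by (intro exI[of _ "if hit j then j else j + 1"]) (simp only: fst_conv simp_thms)
        qed
        moreover have "F (f r) (H r)" if "hit r"
          using Hr(1,2,4) that by (simp add: F_def f_def)
        moreover have "snd (H r) \<le> snd s + (body_cost q + ?C)"
          using Hr(1,3) test6_le[OF M(1), of t] by simp
        ultimately show ?thesis by (simp add: G_def)
      qed
      moreover have "fst s 6 \<noteq> 0" using M jU by (auto simp: main_inv_def)
      ultimately show ?thesis by blast
    qed
    have exit: "bind_spmf (loop 6 ?body s) (\<lambda>s. map_spmf (answer len) (?fin s)) = return_spmf y \<and>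
        fst s 6 = 0 \<and> h (test 6 s) \<le> of_nat (snd s + ?D)"
      if s: "F y s" for s y
    proof -
      obtain M t where [simp]: "s = (M, t)" by (cases s)
      from s obtain w where M: "bounded_mem W M" "fin_inv w M" "y = Some w" by (auto simp: F_def)
      then have 0: "M 6 = 0" by (simp add: fin_inv_def)
      from exec_final(1)[OF M(1,2), of q t] obtain M' t' where e: "?fin (test 6 s) = return_spmf (M', t')"
        "answer len (M', t') = Some w" "t' \<le> t + ?D" by auto
      from e 0 M h_le[OF e(1), of "t + ?D"] show ?thesis
        by (subst loop.simps) (simp del: test.simps exec.simps of_nat_add of_nat_mult)
    qed
    have I0: "I (M1, t1)" using M1 b1 by (auto simp: I_def)
    have bij: "bij_betw f G (Some ` T)"
      unfolding T G_def f_def bij_betw_def using inj by (auto simp: inj_on_def)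
    have res: "map_spmf (answer len) p = spmf_of_set (Some ` T)"
      unfolding map_p
      by (rule rejection_loop_uniform[where I = I and F = F and f = f and G = G and V = V, OF _ _ _ GV False bij I0])
        (use run exit in blast)+
    have le1: "(\<integral>\<^sup>+ s. h s \<partial>measure_spmf (loop 6 ?body (M1, t1))) \<le>
        ennreal (snd (M1, t1) + ?D + (body_cost q + ?C) * (V / card G))"
      by (rule rejection_loop_time[where I = I and F = "\<lambda>s. \<exists>y. F y s" and G = G and V = V, OF _ _ _ GV False I0])
        (use run exit in blast, use run in \<open>meson\<close>, use exit in blast)
    have le2: "real (snd (M1, t1) + ?D) + (body_cost q + ?C) * (V / card G) \<le>
        total_cost q * (1 + V / card G)" using tot[of "V / card G"] by simp
    have le3: "total_cost q * (1 + V / card G) \<le> total_cost q * (1 + 2 * real (est []) / max 1 (card T))"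
    proof (intro mult_left_mono add_left_mono)
      have "real V \<le> 2 * real (est [])" using ell_double[OF U0] unfolding V_def by (metis of_nat_le_iff of_nat_mult of_nat_numeral)
      then show "real V / real (card G) \<le> 2 * real (est []) / max 1 (card T)"
        using cG cGT by (simp add: divide_right_mono max_def)
    qed simp
    have "uniform_or_empty T = spmf_of_set (Some ` T)" using T0 by (simp add: uniform_or_empty_def)
    then show ?thesis
      unfolding time_p using res ennreal_le_trans[OF le1 le2 le3] by (simp only: simp_thms)
  qed
  moreover have "finite T"
  proof -
    have "G \<subseteq> {..<est []}" using hits by (auto simp: G_def)
    then show ?thesis unfolding T G_def[symmetric] using finite_subset by blast
  qed
  ultimately show "map_spmf (answer len) p = uniform_or_empty T"
    and "expected_time p \<le> ennreal (total_cost q * (1 + 2 * real (est []) / max 1 (card T)))"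
  proof -
    assume *: "map_spmf (answer len) p = uniform_or_empty T \<and>
     (\<integral>\<^sup>+ x. of_nat (snd x) \<partial>measure_spmf p) \<le> ennreal (total_cost q * (1 + 2 * real (est []) / max 1 (card T)))"
      and fT: "finite T"
    show "map_spmf (answer len) p = uniform_or_empty T" using * by simp
    have "lossless_spmf (uniform_or_empty T)" using fT by (simp add: uniform_or_empty_def)
    then have "lossless_spmf p" using * lossless_map_spmf by metis
    then show "expected_time p \<le> ennreal (total_cost q * (1 + 2 * real (est []) / max 1 (card T)))"
      using * by (simp add: expected_time_def)
  qed
qed

end

section \<open>Walks and superadditive estimates\<close>

text \<open>The descent never compares the budget with the estimate of child 1, so a budget that is
  too large shows only at the leaf. Superadditivity carries a success there back up the
  path.\<close>

lemma walk_hit_less: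
  assumes super: "\<And>w. length w < l \<Longrightarrow> U (w @ [False]) + U (w @ [True]) \<le> U w"
    and "length w + n = l" "snd (walk U n w r) < U (fst (walk U n w r))"
  shows "r < U w"
  using assms(2,3)
proof (induction n arbitrary: w r)
  case (Suc n)
  have s: "U (w @ [False]) + U (w @ [True]) \<le> U w" using super[of w] Suc.prems by simp
  show ?case
  proof (cases "r < U (w @ [False])")
    case False
    then have "r - U (w @ [False]) < U (w @ [True])"
      using Suc.IH[of "w @ [True]" "r - U (w @ [False])"] Suc.prems by simp
    then show ?thesis using s by linarith
  qed (use s in linarith)
qed simp

lemma walk_prefix: "\<exists>v. length v = n \<and> fst (walk U n w r) = w @ v"
proof (induction n arbitrary: w r)
  case (Suc n)
  from Suc.IH[of "w @ [False]" r] Suc.IH[of "w @ [True]" "r - U (w @ [False])"]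
  show ?case by (auto intro: exI[of _ "False # _"] exI[of _ "True # _"])
qed simp

text \<open>A leaf has estimate at most 1, so a budget that hits arrives there as 0. It is then the
  sum of the estimates subtracted on the way, which the path determines.\<close>

lemma walk_inj:
  assumes leaf: "\<And>w. length w = l \<Longrightarrow> U w \<le> 1"
    and "length w + n = l" "snd (walk U n w r) < U (fst (walk U n w r))"
    "snd (walk U n w r') < U (fst (walk U n w r'))" "fst (walk U n w r) = fst (walk U n w r')"
  shows "r = r'"
  using assms(2-)
proof (induction n arbitrary: w r r')
  case 0
  then show ?case using leaf[of w] by simp
next
  case (Suc n)
  show ?case
  proof (cases "r < U (w @ [False])")
    case 1: True
    show ?thesis
    proof (cases "r' < U (w @ [False])")
      case True
      then show ?thesis using Suc.IH[of "w @ [False]" r r'] Suc.prems 1 by simp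
    next
      case False
      then show ?thesis using Suc.prems 1 walk_prefix[of n U "w @ [False]" r]
          walk_prefix[of n U "w @ [True]" "r' - U (w @ [False])"] by auto
    qed
  next
    case 1: False
    show ?thesis
    proof (cases "r' < U (w @ [False])")
      case True
      then show ?thesis using Suc.prems 1 walk_prefix[of n U "w @ [False]" r']
          walk_prefix[of n U "w @ [True]" "r - U (w @ [False])"] by auto
    next
      case False
      then have "r - U (w @ [False]) = r' - U (w @ [False])"
        using Suc.IH[of "w @ [True]" "r - U (w @ [False])" "r' - U (w @ [False])"] Suc.prems 1 by simp
      then show ?thesis using 1 False by simp
    qed
  qed
qed

text \<open>The budget is assembled from the leaf upwards, adding the estimate of child 0 at every
  step to child 1. A step to child 0 requires the budget to be below that estimate, which is
  \<open>walk_hit_less\<close>.\<close>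

lemma walk_surj:
  assumes super: "\<And>w. length w < l \<Longrightarrow> U (w @ [False]) + U (w @ [True]) \<le> U w"
    and "length w + n = l" "length v = n" "0 < U (w @ v)"
  shows "\<exists>r. snd (walk U n w r) < U (fst (walk U n w r)) \<and> fst (walk U n w r) = w @ v"
  using assms(2-)
proof (induction n arbitrary: w v)
  case 0
  then show ?case by auto
next
  case (Suc n)
  then obtain c v' where v: "v = c # v'" "length v' = n" by (cases v) auto
  obtain r where r: "snd (walk U n (w @ [c]) r) < U (fst (walk U n (w @ [c]) r))"
    "fst (walk U n (w @ [c]) r) = (w @ [c]) @ v'"
    using Suc.IH[of "w @ [c]" v'] Suc.prems v by auto
  show ?case
  proof (cases c)
    case False
    then have "r < U (w @ [False])" using walk_hit_less[OF super, where w = "w @ [False]" and n = n and r = r] r Suc.prems by simp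
    then show ?thesis using r False v by (intro exI[of _ r]) simp
  next
    case True
    then show ?thesis using r v by (intro exI[of _ "r + U (w @ [False])"]) simp
  qed
qed

section \<open>Superadditivity and zeros of the estimate\<close>

definition cover_list :: "nat \<Rightarrow> (nat \<Rightarrow> nat) \<Rightarrow> nat list" where
  "cover_list r p = concat (map (\<lambda>i. replicate (p i) i) [0..<r])"

lemma prod_cover_list: "prod_list (map f (cover_list r p)) = (\<Prod>i<r. (f i :: nat) ^ p i)"
  by (induction r) (auto simp: cover_list_def prod_list_replicate)

lemma set_cover_list: "set (cover_list r p) \<subseteq> {..<r}"
  by (auto simp: cover_list_def)

context estimator
begin

lemma vprod_cover_list: "vprod (cover_list r p) w = (\<Prod>i<r. cnt i w ^ p i)"
  by (simp add: vprod_def prod_cover_list)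

text \<open>\<open>S\<close> is meant as the set of relations over the variable of the next bit:
  their counts split between the two children, the others stay. The cover condition at this variable
  is what \<open>holder_power\<close> asks for. For the minimum and the rounded root it is enough to
  bound the \<open>m\<close>-th power of the sum by each product.\<close>

lemma est_superadditive:
  assumes S: "S \<subseteq> {..<r}"
    and split: "\<And>i. i \<in> S \<Longrightarrow> cnt i w0 + cnt i w1 = cnt i w"
    and same: "\<And>i. i < r \<Longrightarrow> i \<notin> S \<Longrightarrow> cnt i w0 = cnt i w \<and> cnt i w1 = cnt i w"
    and cover: "\<And>js. js \<in> set (js0 # jss) \<Longrightarrow> \<exists>p. js = cover_list r p \<and> m \<le> (\<Sum>i\<in>S. p i)"
  shows "est w0 + est w1 \<le> est w"
proof -
  have fS: "finite S" using S finite_subset by auto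
  have "(est w0 + est w1) ^ m \<le> vprod js w" if js: "js \<in> set (js0 # jss)" for js
  proof -
    obtain p where p: "js = cover_list r p" "m \<le> (\<Sum>i\<in>S. p i)" using cover[OF js] by blast
    define z where "z = (\<Prod>i\<in>{..<r} - S. cnt i w ^ p i)"
    have prod: "vprod js v = (\<Prod>i\<in>S. cnt i v ^ p i) * (\<Prod>i\<in>{..<r} - S. cnt i v ^ p i)" for v
      unfolding p vprod_cover_list using S by (subst prod.subset_diff[OF S]) (auto simp: mult.commute)
    have le: "est v ^ m \<le> vprod js v" for v
    proof -
      have "vmin v \<le> vprod js v" unfolding vmin_eq using js by (intro Min_le) auto
      then show ?thesis using froot_power_le[OF m_pos, of "vmin v"] by (simp add: est_def)
    qed
    have "(\<Prod>i\<in>{..<r} - S. cnt i w0 ^ p i) = z" "(\<Prod>i\<in>{..<r} - S. cnt i w1 ^ p i) = z"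
      unfolding z_def using same by (auto intro!: prod.cong)
    then have "est w0 ^ m \<le> (\<Prod>i\<in>S. cnt i w0 ^ p i) * z" "est w1 ^ m \<le> (\<Prod>i\<in>S. cnt i w1 ^ p i) * z"
      using le[of w0] le[of w1] prod by auto
    from holder_power[OF fS m_pos p(2) this] have "(est w0 + est w1) ^ m \<le> (\<Prod>i\<in>S. (cnt i w0 + cnt i w1) ^ p i) * z" .
    also have "(\<Prod>i\<in>S. (cnt i w0 + cnt i w1) ^ p i) = (\<Prod>i\<in>S. cnt i w ^ p i)"
      using split by (auto intro!: prod.cong)
    finally show ?thesis unfolding prod z_def .
  qed
  then have "(est w0 + est w1) ^ m \<le> vmin w" unfolding vmin_eq by (subst Min_ge_iff) auto
  then show ?thesis unfolding est_def[of w] by (rule le_froot[OF m_pos])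
qed

lemma est_le_1:
  assumes "\<And>i. i < r \<Longrightarrow> cnt i w \<le> 1" "js0 = cover_list r p"
  shows "est w \<le> 1"
proof -
  have "vmin w \<le> vprod js0 w" unfolding vmin_eq by (intro Min_le) auto
  also have "\<dots> \<le> 1" unfolding assms(2) vprod_cover_list
    using assms(1) by (intro prod_le_1 conjI power_le_one) auto
  finally show ?thesis using froot_le[OF m_pos, of "vmin w"] by (simp add: est_def)
qed

text \<open>The cover \<open>js0\<close> contains every relation, so that a single vanishing count makes the estimate vanish.\<close>

lemma est_pos_iff:
  assumes js0: "js0 = cover_list r (\<lambda>_. m)" and jss: "\<And>js. js \<in> set jss \<Longrightarrow> \<exists>p. js = cover_list r p"
  shows "est w > 0 \<longleftrightarrow> (\<forall>i<r. cnt i w > 0)"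
proof
  assume "est w > 0"
  then have "vmin w > 0" using froot_le[OF m_pos, of "vmin w"] by (simp add: est_def)
  moreover have "vmin w \<le> vprod js0 w" unfolding vmin_eq by (intro Min_le) auto
  ultimately have "vprod js0 w \<noteq> 0" by simp
  then show "\<forall>i<r. cnt i w > 0" using m_pos unfolding js0 vprod_cover_list by auto
next
  assume pos: "\<forall>i<r. cnt i w > 0"
  have "1 \<le> vprod js w" if js: "js \<in> set (js0 # jss)" for js
  proof -
    obtain p where p: "js = cover_list r p" using js js0 jss by auto
    show ?thesis unfolding p vprod_cover_list using pos by (intro prod_ge_1) (auto simp: Suc_le_eq)
  qed
  then have "1 ^ m \<le> vmin w" unfolding vmin_eq by (subst Min_ge_iff) auto
  then have "1 \<le> est w" unfolding est_def by (rule le_froot[OF m_pos])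
  then show "est w > 0" by simp
qed

end

section \<open>Bit strings, agreement and decoding by blocks\<close>

text \<open>Quotient and remainder by \<open>b\<close> identify the variable and the bit, so the new
  position constrains a single bit of a single variable.\<close>

lemma agrees_snoc:
  assumes "length w = j * b + k" "k < b" "j < length vs"
  shows "agrees vs b enc (w @ [c]) Y t \<longleftrightarrow>
    agrees vs b enc w Y t \<and> (vs ! j \<in> Y \<longrightarrow> enc (t (vs ! j)) ! k = c)"
proof -
  have uniq: "j' = j \<and> k' = k" if "j' * b + k' = j * b + k" "k' < b" for j' k'
  proof -
    have "j' = (j' * b + k') div b" "k' = (j' * b + k') mod b" using that(2) by auto
    moreover have "j = (j * b + k) div b" "k = (j * b + k) mod b" using assms(2) by auto
    ultimately show ?thesis using that(1) by metis
  qed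
  show ?thesis
  proof (rule iffI)
    assume a: "agrees vs b enc (w @ [c]) Y t"
    have "agrees vs b enc w Y t" unfolding agrees_def[of vs b enc w]
    proof (intro allI impI)
      fix j' k' assume "j' < length vs" "k' < b" "vs ! j' \<in> Y \<and> j' * b + k' < length w"
      then show "enc (t (vs ! j')) ! k' = w ! (j' * b + k')"
        using a[unfolded agrees_def, rule_format, of j' k'] by (simp add: nth_append)
    qed
    moreover have "enc (t (vs ! j)) ! k = c" if "vs ! j \<in> Y"
      using a[unfolded agrees_def, rule_format, of j k] assms that by (simp add: nth_append)
    ultimately show "agrees vs b enc w Y t \<and> (vs ! j \<in> Y \<longrightarrow> enc (t (vs ! j)) ! k = c)" by blast
  next
    assume a: "agrees vs b enc w Y t \<and> (vs ! j \<in> Y \<longrightarrow> enc (t (vs ! j)) ! k = c)"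
    show "agrees vs b enc (w @ [c]) Y t" unfolding agrees_def
    proof (intro allI impI)
      fix j' k' assume jk: "j' < length vs" "k' < b" "vs ! j' \<in> Y \<and> j' * b + k' < length (w @ [c])"
      show "enc (t (vs ! j')) ! k' = (w @ [c]) ! (j' * b + k')"
      proof (cases "j' * b + k' < length w")
        case True
        then show ?thesis using a[unfolded agrees_def] jk by (simp add: nth_append)
      next
        case False
        then have "j' * b + k' = j * b + k" using jk assms by simp
        then show ?thesis using uniq[of j' k'] a jk assms by (simp add: nth_append)
      qed
    qed
  qed
qed

definition block :: "nat \<Rightarrow> bool list \<Rightarrow> nat \<Rightarrow> bool list" where
  "block b w j = take b (drop (j * b) w)"

lemma length_block: "length w = n * b \<Longrightarrow> j < n \<Longrightarrow> length (block b w j) = b"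
proof -
  assume "length w = n * b" "j < n"
  moreover have "Suc j * b \<le> n * b" using \<open>j < n\<close> by (intro mult_right_mono) auto
  ultimately have "b \<le> n * b - j * b" by (simp add: algebra_simps)
  then show ?thesis using \<open>length w = n * b\<close> by (simp add: block_def)
qed

lemma concat_blocks: "length w = n * b \<Longrightarrow> concat (map (block b w) [0..<n]) = w"
proof (induction n arbitrary: w)
  case (Suc n)
  have "map (block b w) [0..<n] = map (block b (take (n * b) w)) [0..<n]"
  proof (rule map_cong[OF refl])
    fix j assume "j \<in> set [0..<n]"
    then have "Suc j * b \<le> n * b" by (intro mult_right_mono) auto
    then show "block b w j = block b (take (n * b) w) j"
      by (simp add: block_def drop_take min_def)
  qed
  also have "concat \<dots> = take (n * b) w" using Suc.prems by (intro Suc.IH) simp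
  finally have "concat (map (block b w) [0..<n]) = take (n * b) w" .
  moreover have "block b w n = drop (n * b) w" using Suc.prems by (simp add: block_def)
  ultimately show ?case by simp
qed simp

lemma block_concat:
  assumes "\<And>x. x \<in> set xs \<Longrightarrow> length (f x) = b" "j < length xs"
  shows "block b (concat (map f xs)) j = f (xs ! j)"
  using assms
proof (induction xs arbitrary: j)
  case (Cons x xs)
  then show ?case by (cases j) (simp_all add: block_def)
qed simp

lemma agrees_full:
  assumes len: "length w = length vs * b" and enc: "\<And>j. j < length vs \<Longrightarrow> vs ! j \<in> Y \<Longrightarrow> length (enc (t (vs ! j))) = b"
  shows "agrees vs b enc w Y t \<longleftrightarrow> (\<forall>j<length vs. vs ! j \<in> Y \<longrightarrow> enc (t (vs ! j)) = block b w j)"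
proof -
  have lt: "j * b + k < length w" if "j < length vs" "k < b" for j k
  proof -
    have "j * b + k < Suc j * b" using that by simp
    also have "\<dots> \<le> length vs * b" using that by (intro mult_right_mono) auto
    finally show ?thesis using len by simp
  qed
  have nth: "block b w j ! k = w ! (j * b + k)" if "j < length vs" "k < b" for j k
    using lt[OF that] that by (simp add: block_def)
  have "(enc (t (vs ! j)) = block b w j) \<longleftrightarrow> (\<forall>k<b. enc (t (vs ! j)) ! k = w ! (j * b + k))"
    if "j < length vs" "vs ! j \<in> Y" for j
    using enc[OF that] length_block[OF len that(1)] nth[OF that(1)] by (auto simp: list_eq_iff_nth_eq)
  then show ?thesis unfolding agrees_def using lt by auto
qed

section \<open>Encoded queries\<close>

locale encoded_query =
  fixes X :: "'x set" and vs :: "'x list" and D :: "nat set" and Q :: "'x rel set"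
    and Rs :: "'x rel list" and b :: nat and enc :: "nat \<Rightarrow> bool list"
  assumes query: "join_query X D Q" and vs: "distinct vs" "set vs = X"
    and Rs: "set Rs = Q" and enc: "is_encoding D b enc" and cov: "\<Union> (fst ` Q) = X"
begin

abbreviation cnt where "cnt \<equiv> count_access vs b enc Rs"

lemma enc_eqD: "enc d = enc d' \<Longrightarrow> d \<in> D \<Longrightarrow> d' \<in> D \<Longrightarrow> d = d'"
  using enc by (auto simp: is_encoding_def inj_on_def)

lemma rel_props:
  assumes "i < length Rs"
  shows "Rs ! i \<in> Q" "fst (Rs ! i) \<subseteq> X" "snd (Rs ! i) \<subseteq> (fst (Rs ! i) \<rightarrow>\<^sub>E D)" "finite (snd (Rs ! i))"
proof -
  show Q: "Rs ! i \<in> Q" using assms Rs nth_mem by blast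
  then show X: "fst (Rs ! i) \<subseteq> X" and sub: "snd (Rs ! i) \<subseteq> (fst (Rs ! i) \<rightarrow>\<^sub>E D)"
    using query by (auto simp: join_query_def)
  have "finite (fst (Rs ! i))" "finite D" using query X finite_subset by (auto simp: join_query_def)
  then have "finite (fst (Rs ! i) \<rightarrow>\<^sub>E D)" by (simp add: finite_PiE)
  then show "finite (snd (Rs ! i))" using sub finite_subset by blast
qed

lemma length_enc: "i < length Rs \<Longrightarrow> t \<in> snd (Rs ! i) \<Longrightarrow> x \<in> fst (Rs ! i) \<Longrightarrow> t x \<in> D \<and> length (enc (t x)) = b"
  using rel_props(3)[of i] enc by (auto simp: is_encoding_def)

lemma cnt_split:
  assumes "length w = j * b + k" "k < b" "j < length vs" and i: "i < length Rs" and x: "vs ! j \<in> fst (Rs ! i)"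
  shows "cnt i (w @ [False]) + cnt i (w @ [True]) = cnt i w"
proof -
  let ?S = "\<lambda>w. {t \<in> snd (Rs ! i). agrees vs b enc w (fst (Rs ! i)) t}"
  have "?S w = ?S (w @ [False]) \<union> ?S (w @ [True])" "?S (w @ [False]) \<inter> ?S (w @ [True]) = {}"
    using x by (auto simp: agrees_snoc[OF assms(1-3)])
  then show ?thesis using i rel_props(4)[OF i] by (simp add: count_access_def card_Un_disjoint)
qed

lemma cnt_same:
  assumes "length w = j * b + k" "k < b" "j < length vs" and i: "i < length Rs" and x: "vs ! j \<notin> fst (Rs ! i)"
  shows "cnt i (w @ [c]) = cnt i w"
  using i x by (simp add: count_access_def agrees_snoc[OF assms(1-3)])

lemma cnt_Nil: "i < length Rs \<Longrightarrow> cnt i [] = card (snd (Rs ! i))"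
  by (simp add: count_access_def agrees_def)

lemma cnt_le: "cnt i w \<le> (\<Sum>R\<in>Q. card (snd R))"
proof (cases "i < length Rs")
  case True
  then have "cnt i w \<le> card (snd (Rs ! i))"
    using rel_props(4)[OF True] by (auto simp: count_access_def intro: card_mono)
  also have "\<dots> \<le> (\<Sum>R\<in>Q. card (snd R))"
    using rel_props(1)[OF True] query by (intro member_le_sum) (auto simp: join_query_def)
  finally show ?thesis .
qed (simp add: count_access_def)

lemma agrees_leaf:
  assumes "length w = length vs * b" "i < length Rs" "t \<in> snd (Rs ! i)"
  shows "agrees vs b enc w (fst (Rs ! i)) t \<longleftrightarrow>
    (\<forall>j<length vs. vs ! j \<in> fst (Rs ! i) \<longrightarrow> enc (t (vs ! j)) = block b w j)"
  using assms length_enc by (intro agrees_full) auto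

lemma cnt_leaf_le_1:
  assumes w: "length w = length vs * b" and i: "i < length Rs"
  shows "cnt i w \<le> 1"
proof -
  let ?Y = "fst (Rs ! i)"
  have "t = t'" if t: "t \<in> snd (Rs ! i)" "agrees vs b enc w ?Y t"
    and t': "t' \<in> snd (Rs ! i)" "agrees vs b enc w ?Y t'" for t t'
  proof
    fix x
    show "t x = t' x"
    proof (cases "x \<in> ?Y")
      case True
      then obtain j where j: "j < length vs" "x = vs ! j"
        using rel_props(2)[OF i] vs by (metis in_set_conv_nth subsetD)
      then have "enc (t x) = enc (t' x)"
        using agrees_leaf[OF w i] t t' True by auto
      then show ?thesis
        by (rule enc_eqD) (use length_enc[OF i t(1) True] length_enc[OF i t'(1) True] in blast)+
    next
      case False
      have "t \<in> (?Y \<rightarrow>\<^sub>E D)" "t' \<in> (?Y \<rightarrow>\<^sub>E D)" using rel_props(3)[OF i] t(1) t'(1) by auto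
      then show ?thesis using False by (metis PiE_arb)
    qed
  qed
  then show ?thesis using i rel_props(4)[OF i]
    by (auto simp: count_access_def card_le_Suc0_iff_eq)
qed

lemma ans_D: "\<tau> \<in> ans X D Q \<Longrightarrow> x \<in> set vs \<Longrightarrow> \<tau> x \<in> D \<and> length (enc (\<tau> x)) = b"
  using vs enc by (auto simp: ans_def is_encoding_def)

lemma length_enc_tuple: "\<tau> \<in> ans X D Q \<Longrightarrow> length (enc_tuple vs enc \<tau>) = length vs * b"
proof -
  assume \<tau>: "\<tau> \<in> ans X D Q"
  have "length (concat (map (\<lambda>x. enc (\<tau> x)) xs)) = length xs * b" if "set xs \<subseteq> set vs" for xs
    using that ans_D[OF \<tau>] by (induction xs) auto
  then show ?thesis by (simp add: enc_tuple_def)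
qed

lemma block_enc_tuple: "\<tau> \<in> ans X D Q \<Longrightarrow> j < length vs \<Longrightarrow> block b (enc_tuple vs enc \<tau>) j = enc (\<tau> (vs ! j))"
  unfolding enc_tuple_def using ans_D by (intro block_concat) auto

lemma inj_enc_tuple: "inj_on (enc_tuple vs enc) (ans X D Q)"
proof (rule inj_onI)
  fix \<tau> \<sigma> assume \<tau>: "\<tau> \<in> ans X D Q" and \<sigma>: "\<sigma> \<in> ans X D Q" and eq: "enc_tuple vs enc \<tau> = enc_tuple vs enc \<sigma>"
  show "\<tau> = \<sigma>"
  proof
    fix x
    show "\<tau> x = \<sigma> x"
    proof (cases "x \<in> X")
      case True
      then obtain j where j: "j < length vs" "x = vs ! j" using vs by (metis in_set_conv_nth)
      then have "enc (\<tau> x) = enc (\<sigma> x)"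
        using block_enc_tuple[OF \<tau> j(1)] block_enc_tuple[OF \<sigma> j(1)] eq by simp
      moreover have "\<tau> x \<in> D" "\<sigma> x \<in> D" using \<tau> \<sigma> True by (auto simp: ans_def)
      ultimately show ?thesis by (rule enc_eqD)
    next
      case False
      have "\<tau> \<in> X \<rightarrow>\<^sub>E D" "\<sigma> \<in> X \<rightarrow>\<^sub>E D" using \<tau> \<sigma> by (simp_all add: ans_def)
      with False show ?thesis by (metis PiE_arb)
    qed
  qed
qed

text \<open>A bit string need not encode values of \<open>D\<close>. If every relation has an
  agreeing tuple, then each variable lies in some relation, whose tuple supplies a value with the
  right block. Injectivity of \<open>enc\<close> makes the tuples of different relations coincide on
  common variables.\<close>

lemma leaf_iff_ans:
  assumes w: "length w = length vs * b"
  shows "(\<forall>i<length Rs. cnt i w > 0) \<longleftrightarrow> w \<in> enc_tuple vs enc ` ans X D Q"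
proof
  assume "w \<in> enc_tuple vs enc ` ans X D Q"
  then obtain \<tau> where \<tau>: "\<tau> \<in> ans X D Q" "w = enc_tuple vs enc \<tau>" by blast
  show "\<forall>i<length Rs. cnt i w > 0"
  proof (intro allI impI)
    fix i assume i: "i < length Rs"
    let ?t = "restrict \<tau> (fst (Rs ! i))"
    have t: "?t \<in> snd (Rs ! i)" using \<tau> rel_props(1)[OF i] by (auto simp: ans_def)
    moreover have "agrees vs b enc w (fst (Rs ! i)) ?t"
      using block_enc_tuple[OF \<tau>(1)] by (subst agrees_leaf[OF w i t]) (simp add: \<tau>(2))
    ultimately show "cnt i w > 0" using i rel_props(4)[OF i]
      by (auto simp: count_access_def card_gt_0_iff)
  qed
next
  assume pos: "\<forall>i<length Rs. cnt i w > 0"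
  have "\<exists>t. t \<in> snd (Rs ! i) \<and> agrees vs b enc w (fst (Rs ! i)) t" if "i < length Rs" for i
    using pos that by (auto simp: count_access_def card_gt_0_iff)
  then obtain t where t: "\<And>i. i < length Rs \<Longrightarrow> t i \<in> snd (Rs ! i)"
    "\<And>i. i < length Rs \<Longrightarrow> agrees vs b enc w (fst (Rs ! i)) (t i)" by metis
  have t_enc: "enc (t i (vs ! j)) = block b w j" if "i < length Rs" "j < length vs" "vs ! j \<in> fst (Rs ! i)" for i j
    using agrees_leaf[OF w that(1) t(1)] t(2) that by blast
  \<comment> \<open>Here the hypergraph has to cover \<open>X\<close>: a variable outside all
    relations would get no value from them.\<close>
  have "\<exists>d. d \<in> D \<and> (\<forall>j<length vs. vs ! j = x \<longrightarrow> enc d = block b w j)" if x: "x \<in> X" for x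
  proof -
    from x cov obtain R where "R \<in> Q" "x \<in> fst R" by auto
    then obtain i where i: "i < length Rs" "x \<in> fst (Rs ! i)" using Rs by (metis in_set_conv_nth)
    then show ?thesis using t_enc[OF i(1)] length_enc[OF i(1) t(1)] by (intro exI[of _ "t i x"]) auto
  qed
  then obtain g where g: "\<And>x. x \<in> X \<Longrightarrow> g x \<in> D"
    "\<And>x j. x \<in> X \<Longrightarrow> j < length vs \<Longrightarrow> vs ! j = x \<Longrightarrow> enc (g x) = block b w j" by metis
  let ?\<tau> = "restrict g X"
  have "restrict ?\<tau> (fst R) \<in> snd R" if "R \<in> Q" for R
  proof -
    from that Rs obtain i where i: "i < length Rs" "R = Rs ! i" by (metis in_set_conv_nth)
    have "restrict ?\<tau> (fst R) = t i"
    proof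
      fix x
      show "restrict ?\<tau> (fst R) x = t i x"
      proof (cases "x \<in> fst R")
        case True
        then have x: "x \<in> X" using rel_props(2)[OF i(1)] i by auto
        then obtain j where j: "j < length vs" "vs ! j = x" using vs by (metis in_set_conv_nth)
        have "enc (g x) = enc (t i x)" using g(2)[OF x j] t_enc[OF i(1) j(1)] j True i by simp
        moreover have "t i x \<in> D" using length_enc[OF i(1) t(1)[OF i(1)]] True i by blast
        ultimately have "g x = t i x" using g(1)[OF x] enc_eqD by blast
        then show ?thesis using True x by simp
      next
        case False
        have "t i \<in> (fst R \<rightarrow>\<^sub>E D)" using rel_props(3)[OF i(1)] t(1)[OF i(1)] i by blast
        from PiE_arb[OF this False] False show ?thesis by simp
      qed
    qed
    then show ?thesis using t(1)[OF i(1)] i by simp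
  qed
  then have \<tau>: "?\<tau> \<in> ans X D Q" using g(1) by (auto simp: ans_def)
  have "map (\<lambda>x. enc (?\<tau> x)) vs = map (block b w) [0..<length vs]"
  proof (rule nth_equalityI)
    fix j assume "j < length (map (\<lambda>x. enc (?\<tau> x)) vs)"
    then have j: "j < length vs" by simp
    then have x: "vs ! j \<in> X" using vs(2) nth_mem by blast
    show "map (\<lambda>x. enc (?\<tau> x)) vs ! j = map (block b w) [0..<length vs] ! j"
      using g(2)[OF x j refl] j x by simp
  qed simp
  then have "enc_tuple vs enc ?\<tau> = w" unfolding enc_tuple_def using concat_blocks[OF w] by simp
  then show "w \<in> enc_tuple vs enc ` ans X D Q" using \<tau> by blast
qed

text \<open>The lower bound on the worst case: variable \<open>x\<close> gets the first
  \<open>d x\<close> values and each relation is the full product over its edge. Its size is at most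
  \<open>exp\<close> of the sum of \<open>y\<close> over the edge, hence at most the size of every
  relation of \<open>Q\<close> on that edge, in particular of one that obeys \<open>N\<close>. The
  answers include the full product over \<open>X\<close>.\<close>

lemma product_query_le_wc:
  assumes mem: "(D, Q) \<in> card_class X E N" and pos: "\<And>i. i < length Rs \<Longrightarrow> snd (Rs ! i) \<noteq> {}"
    and y0: "\<And>x. x \<in> X \<Longrightarrow> 0 \<le> y x"
    and y: "\<And>i. i < length Rs \<Longrightarrow> (\<Sum>x\<in>X \<inter> fst (Rs ! i). y x) \<le> ln (card (snd (Rs ! i)))"
  shows "ennreal (exp (\<Sum>x\<in>X. y x)) \<le> 2 ^ card X * wc X (card_class X E N)"
proof -
  define d where "d x = nat \<lfloor>exp (y x)\<rfloor>" for x
  have finX: "finite X" and "finite Q" using query by (simp_all add: join_query_def)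
  have EX: "E = fst ` Q" and small: "\<forall>e\<in>E. \<exists>R\<in>Q. fst R = e \<and> card (snd R) \<le> N e"
    using mem by (simp_all add: card_class_def)
  have finE: "finite E" using EX \<open>finite Q\<close> by simp
  have d_le: "real (d x) \<le> exp (y x)" for x by (simp add: d_def)
  have d_ge: "exp (y x) \<le> 2 * real (d x)" if "x \<in> X" for x
  proof -
    \<comment> \<open>Rounding down a number that is at least 1 loses less than a factor of 2; below
      1 it would give 0.\<close>
    have "1 \<le> exp (y x)" using y0[OF that] by simp
    then have "1 \<le> \<lfloor>exp (y x)\<rfloor>" by (simp add: le_floor_iff)
    then show ?thesis unfolding d_def by linarith
  qed
  \<comment> \<open>The sum bounds each \<open>d x\<close>, so this one domain contains the values
    of all variables.\<close>
  define D' where "D' = {..<(\<Sum>x\<in>X. d x)}"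
  define Q' where "Q' = (\<lambda>e. (e, PiE e (\<lambda>x. {..<d x}))) ` E"
  have sub: "e \<subseteq> X" if "e \<in> E" for e using that EX query by (auto simp: join_query_def)
  have dD: "{..<d x} \<subseteq> D'" if "x \<in> X" for x
    using member_le_sum[OF that, of d] finX by (auto simp: D'_def)
  have "(D', Q') \<in> card_class X E N"
    unfolding card_class_def mem_Collect_eq prod.case
  proof (intro conjI ballI)
    show "join_query X D' Q'"
    proof -
      have "PiE e (\<lambda>x. {..<d x}) \<subseteq> (e \<rightarrow>\<^sub>E D')" if "e \<in> E" for e
        using sub[OF that] dD by (intro PiE_mono) blast
      moreover have "finite Q'" "finite D'" using finE by (auto simp: Q'_def D'_def)
      ultimately show ?thesis using finX sub by (simp add: join_query_def Q'_def)
    qed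
    show "fst ` Q' = E" by (force simp: Q'_def)
    fix e assume e: "e \<in> E"
    then obtain R where R: "R \<in> Q" "fst R = e" "card (snd R) \<le> N e" using small by blast
    then obtain i where i: "i < length Rs" "R = Rs ! i" using Rs by (metis in_set_conv_nth)
    have "card (snd R) > 0" using pos[OF i(1)] rel_props(4)[OF i(1)] i by (simp add: card_gt_0_iff)
    have "real (card (PiE e (\<lambda>x. {..<d x}))) = (\<Prod>x\<in>e. real (d x))"
      using finite_subset[OF sub[OF e] finX] by (simp add: card_PiE)
    also have "\<dots> \<le> (\<Prod>x\<in>e. exp (y x))" using d_le by (intro prod_mono) auto
    also have "\<dots> = exp (\<Sum>x\<in>X \<inter> e. y x)"
      using sub[OF e] finite_subset[OF sub[OF e] finX] by (simp add: exp_sum Int_absorb1)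
    also have "\<dots> \<le> exp (ln (card (snd R)))" using y[OF i(1)] R i by simp
    also have "\<dots> = card (snd R)" using \<open>card (snd R) > 0\<close> by simp
    finally have "card (PiE e (\<lambda>x. {..<d x})) \<le> N e" using R(3) by linarith
    then show "\<exists>R\<in>Q'. fst R = e \<and> card (snd R) \<le> N e" using e by (auto simp: Q'_def)
  qed
  then have "of_nat (card (ans X D' Q')) \<le> wc X (card_class X E N)"
    unfolding wc_def by (intro SUP_upper2[of "(D', Q')"]) auto
  moreover have "(\<Prod>x\<in>X. d x) \<le> card (ans X D' Q')"
  proof -
    have "finite (X \<rightarrow>\<^sub>E D')" using finX by (simp add: finite_PiE D'_def)
    then have "finite (ans X D' Q')" by (rule finite_subset[rotated]) (auto simp: ans_def)
    moreover have "PiE X (\<lambda>x. {..<d x}) \<subseteq> ans X D' Q'"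
    proof
      fix \<tau> assume \<tau>: "\<tau> \<in> PiE X (\<lambda>x. {..<d x})"
      have "PiE X (\<lambda>x. {..<d x}) \<subseteq> (X \<rightarrow>\<^sub>E D')" using dD by (intro PiE_mono) blast
      then have "\<tau> \<in> X \<rightarrow>\<^sub>E D'" using \<tau> by blast
      moreover have "restrict \<tau> e \<in> PiE e (\<lambda>x. {..<d x})" if "e \<in> E" for e
        unfolding restrict_PiE_iff using PiE_mem[OF \<tau>] sub[OF that] by blast
      ultimately show "\<tau> \<in> ans X D' Q'" by (auto simp: ans_def Q'_def)
    qed
    ultimately have "card (PiE X (\<lambda>x. {..<d x})) \<le> card (ans X D' Q')" by (rule card_mono)
    then show ?thesis using finX by (simp add: card_PiE)
  qed
  ultimately have le: "of_nat (\<Prod>x\<in>X. d x) \<le> wc X (card_class X E N)"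
    by (meson of_nat_mono order_trans)
  have "exp (\<Sum>x\<in>X. y x) = (\<Prod>x\<in>X. exp (y x))" using finX by (simp add: exp_sum)
  also have "\<dots> \<le> (\<Prod>x\<in>X. 2 * real (d x))" using d_ge by (intro prod_mono) auto
  also have "\<dots> = real (2 ^ card X * (\<Prod>x\<in>X. d x))" by (simp add: prod.distrib)
  finally have "ennreal (exp (\<Sum>x\<in>X. y x)) \<le> of_nat (2 ^ card X * (\<Prod>x\<in>X. d x))"
    by (simp only: ennreal_of_nat_eq_real_of_nat ennreal_leI)
  also have "\<dots> = 2 ^ card X * of_nat (\<Prod>x\<in>X. d x)" by (simp only: of_nat_mult of_nat_power of_nat_numeral)
  also have "\<dots> \<le> 2 ^ card X * wc X (card_class X E N)" by (intro mult_left_mono le) simp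
  finally show ?thesis .
qed

end

section \<open>Cost, correctness and number of rounds for an encoded query\<close>

lemma uniform_or_empty_image:
  "inj_on f S \<Longrightarrow> uniform_or_empty (f ` S) = map_spmf (map_option f) (uniform_or_empty S)"
proof (cases "S = {}")
  case False
  assume inj: "inj_on f S"
  have "map_spmf (map_option f) (spmf_of_set (Some ` S)) = spmf_of_set (map_option f ` Some ` S)"
    using inj by (intro map_spmf_of_set_inj_on) (auto simp: inj_on_def)
  moreover have "map_option f ` Some ` S = Some ` f ` S" by (auto simp: image_iff)
  ultimately show ?thesis using False by (simp add: uniform_or_empty_def)
qed (simp add: uniform_or_empty_def)

context estimator
begin

text \<open>A walk evaluates the estimate \<open>len + 1\<close> times, and one evaluation takes up
  to \<open>W\<close> rounds of bisection. As \<open>len + 1 \<le> W\<close>, the step count is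
  quadratic in the word length.\<close>

lemma total_cost_le: "total_cost q \<le> W ^ 2 * (6 * est_time + 162) * step_cost q W"
proof -
  have W: "len + 1 \<le> W" "1 \<le> W" using len_W by auto
  have WW: "W \<le> W ^ 2" "1 \<le> W ^ 2" using W by (auto simp: power2_eq_square)
  have est: "est_cost \<le> W * (2 * (est_time + 1))"
    using mult_right_mono[of "W + 1" "2 * W" "est_time + 1"] W by (simp add: est_cost_def algebra_simps)
  have est2: "est_cost \<le> W ^ 2 * (2 * (est_time + 1))"
    using est mult_right_mono[OF WW(1), of "2 * (est_time + 1)"] by linarith
  have "walk_cost \<le> W * (W * (2 * (est_time + 1)) + W * 15) + W ^ 2 * 6"
    unfolding walk_cost_def using W WW est by (intro add_mono mult_mono) auto
  also have "\<dots> = W ^ 2 * (2 * (est_time + 1) + 21)" by (simp add: power2_eq_square algebra_simps)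
  finally have walk: "walk_cost \<le> W ^ 2 * (2 * (est_time + 1) + 21)" .
  have "total_cost q = (2 * walk_cost + est_cost + 14 * W + 100) * step_cost q W"
    by (simp add: total_cost_def body_cost_def algebra_simps)
  also have "\<dots> \<le> (2 * (W ^ 2 * (2 * (est_time + 1) + 21)) + W ^ 2 * (2 * (est_time + 1)) + W ^ 2 * 14 + W ^ 2 * 100) * step_cost q W"
    using walk est2 WW by (intro mult_right_mono add_mono) auto
  also have "\<dots> = W ^ 2 * (6 * est_time + 162) * step_cost q W" by (simp add: algebra_simps)
  finally show ?thesis .
qed

end

text \<open>For the degenerate case of at most one value: there \<open>log 2 (card D)\<close> is 0,
  the claimed bound drops to the constant 1, and the number of rounds must be constant
  outright.\<close>

lemma (in encoded_query) card_rel_le_1: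
  assumes "card D \<le> 1" "i < length Rs"
  shows "card (snd (Rs ! i)) \<le> 1"
proof -
  have fin: "finite D" "finite (fst (Rs ! i))"
    using query rel_props(2)[OF assms(2)] finite_subset by (auto simp: join_query_def)
  have "card (snd (Rs ! i)) \<le> card (fst (Rs ! i) \<rightarrow>\<^sub>E D)"
    using rel_props(3)[OF assms(2)] fin by (intro card_mono finite_PiE) auto
  also have "\<dots> = card D ^ card (fst (Rs ! i))" using fin by (simp add: card_PiE)
  also have "\<dots> \<le> 1" using assms(1) by (intro power_le_one) auto
  finally show ?thesis .
qed

text \<open>\<open>covers\<close> makes the estimate superadditive, \<open>dual\<close> makes it
  tight at the root. The constant function \<open>m\<close>, put in front of \<open>ps\<close>, is a
  cover because every variable occurs in some relation.\<close>

locale encoded_query_covers = encoded_query X vs D Q Rs b enc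
  for X :: "'x set" and vs D Q Rs b enc +
  fixes m :: nat and ps :: "(nat \<Rightarrow> nat) list" and W A J :: nat
  assumes m0: "m > 0"
    and covers: "\<And>p x. p \<in> set ps \<Longrightarrow> x \<in> X \<Longrightarrow> m \<le> (\<Sum>i | i < length Rs \<and> x \<in> fst (Rs ! i). p i)"
    and dual: "\<And>s :: nat \<Rightarrow> real. (\<And>i. i < length Rs \<Longrightarrow> 0 \<le> s i) \<Longrightarrow>
       \<exists>p\<in>set ps. \<exists>y. (\<forall>x\<in>X. 0 \<le> y x) \<and> (\<forall>i<length Rs. (\<Sum>x\<in>X \<inter> fst (Rs ! i). y x) \<le> s i) \<and>
         (\<Sum>i<length Rs. real (p i) * s i) \<le> real m * (\<Sum>x\<in>X. y x)"
    and est: "estimator (count_access vs b enc Rs) W (length vs * b) m A J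
      (cover_list (length Rs) (\<lambda>_. m)) (map (cover_list (length Rs)) ps)"
    and W_ge: "b \<le> W" "length vs \<le> W"
begin

sublocale estimator "count_access vs b enc Rs" W "length vs * b" m A J
  "cover_list (length Rs) (\<lambda>_. m)" "map (cover_list (length Rs)) ps"
  by (rule est)

lemma est_bits_superadditive:
  assumes "length w < length vs * b"
  shows "est (w @ [False]) + est (w @ [True]) \<le> est w"
proof -
  define j where "j = length w div b"
  define k where "k = length w mod b"
  have b: "b > 0" using assms by (cases b) auto
  have w: "length w = j * b + k" "k < b" using b by (simp_all add: j_def k_def)
  have j: "j < length vs" using assms by (simp add: j_def less_mult_imp_div_less)
  then have x: "vs ! j \<in> X" using vs(2) nth_mem by blast
  let ?S = "{i. i < length Rs \<and> vs ! j \<in> fst (Rs ! i)}"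
  show ?thesis
  proof (rule est_superadditive[where r = "length Rs" and S = ?S])
    show "cnt i (w @ [False]) + cnt i (w @ [True]) = cnt i w" if "i \<in> ?S" for i
      using that by (intro cnt_split[OF w j]) auto
    show "cnt i (w @ [False]) = cnt i w \<and> cnt i (w @ [True]) = cnt i w" if "i < length Rs" "i \<notin> ?S" for i
      using that cnt_same[OF w j] by auto
    show "\<exists>p. js = cover_list (length Rs) p \<and> m \<le> (\<Sum>i\<in>?S. p i)"
      if js: "js \<in> set (cover_list (length Rs) (\<lambda>_. m) # map (cover_list (length Rs)) ps)" for js
    proof -
      consider "js = cover_list (length Rs) (\<lambda>_. m)" | p where "p \<in> set ps" "js = cover_list (length Rs) p"
        using js by auto
      then show ?thesis
      proof cases
        case 1
        from x cov obtain R where "R \<in> Q" "vs ! j \<in> fst R" by auto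
        then have "?S \<noteq> {}" using Rs by (auto simp: in_set_conv_nth)
        then have "m \<le> card ?S * m" by (simp add: Suc_le_eq card_gt_0_iff)
        then show ?thesis using 1 by auto
      next
        case 2
        then show ?thesis using covers[OF 2(1) x] by auto
      qed
    qed
  qed auto
qed

lemma est_leaf_le_1: "length w = length vs * b \<Longrightarrow> est w \<le> 1"
  by (rule est_le_1[OF cnt_leaf_le_1 refl])

lemma est_pos: "est w > 0 \<longleftrightarrow> (\<forall>i<length Rs. cnt i w > 0)"
  by (rule est_pos_iff) auto

lemma hits_image:
  "(\<lambda>r. fst (walk est (length vs * b) [] r)) ` {r. hit r} = enc_tuple vs enc ` ans X D Q"
proof (intro equalityI subsetI)
  fix w assume "w \<in> (\<lambda>r. fst (walk est (length vs * b) [] r)) ` {r. hit r}"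
  then obtain r where r: "hit r" "w = fst (walk est (length vs * b) [] r)" by blast
  then have "est w > 0" by (auto simp: hit_def)
  moreover have "length w = length vs * b" using r by (simp add: length_walk)
  ultimately show "w \<in> enc_tuple vs enc ` ans X D Q" using est_pos leaf_iff_ans by blast
next
  fix w assume w: "w \<in> enc_tuple vs enc ` ans X D Q"
  then have len: "length w = length vs * b" using length_enc_tuple by auto
  then have pos: "0 < est ([] @ w)" using w est_pos leaf_iff_ans by (metis append_Nil)
  have "\<exists>r. snd (walk est (length vs * b) [] r) < est (fst (walk est (length vs * b) [] r)) \<and>
      fst (walk est (length vs * b) [] r) = [] @ w"
    by (rule walk_surj[OF est_bits_superadditive _ len pos]) auto
  then show "w \<in> (\<lambda>r. fst (walk est (length vs * b) [] r)) ` {r. hit r}"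
    by (force simp: hit_def)
qed

lemma run_sampler:
  assumes p: "p = run vs b enc Rs q (sampler_code (length vs)
      (est_code m (cover_list (length Rs) (\<lambda>_. m)) (map (cover_list (length Rs)) ps)))"
  shows "samples_uniformly vs b enc p (ans X D Q)"
    and "expected_time p \<le> ennreal (total_cost q * (1 + 2 * real (est []) / max 1 (card (ans X D Q))))"
proof -
  have hits: "hit r \<Longrightarrow> r < est []" for r
    unfolding hit_def by (rule walk_hit_less[OF est_bits_superadditive]) auto
  have inj: "inj_on (\<lambda>r. fst (walk est (length vs * b) [] r)) {r. hit r}"
    unfolding hit_def by (rule inj_onI, rule walk_inj[OF est_leaf_le_1]) auto
  note sc = sampler_correct[OF refl W_ge hits inj hits_image[symmetric] p[unfolded run_def]]
  show "samples_uniformly vs b enc p (ans X D Q)"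
    unfolding samples_uniformly_def using sc(1) uniform_or_empty_image[OF inj_enc_tuple] by simp
  show "expected_time p \<le> ennreal (total_cost q * (1 + 2 * real (est []) / max 1 (card (ans X D Q))))"
    using sc(2) card_image[OF inj_enc_tuple] by simp
qed

text \<open>With \<open>s i\<close> the logarithm of the size of relation \<open>i\<close>, some
  cover \<open>p\<close> of the list and some \<open>y\<close> satisfy the duality inequality. The
  estimate is at most the root of the product for \<open>p\<close>, hence at most \<open>exp\<close>
  of the sum of \<open>y\<close>, which the product query realises up to \<open>2 ^ card X\<close>.
  An estimate of 0 is set apart; otherwise no relation is empty and all logarithms are
  nonnegative.\<close>

lemma est_root_le_wc:
  assumes mem: "(D, Q) \<in> card_class X E' N"
  shows "of_nat (est []) \<le> 2 ^ card X * wc X (card_class X E' N)"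
proof (cases "est [] = 0")
  case False
  then have "\<forall>i<length Rs. cnt i [] > 0" using est_pos[of "[]"] by simp
  then have pos: "card (snd (Rs ! i)) > 0" if "i < length Rs" for i using that cnt_Nil by simp
  define s where "s i = ln (real (card (snd (Rs ! i))))" for i
  have "0 \<le> s i" if "i < length Rs" for i using pos[OF that] by (simp add: s_def)
  from dual[of s, OF this] obtain p y where p: "p \<in> set ps" and y0: "\<And>x. x \<in> X \<Longrightarrow> 0 \<le> y x"
    and y: "\<And>i. i < length Rs \<Longrightarrow> (\<Sum>x\<in>X \<inter> fst (Rs ! i). y x) \<le> s i"
    and le: "(\<Sum>i<length Rs. real (p i) * s i) \<le> real m * (\<Sum>x\<in>X. y x)" by auto
  have "est [] ^ m \<le> vmin []" unfolding est_def by (rule froot_power_le[OF m0])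
  also have "\<dots> \<le> vprod (cover_list (length Rs) p) []" unfolding vmin_eq using p by (intro Min_le) auto
  also have "\<dots> = (\<Prod>i<length Rs. card (snd (Rs ! i)) ^ p i)"
    unfolding vprod_cover_list by (intro prod.cong) (auto simp: cnt_Nil)
  finally have "real (est [] ^ m) \<le> real (\<Prod>i<length Rs. card (snd (Rs ! i)) ^ p i)"
    by (rule of_nat_mono)
  also have "\<dots> = (\<Prod>i<length Rs. exp (real (p i) * s i))"
    unfolding of_nat_prod using pos by (intro prod.cong) (auto simp: s_def exp_of_nat_mult)
  also have "\<dots> = exp (\<Sum>i<length Rs. real (p i) * s i)" by (simp add: exp_sum)
  also have "\<dots> \<le> exp (real m * (\<Sum>x\<in>X. y x))" using le by simp
  also have "\<dots> = exp (\<Sum>x\<in>X. y x) ^ m" by (rule exp_of_nat_mult)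
  finally have "real (est []) ^ m \<le> exp (\<Sum>x\<in>X. y x) ^ m" by simp
  then have "real (est []) \<le> exp (\<Sum>x\<in>X. y x)"
    using power_mono_iff[of "real (est [])" "exp (\<Sum>x\<in>X. y x)" m] m0 by simp
  then have "of_nat (est []) \<le> ennreal (exp (\<Sum>x\<in>X. y x))"
    by (simp add: ennreal_of_nat_eq_real_of_nat ennreal_leI)
  also have "\<dots> \<le> 2 ^ card X * wc X (card_class X E' N)"
  proof (rule product_query_le_wc[OF mem _ y0])
    show "snd (Rs ! i) \<noteq> {}" if "i < length Rs" for i using pos[OF that] by auto
    show "(\<Sum>x\<in>X \<inter> fst (Rs ! i). y x) \<le> ln (real (card (snd (Rs ! i))))" if "i < length Rs" for i
      using y[OF that] by (simp add: s_def)
  qed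
  finally show ?thesis .
qed simp

lemma est_root_le_1:
  assumes "card D \<le> 1"
  shows "est [] \<le> 1"
  using card_rel_le_1[OF assms] by (intro est_le_1[OF _ refl]) (simp add: cnt_Nil)

text \<open>Once \<open>D\<close> has two values, the factors \<open>card X\<close>,
  \<open>log 2 (card D)\<close> and \<open>card E'\<close> are at least 1 and only enlarge the
  bound. As \<open>D\<close> is the active domain, some value occurs in a relation, so
  \<open>X\<close> and \<open>E'\<close> are nonempty.\<close>

lemma iterations_le:
  assumes mem: "(D, Q) \<in> card_class X E' N" and D: "D = active_domain Q"
  shows "ennreal (1 + 2 * real (est []) / max 1 (card (ans X D Q))) \<le> ennreal (1 + 2 * 2 ^ card X) *
    max 1 (wc X (card_class X E' N) / of_nat (max 1 (card (ans X D Q))) * of_nat (card X) *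
      ennreal (log 2 (real (card D))) * of_nat (card E'))"
proof -
  let ?a = "max 1 (card (ans X D Q))"
  let ?wc = "wc X (card_class X E' N)"
  let ?B = "?wc / of_nat ?a * of_nat (card X) * ennreal (log 2 (real (card D))) * of_nat (card E')"
  let ?Z = "1 + 2 * 2 ^ card X :: real"
  show ?thesis
  proof (cases "card D \<le> 1")
    \<comment> \<open>The logarithm is 0 here, for empty \<open>D\<close> by the convention for
      \<open>log 2 0\<close>, so only the 1 of the maximum is available.\<close>
    case True
    have "real (est []) \<le> 1" using est_root_le_1[OF True] by simp
    then have "real (est []) / real ?a \<le> 1" by (simp add: divide_le_eq)
    moreover have "1 \<le> (2::real) ^ card X" by simp
    ultimately have "1 + 2 * real (est []) / real ?a \<le> ?Z" by linarith
    then have "ennreal (1 + 2 * real (est []) / real ?a) \<le> ennreal ?Z * 1" by (simp add: ennreal_leI)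
    also have "\<dots> \<le> ennreal ?Z * max 1 ?B" by (intro mult_left_mono) auto
    finally show ?thesis .
  next
    case False
    have E': "E' = fst ` Q" using mem by (simp add: card_class_def)
    have "X \<noteq> {}" "E' \<noteq> {}"
    proof -
      obtain d where "d \<in> D" using False by (cases "D = {}") auto
      then obtain R t x where R: "R \<in> Q" "t \<in> snd R" "x \<in> fst R" using D by (auto simp: active_domain_def)
      then show "E' \<noteq> {}" using E' by auto
      show "X \<noteq> {}" using R query by (auto simp: join_query_def)
    qed
    moreover have "finite X" "finite E'" using query E' by (auto simp: join_query_def)
    ultimately have "1 \<le> card X" "1 \<le> card E'" by (auto simp: Suc_le_eq card_gt_0_iff)
    then have one: "(1::ennreal) \<le> of_nat (card X)" "(1::ennreal) \<le> of_nat (card E')"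
      by (metis of_nat_1 of_nat_mono)+
    have "1 \<le> log 2 (real (card D))" using False by (simp add: le_log_iff)
    then have one': "(1::ennreal) \<le> ennreal (log 2 (real (card D)))" by simp
    have "?wc / of_nat ?a * 1 * 1 * 1 \<le> ?B" by (intro mult_mono one one' order_refl) auto
    then have B: "?wc / of_nat ?a \<le> ?B" by simp
    have "ennreal (2 * real (est []) / real ?a) = 2 * (of_nat (est []) / of_nat ?a)"
      by (simp add: ennreal_of_nat_eq_real_of_nat divide_ennreal ennreal_mult' flip: ennreal_numeral ennreal_mult'')
    also have "\<dots> \<le> 2 * ((2 ^ card X * ?wc) / of_nat ?a)"
      by (intro mult_left_mono divide_right_mono_ennreal est_root_le_wc[OF mem]) simp
    also have "\<dots> = ennreal (2 * 2 ^ card X) * (?wc / of_nat ?a)"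
      by (simp add: ennreal_times_divide ennreal_mult ennreal_power mult.assoc flip: ennreal_numeral)
    also have "\<dots> \<le> ennreal (2 * 2 ^ card X) * max 1 ?B"
      using B by (intro mult_left_mono) (auto simp: le_max_iff_disj)
    finally have 1: "ennreal (2 * real (est []) / real ?a) \<le> ennreal (2 * 2 ^ card X) * max 1 ?B" .
    have "ennreal (1 + 2 * real (est []) / real ?a) = 1 + ennreal (2 * real (est []) / real ?a)"
      by (simp add: ennreal_plus)
    also have "\<dots> \<le> 1 * max 1 ?B + ennreal (2 * 2 ^ card X) * max 1 ?B"
      using 1 by (intro add_mono) auto
    also have "\<dots> = ennreal ?Z * max 1 ?B"
      by (simp add: distrib_right ennreal_plus)
    finally show ?thesis .
  qed
qed

end

section \<open>Polylogarithmic bounds and the theorem\<close>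

lemma log_size_ge_1: "1 \<le> log_size D Q"
proof -
  have "log 2 2 \<le> log_size D Q" unfolding log_size_def
    by (subst log_le_cancel_iff) (auto simp: add_pos_nonneg sum_nonneg)
  then show ?thesis by simp
qed

lemma log_card_le_log_size: "log 2 (real (card D)) \<le> log_size D Q"
proof (cases "card D = 0")
  case True
  then show ?thesis using log_size_ge_1[of D Q] by (simp add: log_def)
next
  case False
  then show ?thesis unfolding log_size_def
    by (subst log_le_cancel_iff) (auto simp: add_pos_nonneg sum_nonneg)
qed

lemma size_le_log_size: "real (\<Sum>R\<in>Q. card (snd R)) \<le> 2 powr log_size D Q"
proof -
  have "2 powr log_size D Q = 2 + real (\<Sum>R\<in>Q. card (snd R)) + real (card D)"
    unfolding log_size_def by (subst powr_log_cancel) (auto simp: add_pos_nonneg sum_nonneg simp del: of_nat_sum)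
  then show ?thesis by simp
qed

text \<open>Products of \<open>J\<close> numbers \<open>2 ^ L\<close> are
  \<open>2 ^ (L * J)\<close>; one more in the exponent absorbs the added 1, the power
  \<open>m\<close> multiplies it, and 2 more pay for the factor 4. The bound is put as a multiple of
  \<open>L\<close> so that the word length is linear in the logarithm of the data size.\<close>

lemma estimator_word_size:
  fixes L J m :: nat
  assumes "L > 0" "m > 0" and W: "L * ((J + 1) * m + 2) \<le> W"
  shows "4 * ((2 ^ L) ^ J + 1) ^ m \<le> (2::nat) ^ W"
proof -
  have "((2::nat) ^ L) ^ J + 1 \<le> 2 ^ (L * J + 1)" by (simp add: power_mult[symmetric])
  then have "(((2::nat) ^ L) ^ J + 1) ^ m \<le> (2 ^ (L * J + 1)) ^ m" by (intro power_mono) auto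
  also have "\<dots> = 2 ^ ((L * J + 1) * m)" by (simp only: power_mult[symmetric])
  finally have "4 * (((2::nat) ^ L) ^ J + 1) ^ m \<le> 2 ^ ((L * J + 1) * m + 2)" by (simp add: power_add)
  also have "\<dots> \<le> 2 ^ W"
  proof (rule power_increasing)
    have "(L * J + 1) * m \<le> L * ((J + 1) * m)"
      using mult_right_mono[of "L * J + 1" "L * (J + 1)" m] assms(1) by (simp add: algebra_simps)
    moreover have "L * ((J + 1) * m + 2) = L * ((J + 1) * m) + L * 2" by (rule distrib_left)
    ultimately show "(L * J + 1) * m + 2 \<le> W" using W assms(1) by linarith
  qed simp
  finally show ?thesis .
qed

text \<open>The squared word length contributes the exponent 2, and one step, of cost linear in
  \<open>W\<close> and \<open>q\<close>, at most the exponent \<open>\<kappa> + 1\<close>: this is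
  the origin of \<open>\<kappa> + 3\<close>.\<close>

lemma total_cost_polylog:
  fixes \<l> :: real and T :: nat
  assumes l: "1 \<le> \<l>" and W: "real W \<le> 2 * w * \<l>" and q: "real q \<le> real \<kappa> * \<l> ^ \<kappa>"
    and T: "T \<le> W ^ 2 * K * step_cost q W" and W1: "1 \<le> W" and w: "0 \<le> w"
  shows "real T \<le> 4 * w ^ 2 * K * (10 * w + \<kappa>) * \<l> ^ (\<kappa> + 3)"
proof -
  have mono: "\<l> ^ a \<le> \<l> ^ c" if "a \<le> c" for a c using that l by (rule power_increasing)
  have "real (step_cost q W) \<le> 5 * W + q" using W1 by (simp add: step_cost_def)
  also have "\<dots> \<le> 10 * w * \<l> ^ 1 + \<kappa> * \<l> ^ \<kappa>" using W q by simp
  also have "\<dots> \<le> 10 * w * \<l> ^ (\<kappa> + 1) + \<kappa> * \<l> ^ (\<kappa> + 1)"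
    using w by (intro add_mono mult_left_mono mono) auto
  finally have C: "real (step_cost q W) \<le> (10 * w + \<kappa>) * \<l> ^ (\<kappa> + 1)" by (simp add: algebra_simps)
  have W2: "real W ^ 2 \<le> 4 * w ^ 2 * \<l> ^ 2"
    using power_mono[OF W, of 2] by (simp add: power_mult_distrib)
  have "real T \<le> real (W ^ 2 * K * step_cost q W)" using T by (rule of_nat_mono)
  also have "\<dots> = real W ^ 2 * K * step_cost q W" by simp
  also have "\<dots> \<le> (4 * w ^ 2 * \<l> ^ 2) * K * ((10 * w + \<kappa>) * \<l> ^ (\<kappa> + 1))"
    using W2 C l w by (intro mult_mono) auto
  also have "\<dots> = 4 * w ^ 2 * K * (10 * w + \<kappa>) * (\<l> ^ 2 * \<l> ^ (\<kappa> + 1))" by (simp only: mult_ac)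
  also have "\<l> ^ 2 * \<l> ^ (\<kappa> + 1) = \<l> ^ (\<kappa> + 3)" by (subst power_add[symmetric], rule arg_cong[where f = "power \<l>"]) simp
  finally show ?thesis .
qed

theorem theorem16:
  fixes \<beta> \<kappa> :: nat
  shows "\<exists>k::nat. \<forall>(X::'x set) E (vs::'x list) es.
    hypergraph X E \<and> \<Union>E = X \<and> distinct vs \<and> set vs = X \<and> set es = E \<longrightarrow>
    (\<exists>(P::prog) (c::real). \<forall>(N::'x set \<Rightarrow> nat) D Q Rs b enc q.
       (D, Q) \<in> card_class X E N \<and> D = active_domain Q \<and>
       distinct Rs \<and> set Rs = Q \<and> map fst Rs = es \<and>
       is_encoding D b enc \<and> real b \<le> real \<beta> * (1 + log 2 (real (card D))) \<and>
       real q \<le> real \<kappa> * log_size D Q ^ \<kappa> \<longrightarrow>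
       samples_uniformly vs b enc (run vs b enc Rs q P) (ans X D Q) \<and>
       expected_time (run vs b enc Rs q P) \<le>
         ennreal (c * log_size D Q ^ k) *
         max 1 (wc X (card_class X E N) / of_nat (max 1 (card (ans X D Q)))
                * of_nat (card X) * ennreal (log 2 (real (card D))) * of_nat (card E)))"
proof (intro exI[of _ "\<kappa> + 3"] allI impI)
  fix X :: "'x set" and E vs es
  assume H: "hypergraph X E \<and> \<Union>E = X \<and> distinct vs \<and> set vs = X \<and> set es = E"
  let ?r = "length es"
  have finX: "finite X" using H by (simp add: hypergraph_def)
  have "\<exists>i<?r. x \<in> es ! i" if x: "x \<in> X" for x
  proof -
    from H x obtain e where "e \<in> set es" "x \<in> e" by blast
    then show ?thesis by (metis in_set_conv_nth)
  qed
  from fractional_covers[OF finX this] obtain m :: nat and C :: "(nat \<Rightarrow> nat) set" where m: "m > 0" and "finite C"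
    and cover: "\<And>p x. p \<in> C \<Longrightarrow> x \<in> X \<Longrightarrow> m \<le> (\<Sum>i | i < ?r \<and> x \<in> es ! i. p i)"
    and dual: "\<And>s :: nat \<Rightarrow> real. (\<And>i. i < ?r \<Longrightarrow> 0 \<le> s i) \<Longrightarrow>
       \<exists>p\<in>C. \<exists>y. (\<forall>x\<in>X. 0 \<le> y x) \<and> (\<forall>i<?r. (\<Sum>x\<in>X \<inter> es ! i. y x) \<le> s i) \<and>
         (\<Sum>i<?r. real (p i) * s i) \<le> real m * (\<Sum>x\<in>X. y x)" by blast
  from finite_list[OF \<open>finite C\<close>] obtain ps where ps: "set ps = C" by blast
  define js0 where "js0 = cover_list ?r (\<lambda>_. m)"
  define jss where "jss = map (cover_list ?r) ps"
  \<comment> \<open>One more than the sum of the lengths: positive and at least each of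
    them.\<close>
  define J where "J = Suc (sum_list (map length (js0 # jss)))"
  \<comment> \<open>One summand for each demand on the word length: the encoded tuple, the encoded
    value, the number of variables, the relation indices, \<open>estimator_word_size\<close>, and
    the fixed cells and addresses.\<close>
  define w where "w = 2 * length vs * \<beta> + 2 * \<beta> + length vs + ?r + ((J + 1) * m + 2) + 40"
  define K where "K = 6 * (length jss * (3 * J + 4) + 3 * J + 13 + m) + 162"
  define c0 where "c0 = 4 * real w ^ 2 * K * (10 * real w + \<kappa>)"
  \<comment> \<open>Only the variable order and the hypergraph enter the program, so it is fixed
    before \<open>N\<close>, the query and the encoding.\<close>
  define P where "P = sampler_code (length vs) (est_code m js0 jss)"
  show "\<exists>(P::prog) (c::real). \<forall>(N::'x set \<Rightarrow> nat) D Q Rs b enc q.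
       (D, Q) \<in> card_class X E N \<and> D = active_domain Q \<and>
       distinct Rs \<and> set Rs = Q \<and> map fst Rs = es \<and>
       is_encoding D b enc \<and> real b \<le> real \<beta> * (1 + log 2 (real (card D))) \<and>
       real q \<le> real \<kappa> * log_size D Q ^ \<kappa> \<longrightarrow>
       samples_uniformly vs b enc (run vs b enc Rs q P) (ans X D Q) \<and>
       expected_time (run vs b enc Rs q P) \<le>
         ennreal (c * log_size D Q ^ (\<kappa> + 3)) *
         max 1 (wc X (card_class X E N) / of_nat (max 1 (card (ans X D Q)))
                * of_nat (card X) * ennreal (log 2 (real (card D))) * of_nat (card E))"
  proof (intro exI[of _ P] exI[of _ "c0 * (1 + 2 * 2 ^ card X)"] allI impI)
    fix N :: "'x set \<Rightarrow> nat" and D Q Rs b enc q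
    assume A: "(D, Q) \<in> card_class X E N \<and> D = active_domain Q \<and>
       distinct Rs \<and> set Rs = Q \<and> map fst Rs = es \<and>
       is_encoding D b enc \<and> real b \<le> real \<beta> * (1 + log 2 (real (card D))) \<and>
       real q \<le> real \<kappa> * log_size D Q ^ \<kappa>"
    then have mem: "(D, Q) \<in> card_class X E N" and D: "D = active_domain Q" by blast+
    let ?l = "log_size D Q"
    \<comment> \<open>The unit of the word length, rounded up to an integer; this at most doubles
      it, as the logarithm is at least 1. Every count is at most \<open>2 ^ L\<close>, and a value
      has at most \<open>2 * \<beta> * L\<close> bits.\<close>
    define L where "L = nat \<lceil>?l\<rceil>"
    have l1: "1 \<le> ?l" by (rule log_size_ge_1)
    have L: "?l \<le> real L" "real L \<le> 2 * ?l" using l1 unfolding L_def by linarith+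
    have L0: "L > 0" using L l1 by linarith
    define W where "W = L * w"
    have len: "length Rs = ?r" using A by auto
    have es: "fst (Rs ! i) = es ! i" if "i < ?r" for i
    proof -
      have "es ! i = map fst Rs ! i" using A by simp
      then show ?thesis using that len by simp
    qed
    have "real b \<le> real \<beta> * (1 + log 2 (real (card D)))" using A by blast
    also have "\<dots> \<le> real \<beta> * (2 * real L)"
      using log_card_le_log_size[of D Q] L l1 by (intro mult_left_mono) auto
    finally have "real b \<le> real (2 * \<beta> * L)" by (simp add: algebra_simps)
    then have b: "b \<le> L * (2 * \<beta>)" by (simp only: of_nat_le_iff mult_ac)
    have lenb: "length vs * b \<le> L * (2 * length vs * \<beta>)"
      using mult_left_mono[OF b, of "length vs"] by (simp add: mult_ac)
    have grow: "a \<le> L * a" for a using L0 by simp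
    have W_eq: "W = L * (2 * length vs * \<beta>) + L * (2 * \<beta>) + L * length vs + L * ?r + L * ((J + 1) * m + 2) + L * 40"
      by (simp add: W_def w_def algebra_simps)
    interpret encoded_query X vs D Q Rs b enc
    proof
      show "join_query X D Q" "\<Union> (fst ` Q) = X" using mem H by (simp_all add: card_class_def)
      show "distinct vs" "set vs = X" "set Rs = Q" "is_encoding D b enc" using A H by blast+
    qed
    have cnt: "count_access vs b enc Rs i v \<le> 2 ^ L" for i v
    proof -
      have "real (count_access vs b enc Rs i v) \<le> real (\<Sum>R\<in>Q. card (snd R))"
        using cnt_le by (rule of_nat_mono)
      also have "\<dots> \<le> 2 powr ?l" by (rule size_le_log_size)
      also have "\<dots> \<le> 2 powr real L" using L by simp
      also have "\<dots> = real (2 ^ L)" by (simp add: powr_realpow)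
      finally show ?thesis by (simp only: of_nat_le_iff)
    qed
    have est: "estimator (count_access vs b enc Rs) W (length vs * b) m (2 ^ L) J js0 jss"
    proof
      show "length vs * b + 40 \<le> W" using lenb grow[of 40] unfolding W_eq by linarith
      show "4 * ((2 ^ L) ^ J + 1) ^ m \<le> (2::nat) ^ W"
        by (rule estimator_word_size[OF L0 m]) (simp add: W_eq)
      show "i \<le> W" if "js \<in> set (js0 # jss)" "i \<in> set js" for js i
      proof -
        have "i < ?r" using that set_cover_list[of ?r] by (auto simp: js0_def jss_def)
        then show ?thesis using grow[of ?r] unfolding W_eq by linarith
      qed
      show "length js \<le> J" if "js \<in> set (js0 # jss)" for js
      proof -
        have "length js \<in> set (map length (js0 # jss))" using that by auto
        from member_le_sum_list[OF this] show ?thesis unfolding J_def by linarith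
      qed
    qed (use m cnt in \<open>auto simp: J_def\<close>)
    interpret encoded_query_covers X vs D Q Rs b enc m ps W "2 ^ L" J
    proof (intro encoded_query_covers.intro encoded_query_covers_axioms.intro)
      show "encoded_query X vs D Q Rs b enc" by unfold_locales
      show "m > 0" by (rule m)
      show "estimator (count_access vs b enc Rs) W (length vs * b) m (2 ^ L) J
          (cover_list (length Rs) (\<lambda>_. m)) (map (cover_list (length Rs)) ps)"
        using est by (simp only: js0_def jss_def len)
      show "b \<le> W" using b unfolding W_eq by linarith
      show "length vs \<le> W" using grow[of "length vs"] unfolding W_eq by linarith
      show "m \<le> (\<Sum>i | i < length Rs \<and> x \<in> fst (Rs ! i). p i)" if "p \<in> set ps" "x \<in> X" for p x
      proof -
        have "{i. i < length Rs \<and> x \<in> fst (Rs ! i)} = {i. i < ?r \<and> x \<in> es ! i}" using len es by auto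
        then show ?thesis using cover[of p x] that ps by simp
      qed
      fix s :: "nat \<Rightarrow> real" assume "\<And>i. i < length Rs \<Longrightarrow> 0 \<le> s i"
      then show "\<exists>p\<in>set ps. \<exists>y. (\<forall>x\<in>X. 0 \<le> y x) \<and> (\<forall>i<length Rs. (\<Sum>x\<in>X \<inter> fst (Rs ! i). y x) \<le> s i) \<and>
         (\<Sum>i<length Rs. real (p i) * s i) \<le> real m * (\<Sum>x\<in>X. y x)"
        using dual[of s] ps len es by simp
    qed
    have P_eq: "run vs b enc Rs q P = run vs b enc Rs q (sampler_code (length vs)
      (est_code m (cover_list (length Rs) (\<lambda>_. m)) (map (cover_list (length Rs)) ps)))"
      by (simp add: P_def js0_def jss_def len)
    have "est_time = length jss * (3 * J + 4) + 3 * J + 13 + m"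
      by (simp add: est_time_def jss_def)
    then have "total_cost q \<le> W ^ 2 * K * step_cost q W" using total_cost_le[of q] by (simp add: K_def)
    moreover have "real W \<le> 2 * real w * ?l"
      using mult_right_mono[OF L(2), of "real w"] by (simp add: W_def mult_ac)
    moreover have "1 \<le> W" using L0 by (simp add: W_def w_def)
    ultimately have cost: "real (total_cost q) \<le> c0 * ?l ^ (\<kappa> + 3)"
      unfolding c0_def using A l1 by (intro total_cost_polylog) auto
    let ?R = "max 1 (wc X (card_class X E N) / of_nat (max 1 (card (ans X D Q)))
                * of_nat (card X) * ennreal (log 2 (real (card D))) * of_nat (card E))"
    let ?I = "1 + 2 * real (est []) / real (max 1 (card (ans X D Q)))"
    have "expected_time (run vs b enc Rs q P) \<le> ennreal (total_cost q * ?I)"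
      by (rule run_sampler(2)[OF P_eq])
    also have "\<dots> = ennreal (total_cost q) * ennreal ?I" by (rule ennreal_mult) auto
    also have "\<dots> \<le> ennreal (c0 * ?l ^ (\<kappa> + 3)) * (ennreal (1 + 2 * 2 ^ card X) * ?R)"
      by (intro mult_mono ennreal_leI cost iterations_le[OF mem D]) auto
    also have "\<dots> = ennreal (c0 * (1 + 2 * 2 ^ card X) * ?l ^ (\<kappa> + 3)) * ?R"
    proof -
      have "0 \<le> c0 * ?l ^ (\<kappa> + 3)" using l1 by (simp add: c0_def)
      then have "ennreal (c0 * ?l ^ (\<kappa> + 3)) * ennreal (1 + 2 * 2 ^ card X) =
          ennreal (c0 * ?l ^ (\<kappa> + 3) * (1 + 2 * 2 ^ card X))" by (intro ennreal_mult[symmetric]) auto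
      then show ?thesis by (simp only: mult.assoc[symmetric]) (simp only: mult_ac)
    qed
    finally show "samples_uniformly vs b enc (run vs b enc Rs q P) (ans X D Q) \<and>
       expected_time (run vs b enc Rs q P) \<le> ennreal (c0 * (1 + 2 * 2 ^ card X) * ?l ^ (\<kappa> + 3)) * ?R"
      using run_sampler(1)[OF P_eq] by blast
  qed
qed

end
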